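(* Let $G$ be a finite group of order $n$ such that the largest prime divisor of $n$ is $p$. (1) For $p>7$, if there exists a positive integer $k\geq 4$ such that $$\psi_k(G) > \frac{1+15\cdot 2^k+20\cdot 3^k+24\cdot 5^k}{(1+2^k+2\cdot 4^k)(1+2\cdot 3^k)(1+4\cdot 5^k)}\,\psi_k(\mathbb{Z}_n),$$ then the group $G$ is solvable. (2) For $p=7$, if there exists a positive integer $k\geq 13$ such that $$\psi_k(G) > \frac{1+15\cdot 2^k+20\cdot 3^k+24\cdot 5^k}{(1+2^k+2\cdot 4^k)(1+2\cdot 3^k)(1+4\cdot 5^k)}\,\psi_k(\mathbb{Z}_n),$$ then the group $G$ is solvable.
   Context: For a finite group $G$ and a positive integer $k$, $\psi_k(G)=\sum_{g\in G} o(g)^k$, where $o(g)$ denotes the order of the element $g$. $\mathbb{Z}_n$ denotes the cyclic group of order $n$. *)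

theory Defs
  imports "HOL-Algebra.Algebra" "HOL-Computational_Algebra.Primes"
begin

definition psi :: "nat \<Rightarrow> ('a, 'b) monoid_scheme \<Rightarrow> nat"
  where "psi k G = (\<Sum>g\<in>carrier G. group.ord G g ^ k)"

end

theory Submission
  imports Defs "HOL-Number_Theory.Cong"
begin

text \<open>The constant is \<open>\<psi>\<^sub>k(A\<^sub>5) / \<psi>\<^sub>k(Z\<^sub>6\<^sub>0)\<close>, so the point is that \<open>A\<^sub>5\<close> maximises \<open>\<psi>\<^sub>k(G) / \<psi>\<^sub>k(Z\<^sub>n)\<close>
  among non-solvable groups \<open>G\<close>, where \<open>n\<close> is the order of \<open>G\<close>.

  Let \<open>i\<close> be the least index of a cyclic subgroup of \<open>G\<close>, so that \<open>\<psi>\<^sub>k(G) \<le> n (n / i)\<^sup>k\<close>. A group with a cyclic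
  subgroup of index at most 15 is solvable, unless the index is 12 and some cyclic normal subgroup \<open>K\<close> has a
  quotient of order 60. This is an induction on the index: if \<open>M\<close> is a maximal subgroup containing the cyclic
  one, then modulo the core of \<open>M\<close> a cyclic normal subgroup of \<open>M\<close> meets its conjugates outside \<open>M\<close> trivially,
  which leaves few possibilities; if \<open>M\<close> itself becomes cyclic, transfer gives a normal complement.
  In the exceptional case all elements of \<open>G/K\<close> have order at most 5, class sizes determine how many have each order,
  and summing over the cosets of \<open>K\<close> gives the bound.

  If \<open>i \<ge> 16\<close> and the bound fails, then comparing \<open>n\<^sup>k\<^sup>+\<^sup>1\<close> with \<open>\<psi>\<^sub>k(Z\<^sub>n)\<close> shows that the largest prime divisor \<open>p\<close> of
  \<open>n\<close> is at least 17 and exceeds \<open>i\<close>. The Sylow \<open>p\<close>-subgroup is then cyclic and normal, and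
  passing to the quotient by it gives a smaller counterexample.\<close>

section \<open>Groups with a solvable subgroup of small index\<close>

text \<open>Why 15 and 16: up to lower order terms \<open>psi_Z60 k\<close> is 2/3 of
  \<open>12 ^ k * psi_A5 k\<close>, and n^(k+1) / psi_k(Z_n) is at most the product of q/(q-1) over
  the primes q dividing n. If the bound fails, (i/12)^k is therefore less than about 2/3 of that
  product. When no prime exceeds 13 the product is at most 1001/192; for k = 4, after sharpening the
  factor at 2, i = 16 is the first index that this excludes, with little to spare. So the group
  theory has to reach index 15. If larger primes divide n, the product grows at most linearly in the
  largest one, which is too slow to allow an index that large.

  A_5 is never constructed and no list of simple groups is used. A nonsolvable group of order 60
  enters only through its element orders: an element of order above 5 would generate a subgroup of
  index below 12 = 60/5, the index at which the exception occurs. The least index drops out of reach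
  of the induction only through a large Sylow subgroup, and removing that subgroup multiplies both
  sides of the bound by the same factor.\<close>

lemma (in group) mem_generate_iff:
  assumes "finite (carrier G)" "x \<in> carrier G"
  shows "y \<in> generate G {x} \<longleftrightarrow> (\<exists>j::nat. y = x [^] j)"
  using generate_pow_on_finite_carrier[OF assms] by auto

lemma (in group) subgroup_generate_single:
  "x \<in> carrier G \<Longrightarrow> subgroup (generate G {x}) G"
  by (rule generate_is_subgroup) simp

lemma (in group) finite_subgroupI:
  assumes "finite (carrier G)" "H \<subseteq> carrier G" "H \<noteq> {}"
    and closed: "\<And>g h. g \<in> H \<Longrightarrow> h \<in> H \<Longrightarrow> g \<otimes> h \<in> H"
  shows "subgroup H G"
proof (rule subgroupI)
  fix g assume g: "g \<in> H"
  then have gG: "g \<in> carrier G" using assms(2) by blast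
  \<comment> \<open>Only positive powers are available, as \<open>\<one>\<close> is not yet known to
    lie in H; hence the separate case \<open>ord g = 1\<close> below.\<close>
  have pow: "g [^] Suc n \<in> H" for n :: nat
    by (induction n) (use g gG closed in auto)
  have o1: "ord g \<ge> 1" using ord_ge_1[OF assms(1) gG] .
  have "g [^] (ord g - 1) \<otimes> g = \<one>"
    using o1 gG pow_ord_eq_1[OF gG] by (metis Suc_diff_1 nat_pow_Suc not_one_le_zero not_gr0)
  then have inv: "inv g = g [^] (ord g - 1)"
    using gG by (simp add: inv_equality)
  show "inv g \<in> H"
  proof (cases "ord g = 1")
    case True
    then show ?thesis using g gG ord_eq_1[OF gG] by simp
  next
    case False
    then have "ord g - 1 = Suc (ord g - 2)" using o1 by simp
    then show ?thesis using inv pow by metis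
  qed
qed (use assms in auto)

lemma (in group) ord_subgroup:
  assumes "subgroup H G" "x \<in> H"
  shows "group.ord (G\<lparr>carrier := H\<rparr>) x = ord x"
proof -
  interpret H: group "G\<lparr>carrier := H\<rparr>" using subgroup_imp_group[OF assms(1)] .
  have x: "x \<in> carrier G" using assms subgroup.mem_carrier by fast
  have "x [^]\<^bsub>G\<lparr>carrier := H\<rparr>\<^esub> n = x [^] n" for n :: nat
    using nat_pow_consistent by metis
  then show ?thesis
    using H.ord_unique[of x "ord x"] assms(2) pow_eq_id[OF x] by simp
qed

lemma (in group_hom) ord_inj:
  assumes "inj_on h (carrier G)" "x \<in> carrier G"
  shows "group.ord H (h x) = group.ord G x"
proof -
  have "h x [^]\<^bsub>H\<^esub> n = \<one>\<^bsub>H\<^esub> \<longleftrightarrow> x [^] n = \<one>" for n :: nat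
    by (metis G.nat_pow_closed G.one_closed assms hom_nat_pow hom_one inj_on_eq_iff)
  then show ?thesis
    using H.ord_unique[of "h x" "G.ord x"] assms(2) G.pow_eq_id[OF assms(2)] by simp
qed

lemma (in group) comm_group_imp_solvable:
  assumes "\<And>x y. x \<in> carrier G \<Longrightarrow> y \<in> carrier G \<Longrightarrow> x \<otimes> y = y \<otimes> x"
  shows "solvable G"
proof -
  have "derived_set G (carrier G) \<subseteq> {\<one>}"
  proof
    fix z assume "z \<in> derived_set G (carrier G)"
    then obtain a b where ab: "a \<in> carrier G" "b \<in> carrier G" "z = a \<otimes> b \<otimes> inv a \<otimes> inv b"
      by auto
    have "a \<otimes> b \<otimes> inv a = b \<otimes> a \<otimes> inv a" using assms[OF ab(1,2)] by simp
    then have "z = b \<otimes> a \<otimes> inv a \<otimes> inv b" using ab by simp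
    then show "z \<in> {\<one>}" using ab by (simp add: m_assoc)
  qed
  then have "derived G (carrier G) \<subseteq> {\<one>}"
    unfolding derived_def by (rule generate_subgroup_incl[OF _ triv_subgroup])
  moreover have "\<one> \<in> derived G (carrier G)"
    using derived_is_subgroup[of "carrier G"] subgroup.one_closed by blast
  ultimately have "(derived G ^^ 1) (carrier G) = {\<one>}" by auto
  then show ?thesis
    using solvable_iff_trivial_derived_seq by blast
qed

lemma (in group) cyclic_imp_solvable:
  assumes "finite (carrier G)" "x \<in> carrier G" "order G = ord x"
  shows "solvable G"
proof -
  have "generate G {x} = carrier G"
  proof (rule card_subset_eq[OF assms(1)])
    show "generate G {x} \<subseteq> carrier G" using generate_incl[of "{x}"] assms(2) by simp
    show "card (generate G {x}) = card (carrier G)"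
      using assms(3) generate_pow_card[OF assms(2)] by (simp add: order_def)
  qed
  then have gen: "\<exists>j::nat. y = x [^] j" if "y \<in> carrier G" for y
    using mem_generate_iff[OF assms(1,2)] that by blast
  show ?thesis
  proof (rule comm_group_imp_solvable)
    fix a b assume "a \<in> carrier G" "b \<in> carrier G"
    then obtain i j :: nat where "a = x [^] i" "b = x [^] j" using gen by metis
    then show "a \<otimes> b = b \<otimes> a" using assms(2) by (simp add: nat_pow_mult add.commute)
  qed
qed

lemma (in group) cauchy:
  assumes "finite (carrier G)" "Factorial_Ring.prime p" "p dvd order G"
  obtains y where "y \<in> carrier G" "ord y = p"
proof -
  \<comment> \<open>\<open>sylow_thm\<close> does not require the cofactor m to be prime to p, so
    the exponent 1 yields a subgroup of order p.\<close>
  obtain m where "order G = p ^ 1 * m" using assms(3) by (auto elim: dvdE)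
  from sylow_thm[OF assms(2) group_axioms this assms(1)]
  obtain H where H: "subgroup H G" "card H = p" by auto
  have "card H > 1" using H assms(2) prime_gt_1_nat by simp
  then have "\<not> H \<subseteq> {\<one>}"
    using card_mono[of "{\<one>}" H] by auto
  then obtain y where y: "y \<in> H" "y \<noteq> \<one>" by blast
  interpret H: group "G\<lparr>carrier := H\<rparr>" using subgroup_imp_group[OF H(1)] .
  have yG: "y \<in> carrier G" using y H(1) subgroup.mem_carrier by fast
  have "ord y dvd p"
    using H.ord_dvd_group_order[of y] y(1) ord_subgroup[OF H(1) y(1)] H(2) by (simp add: order_def)
  moreover have "ord y \<noteq> 1" using ord_eq_1[OF yG] y(2) by simp
  ultimately have "ord y = p" using assms(2) by (auto simp: prime_nat_iff)
  with yG show ?thesis using that by blast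
qed

lemma (in group) prime_order_imp_solvable:
  assumes "Factorial_Ring.prime (order G)"
  shows "solvable G"
proof -
  have "0 < order G" using assms prime_gt_0_nat by blast
  then have fin: "finite (carrier G)" by (simp add: order_gt_0_iff_finite)
  obtain y where "y \<in> carrier G" "ord y = order G" by (rule cauchy[OF fin assms dvd_refl])
  then show ?thesis using cyclic_imp_solvable[OF fin] by simp
qed

section \<open>The permutation action on right cosets\<close>

lemma card_Bij:
  assumes "finite E"
  shows "card (Bij E) = fact (card E)"
proof -
  \<comment> \<open>Members of \<open>Bij E\<close> are undefined outside E, whereas those of
    \<open>permutes\<close> are the identity there; restriction translates between the two.\<close>
  have "bij_betw (\<lambda>f. restrict f E) {p. p permutes E} (Bij E)"
    unfolding bij_betw_def
  proof
    show "inj_on (\<lambda>f. restrict f E) {p. p permutes E}"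
    proof (rule inj_onI, rule ext)
      fix f g x assume a: "f \<in> {p. p permutes E}" "g \<in> {p. p permutes E}" "restrict f E = restrict g E"
      show "f x = g x"
      proof (cases "x \<in> E")
        case True then show ?thesis using a(3) by (metis restrict_apply')
      next
        case False then show ?thesis using a(1,2) by (simp add: permutes_def)
      qed
    qed
    show "(\<lambda>f. restrict f E) ` {p. p permutes E} = Bij E"
    proof
      show "(\<lambda>f. restrict f E) ` {p. p permutes E} \<subseteq> Bij E"
        by (auto simp: Bij_def permutes_imp_bij)
      show "Bij E \<subseteq> (\<lambda>f. restrict f E) ` {p. p permutes E}"
      proof
        fix f assume f: "f \<in> Bij E"
        define p where "p x = (if x \<in> E then f x else x)" for x
        have "bij_betw p E E"
          using f bij_betw_cong[of E p f E] by (simp add: p_def Bij_def)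
        then have "p permutes E" by (rule bij_imp_permutes) (simp add: p_def)
        moreover have "restrict p E = f"
          using f by (auto simp: Bij_def p_def extensional_def restrict_def fun_eq_iff)
        ultimately show "f \<in> (\<lambda>f. restrict f E) ` {p. p permutes E}" by blast
      qed
    qed
  qed
  then show ?thesis
    using bij_betw_same_card card_permutations[OF refl assms] by metis
qed

lemma order_BijGroup: "finite E \<Longrightarrow> order (BijGroup E) = fact (card E)"
  by (simp add: order_def BijGroup_def card_Bij)

definition core :: "('a, 'b) monoid_scheme \<Rightarrow> 'a set \<Rightarrow> 'a set"
  where "core G H = {z \<in> carrier G. \<forall>g\<in>carrier G. g \<otimes>\<^bsub>G\<^esub> z \<otimes>\<^bsub>G\<^esub> inv\<^bsub>G\<^esub> g \<in> H}"

text \<open>Multiplying on the right by the inverse makes this a homomorphism. It is restricted to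
  the cosets because \<open>BijGroup\<close> consists of extensional functions.\<close>

definition coset_action :: "('a, 'b) monoid_scheme \<Rightarrow> 'a set \<Rightarrow> 'a \<Rightarrow> 'a set \<Rightarrow> 'a set"
  where "coset_action G H g = (\<lambda>C \<in> rcosets\<^bsub>G\<^esub> H. C #>\<^bsub>G\<^esub> inv\<^bsub>G\<^esub> g)"

lemma (in group) coset_mult_closed:
  assumes "subgroup H G" "C \<in> rcosets H" "g \<in> carrier G"
  shows "C #> g \<in> rcosets H"
proof -
  obtain a where "a \<in> carrier G" "C = H #> a" using assms(2) by (auto simp: RCOSETS_def)
  then show ?thesis
    using assms subgroup.subset[OF assms(1)] by (simp add: coset_mult_assoc rcosetsI)
qed

lemma (in group) rcoset_subset:
  assumes "subgroup H G" "C \<in> rcosets H" shows "C \<subseteq> carrier G"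
  using subgroup.rcosets_carrier[OF assms(1) group_axioms assms(2)] .

lemma (in group) coset_action_hom:
  assumes "subgroup H G"
  shows "group_hom G (BijGroup (rcosets H)) (coset_action G H)"
proof -
  have bij: "coset_action G H g \<in> Bij (rcosets H)" if g: "g \<in> carrier G" for g
  proof -
    have "bij_betw (\<lambda>C. C #> inv g) (rcosets H) (rcosets H)"
      by (rule bij_betw_byWitness[where f' = "\<lambda>C. C #> g"])
        (use g assms rcoset_subset[OF assms] in \<open>auto simp: coset_mult_closed coset_mult_assoc\<close>)
    then show ?thesis
      by (simp add: Bij_def coset_action_def cong: bij_betw_cong)
  qed
  have "coset_action G H (g \<otimes> h) = coset_action G H g \<otimes>\<^bsub>BijGroup (rcosets H)\<^esub> coset_action G H h"
    if "g \<in> carrier G" "h \<in> carrier G" for g h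
  proof -
    have "compose (rcosets H) (coset_action G H g) (coset_action G H h) = coset_action G H (g \<otimes> h)"
    proof (rule ext)
      fix C
      show "compose (rcosets H) (coset_action G H g) (coset_action G H h) C = coset_action G H (g \<otimes> h) C"
        using that assms rcoset_subset[OF assms, of C]
        by (auto simp: compose_def coset_action_def coset_mult_closed coset_mult_assoc inv_mult_group)
    qed
    then show ?thesis using bij that by (simp add: BijGroup_def)
  qed
  then have "coset_action G H \<in> hom G (BijGroup (rcosets H))"
    using bij by (auto simp: hom_def BijGroup_def)
  then show ?thesis
    by (simp add: group_hom_def group_hom_axioms_def group_BijGroup group_axioms)
qed

lemma (in group) core_subset:
  assumes "subgroup H G" shows "core G H \<subseteq> H"
proof
  fix z assume "z \<in> core G H"
  then have z: "\<forall>g\<in>carrier G. g \<otimes> z \<otimes> inv g \<in> H" "z \<in> carrier G" by (auto simp: core_def)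
  from bspec[OF z(1) one_closed] z(2) show "z \<in> H" by simp
qed

lemma (in group) kernel_coset_action:
  assumes "subgroup H G"
  shows "kernel G (BijGroup (rcosets H)) (coset_action G H) = core G H"
proof -
  interpret subgroup H G by fact
  \<comment> \<open>z fixes the coset of a exactly when its conjugate by a lies in H, so fixing all
    cosets is the defining condition of \<open>core\<close>.\<close>
  have key: "(H #> a) #> inv z = H #> a \<longleftrightarrow> a \<otimes> z \<otimes> inv a \<in> H"
    if "z \<in> carrier G" "a \<in> carrier G" for z a
  proof -
    have "(H #> a) #> inv z = H #> (a \<otimes> inv z)" using that by (simp add: coset_mult_assoc subset)
    moreover have "H #> (a \<otimes> inv z) = H #> a \<longleftrightarrow> a \<in> H #> (a \<otimes> inv z)"
    proof
      assume "H #> (a \<otimes> inv z) = H #> a"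
      then show "a \<in> H #> (a \<otimes> inv z)" using rcos_self[OF that(2) assms] by simp
    next
      assume "a \<in> H #> (a \<otimes> inv z)"
      from repr_independence[OF this _ assms] that show "H #> (a \<otimes> inv z) = H #> a" by simp
    qed
    moreover have "a \<in> H #> (a \<otimes> inv z) \<longleftrightarrow> a \<otimes> inv (a \<otimes> inv z) \<in> H"
      using rcos_module[OF group_axioms, of "a \<otimes> inv z" a] that by simp
    moreover have "a \<otimes> inv (a \<otimes> inv z) = a \<otimes> z \<otimes> inv a"
      using that by (simp add: inv_mult_group m_assoc)
    ultimately show ?thesis by simp
  qed
  have "coset_action G H z = \<one>\<^bsub>BijGroup (rcosets H)\<^esub> \<longleftrightarrow> (\<forall>g\<in>carrier G. g \<otimes> z \<otimes> inv g \<in> H)"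
    if z: "z \<in> carrier G" for z
  proof -
    have "coset_action G H z = \<one>\<^bsub>BijGroup (rcosets H)\<^esub> \<longleftrightarrow> (\<forall>C\<in>(rcosets H). C #> inv z = C)"
    proof
      assume eq: "coset_action G H z = \<one>\<^bsub>BijGroup (rcosets H)\<^esub>"
      show "\<forall>C\<in>(rcosets H). C #> inv z = C"
      proof
        fix C assume "C \<in> rcosets H"
        then show "C #> inv z = C" using fun_cong[OF eq, of C] by (simp add: BijGroup_def coset_action_def)
      qed
    qed (auto simp: BijGroup_def coset_action_def fun_eq_iff restrict_def)
    also have "\<dots> \<longleftrightarrow> (\<forall>a\<in>carrier G. (H #> a) #> inv z = H #> a)"
      by (auto simp: RCOSETS_def)
    finally show ?thesis using key[OF z] by auto
  qed
  then show ?thesis by (auto simp: kernel_def core_def)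
qed

lemma (in group) normal_core:
  assumes "subgroup H G" shows "core G H \<lhd> G"
  using group_hom.normal_kernel[OF coset_action_hom[OF assms]] kernel_coset_action[OF assms] by simp

text \<open>The quotient by the core is isomorphic to the image of \<open>coset_action\<close>, a
  subgroup of the permutation group of the cosets, to which Lagrange applies.\<close>

lemma (in group) order_Mod_core_dvd:
  assumes "finite (carrier G)" "subgroup H G"
  shows "order (G Mod core G H) dvd fact (card (rcosets H))"
proof -
  let ?B = "BijGroup (rcosets H)"
  interpret h: group_hom G ?B "coset_action G H" using coset_action_hom[OF assms(2)] .
  have finE: "finite (rcosets H)"
    using assms rcosets_subset_PowG[OF assms(2)] finite_subset by blast
  let ?I = "coset_action G H ` carrier G"
  have I: "subgroup ?I ?B" by (rule h.img_is_subgroup)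
  have "bij_betw (\<lambda>C. the_elem (coset_action G H ` C)) (carrier (G Mod kernel G ?B (coset_action G H))) ?I"
  proof -
    have "group_hom G (?B\<lparr>carrier := ?I\<rparr>) (coset_action G H)"
      using h.H.subgroup_imp_group[OF I]
      by (auto simp: group_hom_def group_hom_axioms_def group_axioms hom_def)
    from group_hom.FactGroup_iso_set[OF this]
    have "(\<lambda>C. the_elem (coset_action G H ` C)) \<in> iso (G Mod kernel G (?B\<lparr>carrier := ?I\<rparr>) (coset_action G H)) (?B\<lparr>carrier := ?I\<rparr>)"
      by simp
    then show ?thesis by (simp add: iso_def kernel_def)
  qed
  then have "order (G Mod core G H) = card ?I"
    using bij_betw_same_card kernel_coset_action[OF assms(2)] by (simp add: order_def)
  moreover have "card ?I dvd order ?B"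
    by (simp flip: h.H.lagrange[OF I])
  ultimately show ?thesis using order_BijGroup[OF finE] by simp
qed

lemma (in group) solvable_of_normal:
  assumes "L \<lhd> G" "solvable (G\<lparr>carrier := L\<rparr>)" "solvable (G Mod L)"
  shows "solvable G"
proof -
  interpret L: normal L G by fact
  have 1: "group_hom (G\<lparr>carrier := L\<rparr>) G id"
    using subgroup_imp_group[OF L.subgroup_axioms] L.subset
    by (auto simp: group_hom_def group_hom_axioms_def group_axioms hom_def)
  have 2: "group_hom G (G Mod L) (\<lambda>a. L #> a)"
    using L.factorgroup_is_group L.r_coset_hom_Mod
    by (auto simp: group_hom_def group_hom_axioms_def group_axioms)
  have 3: "kernel G (G Mod L) (\<lambda>a. L #> a) \<subseteq> L"
    using coset_join1[OF _ _ L.subgroup_axioms] by (auto simp: kernel_def)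
  show ?thesis
    by (rule solvable_condition[OF 1 2]) (use 3 assms in \<open>auto simp: carrier_FactGroup\<close>)
qed

lemma (in group) solvable_subgroup':
  assumes "subgroup H G" "solvable G" shows "solvable (G\<lparr>carrier := H\<rparr>)"
proof -
  have "group_hom (G\<lparr>carrier := H\<rparr>) G id"
    using subgroup_imp_group[OF assms(1)] subgroup.subset[OF assms(1)]
    by (auto simp: group_hom_def group_hom_axioms_def group_axioms hom_def)
  then show ?thesis
    by (rule group_hom.inj_hom_imp_solvable) (use assms(2) in auto)
qed

lemma (in group) solvable_subgroup_mono:
  assumes "subgroup H G" "subgroup K G" "K \<subseteq> H" "solvable (G\<lparr>carrier := H\<rparr>)"
  shows "solvable (G\<lparr>carrier := K\<rparr>)"
proof -
  interpret H: group "G\<lparr>carrier := H\<rparr>" using subgroup_imp_group[OF assms(1)] .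
  have "subgroup K (G\<lparr>carrier := H\<rparr>)" using subgroup_incl[OF assms(2,1,3)] .
  from H.solvable_subgroup'[OF this assms(4)] show ?thesis by simp
qed

text \<open>G is an extension of the core, solvable as a subgroup of H, by its image in the
  permutation group of the cosets, solvable as a subgroup of that group.\<close>

lemma (in group) solvable_of_index:
  assumes "subgroup H G" "solvable (G\<lparr>carrier := H\<rparr>)" "solvable (BijGroup (rcosets H))"
  shows "solvable G"
proof -
  let ?B = "BijGroup (rcosets H)" and ?f = "coset_action G H"
  interpret h: group_hom G ?B ?f using coset_action_hom[OF assms(1)] .
  interpret L: normal "core G H" G using normal_core[OF assms(1)] .
  let ?K = "?B\<lparr>carrier := ?f ` carrier G\<rparr>"
  have I: "subgroup (?f ` carrier G) ?B" by (rule h.img_is_subgroup)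
  have K: "solvable ?K" using h.H.solvable_subgroup'[OF I assms(3)] .
  have L: "solvable (G\<lparr>carrier := core G H\<rparr>)"
    by (rule solvable_subgroup_mono[OF assms(1) L.subgroup_axioms core_subset[OF assms(1)] assms(2)])
  have 1: "group_hom (G\<lparr>carrier := core G H\<rparr>) G id"
    using subgroup_imp_group[OF L.subgroup_axioms] L.subset
    by (auto simp: group_hom_def group_hom_axioms_def group_axioms hom_def)
  have 2: "group_hom G ?K ?f"
    using h.H.subgroup_imp_group[OF I]
    by (auto simp: group_hom_def group_hom_axioms_def group_axioms hom_def)
  have 3: "kernel G ?K ?f = core G H"
    using kernel_coset_action[OF assms(1)] by (simp add: kernel_def)
  show ?thesis
    by (rule solvable_condition[OF 1 2 _ _ L K]) (use 3 in auto)
qed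

lemma (in group) finite_rcosets:
  assumes "finite (carrier G)" "subgroup H G" shows "finite (rcosets H)"
  using assms rcosets_subset_PowG[OF assms(2)] finite_subset by blast

section \<open>Subgroups of index at most four and some small orders\<close>

lemma (in group) solvable_of_index_two:
  assumes "finite (carrier G)" "subgroup H G" "order G = 2 * card H" "solvable (G\<lparr>carrier := H\<rparr>)"
  shows "solvable G"
proof (rule solvable_of_index[OF assms(2,4)])
  interpret B: group "BijGroup (rcosets H)" by (rule group_BijGroup)
  have "card H > 0" using assms(2) subgroup.finite_imp_card_positive[OF assms(2,1)] by simp
  then have "card (rcosets H) = 2" using lagrange[OF assms(2)] assms(3) by simp
  then have "order (BijGroup (rcosets H)) = 2"
    using order_BijGroup[OF finite_rcosets[OF assms(1,2)]] by simp
  then show "solvable (BijGroup (rcosets H))" using B.prime_order_imp_solvable by simp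
qed

text \<open>\<open>sylow_thm\<close> also gives p-subgroups that are not maximal, here one of index
  two.\<close>

lemma two_power_order_imp_solvable:
  "group G \<Longrightarrow> order G = 2 ^ a \<Longrightarrow> solvable G"
proof (induction a arbitrary: G)
  case 0
  interpret group G by fact
  have "order G = ord \<one>\<^bsub>G\<^esub>" using 0 by simp
  moreover have "finite (carrier G)" using 0 order_gt_0_iff_finite by simp
  ultimately show ?case using cyclic_imp_solvable by blast
next
  case (Suc a)
  interpret group G by fact
  have fin: "finite (carrier G)" using Suc.prems order_gt_0_iff_finite by simp
  obtain H where H: "subgroup H G" "card H = 2 ^ a"
    using sylow_thm[of 2 G a 2] Suc.prems fin by auto
  show ?case
    by (rule solvable_of_index_two[OF fin H(1)])
      (use H Suc subgroup_imp_group[OF H(1)] in \<open>auto simp: order_def\<close>)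
qed

lemma order_six_imp_solvable:
  assumes "group G" "order G = 6" shows "solvable G"
proof -
  interpret group G by fact
  have fin: "finite (carrier G)" using assms order_gt_0_iff_finite by simp
  obtain H where H: "subgroup H G" "card H = 3"
    using sylow_thm[of 3 G 1 2] assms fin by auto
  show ?thesis
  proof (rule solvable_of_index_two[OF fin H(1)])
    show "solvable (G\<lparr>carrier := H\<rparr>)"
      by (rule group.prime_order_imp_solvable) (use H subgroup_imp_group in \<open>auto simp: order_def\<close>)
  qed (use H assms in simp)
qed

lemma (in group) solvable_of_index_three:
  assumes "finite (carrier G)" "subgroup H G" "order G = 3 * card H" "solvable (G\<lparr>carrier := H\<rparr>)"
  shows "solvable G"
proof (rule solvable_of_index[OF assms(2,4)])
  have "card H > 0" using assms(2) subgroup.finite_imp_card_positive[OF assms(2,1)] by simp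
  then have "card (rcosets H) = 3" using lagrange[OF assms(2)] assms(3) by simp
  then have "order (BijGroup (rcosets H)) = 6"
    using order_BijGroup[OF finite_rcosets[OF assms(1,2)]] by (simp add: fact_numeral)
  then show "solvable (BijGroup (rcosets H))" using order_six_imp_solvable group_BijGroup by blast
qed

text \<open>A Sylow 2-subgroup has index three. Order 24 is that of the permutation group of four
  cosets; 12, 24 and 48 recur when a maximal subgroup of index six is examined.\<close>

lemma (in group) solvable_of_two_power_index_three:
  assumes "order G = 2 ^ a * 3" shows "solvable G"
proof -
  have fin: "finite (carrier G)" using assms order_gt_0_iff_finite by simp
  obtain H where H: "subgroup H G" "card H = 2 ^ a"
    using sylow_thm[of 2 G a 3] assms fin group_axioms by auto
  have "solvable (G\<lparr>carrier := H\<rparr>)"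
    by (rule two_power_order_imp_solvable) (use H subgroup_imp_group in \<open>auto simp: order_def\<close>)
  then show ?thesis using solvable_of_index_three[OF fin H(1)] H(2) assms by simp
qed

lemma (in group) solvable_of_index_four:
  assumes "finite (carrier G)" "subgroup H G" "order G = 4 * card H" "solvable (G\<lparr>carrier := H\<rparr>)"
  shows "solvable G"
proof (rule solvable_of_index[OF assms(2,4)])
  interpret B: group "BijGroup (rcosets H)" by (rule group_BijGroup)
  have "card H > 0" using assms(2) subgroup.finite_imp_card_positive[OF assms(2,1)] by simp
  then have "card (rcosets H) = 4" using lagrange[OF assms(2)] assms(3) by simp
  then have "order (BijGroup (rcosets H)) = 2 ^ 3 * 3"
    using order_BijGroup[OF finite_rcosets[OF assms(1,2)]] by (simp add: fact_numeral)
  then show "solvable (BijGroup (rcosets H))" using B.solvable_of_two_power_index_three by blast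
qed

lemma (in group) solvable_of_index_le_four:
  assumes "finite (carrier G)" "subgroup H G" "order G = d * card H" "d \<le> 4" "solvable (G\<lparr>carrier := H\<rparr>)"
  shows "solvable G"
proof -
  have "order G > 0" using assms(1) order_gt_0_iff_finite by simp
  then have "d = 1 \<or> d = 2 \<or> d = 3 \<or> d = 4" using assms(3,4) by (cases "d = 0") auto
  then show ?thesis
  proof (elim disjE)
    assume "d = 1"
    then have "H = carrier G"
      using assms(1,3) subgroup.subset[OF assms(2)] by (simp add: card_subset_eq order_def)
    then show ?thesis using assms(5) by (simp add: solvable_iff_trivial_derived_seq)
  qed (use solvable_of_index_two solvable_of_index_three solvable_of_index_four assms in auto)
qed

text \<open>A Sylow 3-subgroup has index four, and it contains a subgroup of order 3 and index
  three.\<close>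

lemma (in group) order_36_imp_solvable:
  assumes "order G = 36" shows "solvable G"
proof -
  have fin: "finite (carrier G)" using assms order_gt_0_iff_finite by simp
  obtain H where H: "subgroup H G" "card H = 9"
    using sylow_thm[of 3 G 2 4] assms fin group_axioms by auto
  interpret H: group "G\<lparr>carrier := H\<rparr>" using subgroup_imp_group[OF H(1)] .
  have finH: "finite (carrier (G\<lparr>carrier := H\<rparr>))" using H(2) by (simp add: card_ge_0_finite)
  obtain K where K: "subgroup K (G\<lparr>carrier := H\<rparr>)" "card K = 3"
    using sylow_thm[of 3 "G\<lparr>carrier := H\<rparr>" 1 3] H finH H.group_axioms by (auto simp: order_def)
  interpret K: group "G\<lparr>carrier := H, carrier := K\<rparr>" using H.subgroup_imp_group[OF K(1)] .
  have "solvable (G\<lparr>carrier := H, carrier := K\<rparr>)"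
    by (rule K.prime_order_imp_solvable) (use K in \<open>simp add: order_def\<close>)
  then have "solvable (G\<lparr>carrier := H\<rparr>)"
    using H.solvable_of_index_three[OF finH K(1)] H K by (simp add: order_def)
  then show ?thesis using solvable_of_index_four[OF fin H(1)] H(2) assms by simp
qed

text \<open>Copies the group along an injection into the naturals. \<open>image_group\<close> is
  reached through weak morphisms, whose condition for the kernel \<open>{\<one>}\<close> is just
  injectivity.\<close>

lemma (in group) ex_nat_group:
  assumes "finite (carrier G)"
  obtains N :: "nat monoid" and f where "group N" "group_hom G N f" "bij_betw f (carrier G) (carrier N)"
proof -
  obtain f :: "'a \<Rightarrow> nat" where f: "inj_on f (carrier G)"
    using finite_imp_inj_to_nat_seg[OF assms] by blast
  have "weak_group_morphism f {\<one>} G"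
  proof (rule weak_group_morphismsI[OF one_is_normal])
    fix a b assume ab: "a \<in> carrier G" "b \<in> carrier G"
    have "f a = f b \<longleftrightarrow> a = b" using f ab by (simp add: inj_on_eq_iff)
    also have "\<dots> \<longleftrightarrow> a \<otimes> inv b \<in> {\<one>}" using ab
      by (metis inv_closed inv_equality inv_inv r_inv singleton_iff)
    finally show "f a = f b \<longleftrightarrow> a \<otimes> inv b \<in> {\<one>}" .
  qed
  then have "group_hom G (image_group f G) f" by (rule weak_group_morphism_group_hom)
  moreover have "bij_betw f (carrier G) (carrier (image_group f G))"
    using f by (simp add: bij_betw_def image_group_carrier)
  ultimately show ?thesis using that group_hom.axioms(2) by blast
qed

section \<open>Cyclic subgroups of maximal subgroups\<close>

lemma (in group) conj_pow:
  assumes "g \<in> carrier G" "u \<in> carrier G"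
  shows "(g \<otimes> u \<otimes> inv g) [^] (n::nat) = g \<otimes> u [^] n \<otimes> inv g"
proof (induction n)
  case 0 show ?case using assms by simp
next
  case (Suc n)
  have "g \<otimes> u [^] n \<otimes> inv g \<otimes> (g \<otimes> u \<otimes> inv g) = g \<otimes> u [^] n \<otimes> (inv g \<otimes> g) \<otimes> u \<otimes> inv g"
    using assms by (simp only: m_assoc m_closed inv_closed nat_pow_closed)
  also have "\<dots> = g \<otimes> (u [^] n \<otimes> u) \<otimes> inv g" using assms by (simp add: m_assoc)
  finally show ?case using Suc by simp
qed

lemma (in group) conj_eq_one_iff:
  assumes "g \<in> carrier G" "u \<in> carrier G"
  shows "g \<otimes> u \<otimes> inv g = \<one> \<longleftrightarrow> u = \<one>"
proof
  assume "g \<otimes> u \<otimes> inv g = \<one>"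
  then have "g \<otimes> u \<otimes> inv g = g \<otimes> \<one> \<otimes> inv g" using assms by simp
  then show "u = \<one>" using conjugation_is_inj[OF assms one_closed] by blast
qed (use assms in simp)

lemma (in group) ord_conj:
  assumes "g \<in> carrier G" "u \<in> carrier G"
  shows "ord (g \<otimes> u \<otimes> inv g) = ord u"
proof -
  have c: "g \<otimes> u \<otimes> inv g \<in> carrier G" using assms by simp
  have "(g \<otimes> u \<otimes> inv g) [^] n = \<one> \<longleftrightarrow> ord u dvd n" for n :: nat
    using assms conj_pow conj_eq_one_iff pow_eq_id by simp
  then show ?thesis using ord_unique[OF c] by simp
qed

text \<open>A cyclic group has only one subgroup of each order. For powers u and v of x with
  exponents a and b, the order condition makes gcd(ord x, a) divide b, and Bezout writes that gcd as
  a multiple of a modulo \<open>ord x\<close>.\<close>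

lemma (in group) mem_generate_of_ord_dvd:
  assumes fin: "finite (carrier G)" and x: "x \<in> carrier G"
    and "u \<in> generate G {x}" "v \<in> generate G {x}" "ord v dvd ord u"
  shows "v \<in> generate G {u}"
proof -
  obtain a b :: nat where u: "u = x [^] a" and v: "v = x [^] b"
    using assms mem_generate_iff[OF fin x] by blast
  have uc: "u \<in> carrier G" and vc: "v \<in> carrier G" using u v x by auto
  have n: "ord x > 0" using ord_ge_1[OF fin x] by simp
  have ou: "ord u = ord x div gcd (ord x) a" using ord_pow_gen[OF x, of a] n u by auto
  have "v [^] ord u = \<one>" using assms(5) pow_eq_id[OF vc] by blast
  then have "ord x dvd b * ord u" using x v pow_eq_id[OF x] by (simp add: nat_pow_pow)
  moreover have "ord x = gcd (ord x) a * ord u" using ou by simp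
  moreover have "ord u > 0" using ord_ge_1[OF fin uc] by simp
  ultimately have "gcd (ord x) a dvd b"
    using nat_mult_dvd_cancel1[of "ord u" "gcd (ord x) a" b] by (simp only: mult.commute[of _ "ord u"])
  then obtain c where c: "b = gcd (ord x) a * c" by (auto elim: dvdE)
  show ?thesis
  \<comment> \<open>\<open>bezout_nat\<close> needs a nonzero exponent; for a = 0 the gcd is
    \<open>ord x\<close>, so v is trivial.\<close>
  proof (cases "a = 0")
    case True
    then have "v = \<one>" using c v x pow_eq_id[OF x] by simp
    then show ?thesis by (simp add: generate.one)
  next
    case False
    obtain s t where st: "a * s = ord x * t + gcd a (ord x)" using bezout_nat[OF False] by blast
    have "u [^] (s * c) = x [^] (a * s * c)" using u x by (simp add: nat_pow_pow mult.assoc)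
    also have "a * s * c = ord x * (t * c) + b"
      using st c by (simp add: algebra_simps gcd.commute)
    also have "x [^] (ord x * (t * c) + b) = (x [^] ord x) [^] (t * c) \<otimes> x [^] b"
      by (simp only: nat_pow_mult[OF x, symmetric] nat_pow_pow[OF x])
    also have "\<dots> = v" using x v by simp
    finally show ?thesis using mem_generate_iff[OF fin uc] by metis
  qed
qed

definition maximal_subgroup :: "'a set \<Rightarrow> ('a, 'b) monoid_scheme \<Rightarrow> bool"
  where "maximal_subgroup M G \<longleftrightarrow> subgroup M G \<and> M \<noteq> carrier G \<and>
    (\<forall>N. subgroup N G \<longrightarrow> M \<subseteq> N \<longrightarrow> N = M \<or> N = carrier G)"

text \<open>By uniqueness of subgroups of a cyclic group, M normalizes
  \<open>generate G {u}\<close>, and so does g if it conjugates u into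
  \<open>generate G {x}\<close>. By maximality all of G normalizes it; it lies in M, hence in the
  trivial core.\<close>

lemma (in group) malnormal_of_maximal:
  assumes fin: "finite (carrier G)" and M: "maximal_subgroup M G" and core: "core G M = {\<one>}"
    and x: "x \<in> M" and conj: "\<And>h. h \<in> M \<Longrightarrow> h \<otimes> x \<otimes> inv h \<in> generate G {x}"
    and g: "g \<in> carrier G" "g \<notin> M" and u: "u \<in> generate G {x}" "g \<otimes> u \<otimes> inv g \<in> generate G {x}"
  shows "u = \<one>"
proof -
  have MG: "subgroup M G" using M by (simp add: maximal_subgroup_def)
  interpret M: subgroup M G by fact
  have xG: "x \<in> carrier G" using x by simp
  have AM: "generate G {x} \<subseteq> M" using x MG by (simp add: generate_subgroup_incl)
  have uG: "u \<in> carrier G" using u AM by auto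
  have uM: "generate G {u} \<subseteq> M" using u AM MG by (intro generate_subgroup_incl) auto
  \<comment> \<open>The normalizer of \<open>generate G {u}\<close>, tested on the generator
    alone.\<close>
  define N where "N = {g \<in> carrier G. g \<otimes> u \<otimes> inv g \<in> generate G {u}}"
  have inN: "h \<in> N" if h: "h \<in> carrier G" "h \<otimes> u \<otimes> inv h \<in> generate G {x}" for h
    using mem_generate_of_ord_dvd[OF fin xG u(1) h(2)] ord_conj[OF h(1) uG] h(1) by (simp add: N_def)
  have "M \<subseteq> N"
  proof
    fix h assume h: "h \<in> M"
    obtain j :: nat where j: "u = x [^] j" using u(1) mem_generate_iff[OF fin xG] by blast
    obtain s :: nat where s: "h \<otimes> x \<otimes> inv h = x [^] s" using conj[OF h] mem_generate_iff[OF fin xG] by blast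
    have "h \<otimes> u \<otimes> inv h = x [^] (s * j)"
      using conj_pow[of h x j] h xG j s by (simp add: nat_pow_pow)
    then have "h \<otimes> u \<otimes> inv h \<in> generate G {x}" using mem_generate_iff[OF fin xG] by blast
    then show "h \<in> N" using inN h by simp
  qed
  have "subgroup N G"
  proof (rule finite_subgroupI[OF fin])
    fix a b assume ab: "a \<in> N" "b \<in> N"
    then have abG: "a \<in> carrier G" "b \<in> carrier G" by (auto simp: N_def)
    obtain s t :: nat where s: "a \<otimes> u \<otimes> inv a = u [^] s" and t: "b \<otimes> u \<otimes> inv b = u [^] t"
      using ab mem_generate_iff[OF fin uG] by (auto simp: N_def)
    have "a \<otimes> b \<otimes> u \<otimes> inv (a \<otimes> b) = a \<otimes> (b \<otimes> u \<otimes> inv b) \<otimes> inv a"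
      using abG uG by (simp add: m_assoc inv_mult_group)
    also have "\<dots> = u [^] (s * t)"
      using conj_pow[OF abG(1) uG, of t] s t uG by (simp add: nat_pow_pow)
    finally show "a \<otimes> b \<in> N" using abG mem_generate_iff[OF fin uG] by (auto simp: N_def)
  qed (use \<open>M \<subseteq> N\<close> x in \<open>auto simp: N_def\<close>)
  moreover have "g \<in> N" using inN g u by blast
  ultimately have "N = carrier G" using M \<open>M \<subseteq> N\<close> g by (auto simp: maximal_subgroup_def)
  then have "u \<in> core G M" using uM uG by (auto simp: core_def N_def)
  then show ?thesis using core by simp
qed

text \<open>M is the disjoint union of A and its left coset by h, and y lies in the latter.\<close>

lemma (in group) mem_of_index_two:
  assumes A: "subgroup A G" and M: "subgroup M G" and AM: "A \<subseteq> M" and fin: "finite M"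
    and "card M = 2 * card A" "h \<in> M" "h \<notin> A" "y \<in> M" "y \<notin> A"
  shows "inv h \<otimes> y \<in> A"
proof -
  interpret A: subgroup A G by fact
  interpret M: subgroup M G by fact
  have h: "h \<in> carrier G" using assms by simp
  let ?B = "(\<lambda>a. h \<otimes> a) ` A"
  have inj: "inj_on (\<lambda>a. h \<otimes> a) A" using h A.subset by (auto simp: inj_on_def)
  have disj: "A \<inter> ?B = {}"
  proof (rule ccontr)
    assume "A \<inter> ?B \<noteq> {}"
    then obtain a b where ab: "a \<in> A" "b \<in> A" "b = h \<otimes> a" by blast
    then have "h = b \<otimes> inv a" using h A.mem_carrier by (simp add: inv_solve_right)
    moreover have "b \<otimes> inv a \<in> A" using ab by blast
    ultimately show False using assms(7) by simp
  qed
  have sub: "A \<union> ?B \<subseteq> M" using AM assms(6) by auto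
  have finA: "finite A" using AM fin finite_subset by blast
  have "card (A \<union> ?B) = card M"
    using card_Un_disjoint[OF finA _ disj] finA card_image[OF inj] assms(5) by simp
  then have "M = A \<union> ?B" using card_subset_eq[OF fin sub] by simp
  then obtain a where "a \<in> A" "y = h \<otimes> a" using assms(8,9) by blast
  then show ?thesis using h by (simp flip: m_assoc)
qed

text \<open>Some g outside M conjugates no nontrivial element of \<open>generate G {x}\<close> into
  M. Translating M g by that subgroup then yields \<open>ord x\<close> different cosets of M, none
  equal to M, among the d - 1 available.\<close>

lemma (in group) ord_le_of_index_two:
  assumes fin: "finite (carrier G)" and M: "maximal_subgroup M G" and core: "core G M = {\<one>}"
    and x: "x \<in> M" and card: "card M = 2 * ord x" and ord: "order G = d * card M"
  shows "ord x \<le> d - 1"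
proof -
  have MG: "subgroup M G" using M by (simp add: maximal_subgroup_def)
  interpret M: subgroup M G by fact
  let ?A = "generate G {x}"
  have xG: "x \<in> carrier G" using x by simp
  have AM: "?A \<subseteq> M" using x MG by (simp add: generate_subgroup_incl)
  interpret A: subgroup ?A G using subgroup_generate_single[OF xG] .
  have finM: "finite M" using fin M.subset finite_subset by blast
  have card': "card M = 2 * card ?A" using card generate_pow_card[OF xG] by simp
  note ix = mem_of_index_two[OF A.subgroup_axioms MG AM finM card']
  have xA: "x \<in> ?A" by (simp add: generate.incl)
  have conj: "h \<otimes> x \<otimes> inv h \<in> ?A" if h: "h \<in> M" for h
  proof (rule ccontr)
    assume n: "h \<otimes> x \<otimes> inv h \<notin> ?A"
    have hG: "h \<in> carrier G" using h by simp
    have hA: "h \<notin> ?A" using n xA by blast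
    have "inv h \<otimes> (h \<otimes> x \<otimes> inv h) \<in> ?A" using ix[OF h hA _ n] h x by simp
    then have "x \<otimes> inv h \<in> ?A" using hG xG by (simp add: m_assoc[symmetric])
    then have "inv x \<otimes> (x \<otimes> inv h) \<in> ?A" using xA by blast
    then have "inv h \<in> ?A" using hG xG by (simp add: m_assoc[symmetric])
    then have "inv (inv h) \<in> ?A" by blast
    then show False using hA hG by simp
  qed
  have sq: "h \<otimes> h \<in> ?A" if h: "h \<in> M" for h
  proof (rule ccontr)
    assume n: "h \<otimes> h \<notin> ?A"
    then have hA: "h \<notin> ?A" by blast
    have "inv h \<otimes> (h \<otimes> h) \<in> ?A" using ix[OF h hA _ n] h by simp
    then show False using hA h by (simp add: m_assoc[symmetric])
  qed
  note mal = malnormal_of_maximal[OF fin M core x conj]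
  \<comment> \<open>Suppose no such g exists. A nontrivial u conjugated into M has its square
    conjugated into \<open>?A\<close>, so by malnormality u has order 2. The unique involution of
    \<open>?A\<close> then has all its conjugates in M, contradicting the trivial core.\<close>
  have ex: "\<exists>g\<in>carrier G. g \<notin> M \<and> (\<forall>u\<in>?A. g \<otimes> u \<otimes> inv g \<in> M \<longrightarrow> u = \<one>)"
  proof (rule ccontr)
    assume "\<not> ?thesis"
    then have H: "\<exists>u\<in>?A. g \<otimes> u \<otimes> inv g \<in> M \<and> u \<noteq> \<one>" if "g \<in> carrier G" "g \<notin> M" for g
      using that by blast
    have H2: "\<exists>u\<in>?A. g \<otimes> u \<otimes> inv g \<in> M \<and> ord u = 2" if g: "g \<in> carrier G" "g \<notin> M" for g
    proof -
      obtain u where u: "u \<in> ?A" "g \<otimes> u \<otimes> inv g \<in> M" "u \<noteq> \<one>" using H[OF g] by blast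
      have uG: "u \<in> carrier G" using u(1) by simp
      have "g \<otimes> u [^] (2::nat) \<otimes> inv g \<in> ?A"
        using sq[OF u(2)] conj_pow[OF g(1) uG, of 2] g(1) uG by (simp add: numeral_2_eq_2)
      moreover have "u [^] (2::nat) \<in> ?A" using u(1) uG by (simp add: numeral_2_eq_2)
      ultimately have "u [^] (2::nat) = \<one>" using mal[OF _ g] by blast
      then have "ord u dvd 2" using pow_eq_id[OF uG] by simp
      moreover have "ord u \<noteq> 1" using u(3) ord_eq_1[OF uG] by simp
      ultimately have "ord u = 2" using two_is_prime_nat prime_nat_iff by blast
      then show ?thesis using u by blast
    qed
    obtain g0 where g0: "g0 \<in> carrier G" "g0 \<notin> M" using M M.subset by (auto simp: maximal_subgroup_def)
    obtain u where u: "u \<in> ?A" "ord u = 2" using H2[OF g0] by blast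
    have uG: "u \<in> carrier G" using u(1) by simp
    have "g \<otimes> u \<otimes> inv g \<in> M" if g: "g \<in> carrier G" for g
    proof (cases "g \<in> M")
      case True then show ?thesis using AM u(1) by auto
    next
      case False
      then obtain v where v: "v \<in> ?A" "g \<otimes> v \<otimes> inv g \<in> M" "ord v = 2" using H2[OF g] by blast
      have vG: "v \<in> carrier G" using v(1) by simp
      have "v \<in> generate G {u}" using mem_generate_of_ord_dvd[OF fin xG u(1) v(1)] u v by simp
      then obtain j :: nat where j: "v = u [^] j" using mem_generate_iff[OF fin uG] by blast
      have u2: "u [^] (2::nat) = \<one>" using u pow_ord_eq_1[OF uG] by simp
      have "v = u"
      proof (cases "even j")
        case True
        then obtain i where "j = 2 * i" by (auto elim: evenE)
        then have "v = (u [^] (2::nat)) [^] i" using j uG by (simp only: nat_pow_pow)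
        then have "v = \<one>" using u2 by simp
        then show ?thesis using v(3) by simp
      next
        case False
        then obtain i where "j = 2 * i + 1" by (auto elim: oddE)
        then have "v = (u [^] (2::nat)) [^] i \<otimes> u" using j uG by (simp add: nat_pow_pow)
        then show ?thesis using u2 uG by simp
      qed
      then show ?thesis using v by simp
    qed
    then have "u \<in> core G M" using uG by (simp add: core_def)
    then show False using core u(2) by simp
  qed
  then obtain g where g: "g \<in> carrier G" "g \<notin> M" "\<And>u. u \<in> ?A \<Longrightarrow> g \<otimes> u \<otimes> inv g \<in> M \<Longrightarrow> u = \<one>"
    by blast
  have inj: "inj_on (\<lambda>a. M #> (g \<otimes> a)) ?A"
  proof (rule inj_onI)
    fix a b assume ab: "a \<in> ?A" "b \<in> ?A" "M #> (g \<otimes> a) = M #> (g \<otimes> b)"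
    have abG: "a \<in> carrier G" "b \<in> carrier G" using ab by simp_all
    have "g \<otimes> a \<in> M #> (g \<otimes> b)" using ab(3) rcos_self[OF _ MG, of "g \<otimes> a"] g(1) abG by simp
    then have "(g \<otimes> a) \<otimes> inv (g \<otimes> b) \<in> M"
      using M.rcos_module_imp[OF group_axioms, of "g \<otimes> b"] g(1) abG by simp
    then have "g \<otimes> (a \<otimes> inv b) \<otimes> inv g \<in> M" using g(1) abG by (simp add: m_assoc inv_mult_group)
    then have "a \<otimes> inv b = \<one>" using g(3) ab by blast
    then show "a = b" using abG inv_equality[of a "inv b"] by simp
  qed
  have sub: "(\<lambda>a. M #> (g \<otimes> a)) ` ?A \<subseteq> rcosets M - {M}"
  proof
    fix C assume "C \<in> (\<lambda>a. M #> (g \<otimes> a)) ` ?A"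
    then obtain a where a: "a \<in> ?A" "C = M #> (g \<otimes> a)" by blast
    have aG: "a \<in> carrier G" using a by simp
    have aM: "a \<in> M" using a AM by blast
    have "C \<noteq> M"
    proof
      assume "C = M"
      then have "g \<otimes> a \<in> M" using rcos_self[OF _ MG, of "g \<otimes> a"] a g(1) aG by simp
      then have "g \<otimes> a \<otimes> inv a \<in> M" using aM by blast
      then show False using g aG by (simp add: m_assoc)
    qed
    then show "C \<in> rcosets M - {M}" using a aG g(1) rcosetsI[OF M.subset] by simp
  qed
  have finR: "finite (rcosets M)" using finite_rcosets[OF fin MG] .
  have "card M > 0" using card ord_ge_1[OF fin xG] by simp
  then have "card (rcosets M) = d" using lagrange[OF MG] ord by simp
  then have "card (rcosets M - {M}) = d - 1"
    using M.subgroup_in_rcosets[OF group_axioms] finR by simp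
  then have "card ?A \<le> d - 1"
    using card_mono[OF _ sub] finR card_image[OF inj] by simp
  then show ?thesis using generate_pow_card[OF xG] by simp
qed

section \<open>Transfer and groups of order 60\<close>

lemma (in group) cancel_both:
  assumes "a \<in> carrier G" "g \<in> carrier G" "b \<in> carrier G"
  shows "inv a \<otimes> (a \<otimes> g \<otimes> b) \<otimes> inv b = g"
proof -
  have "inv a \<otimes> (a \<otimes> g \<otimes> b) \<otimes> inv b = (inv a \<otimes> a) \<otimes> g \<otimes> (b \<otimes> inv b)"
    using assms by (simp only: m_assoc m_closed inv_closed)
  then show ?thesis using assms by simp
qed

text \<open>The retraction is the transfer into \<open>A\<close>. Malnormality makes \<open>A \<times> A\<close> act freely on the complement of \<open>A\<close>,
  so the map \<open>\<beta>\<close> to \<open>A\<close> below can be taken left equivariant, and right invariant outside \<open>A\<close>. Hence only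
  the coset \<open>A\<close> itself contributes to \<open>V a\<close> when \<open>a \<in> A\<close>.\<close>

lemma (in group) retraction_of_malnormal:
  assumes fin: "finite (carrier G)" and A: "subgroup A G"
    and comm: "\<And>a b. a \<in> A \<Longrightarrow> b \<in> A \<Longrightarrow> a \<otimes> b = b \<otimes> a"
    and mal: "\<And>g u. \<lbrakk>g \<in> carrier G; g \<notin> A; u \<in> A; g \<otimes> u \<otimes> inv g \<in> A\<rbrakk> \<Longrightarrow> u = \<one>"
  obtains V where "group_hom G (G\<lparr>carrier := A\<rparr>) V" "\<And>a. a \<in> A \<Longrightarrow> V a = a"
proof -
  interpret A: subgroup A G by fact
  let ?A = "G\<lparr>carrier := A\<rparr>"
  interpret GA: group ?A using subgroup_imp_group[OF A] .
  interpret CA: comm_group ?A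
    by (rule GA.group_comm_groupI) (simp add: comm)
  have invA: "inv\<^bsub>?A\<^esub> a = inv a" if "a \<in> A" for a using m_inv_consistent[OF A that] .
  \<comment> \<open>\<open>D g\<close> is the double coset of g by A, \<open>t g\<close> a
    representative depending only on it, and \<open>\<beta> g\<close> the left factor when g is
    written with \<open>t g\<close> in the middle.\<close>
  define D where "D g = {h. \<exists>a\<in>A. \<exists>b\<in>A. h = a \<otimes> g \<otimes> b}" for g
  define t where "t g = (SOME h. h \<in> D g)" for g
  define \<beta> where "\<beta> g = (if g \<in> A then g else SOME a. a \<in> A \<and> (\<exists>b\<in>A. g = a \<otimes> t g \<otimes> b))" for g
  have D_eq: "D (a \<otimes> g \<otimes> b) = D g" if g: "g \<in> carrier G" and a: "a \<in> A" and b: "b \<in> A" for g a b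
  proof -
    have sub: "D (a \<otimes> g \<otimes> b) \<subseteq> D g" if "g \<in> carrier G" "a \<in> A" "b \<in> A" for g a b
    proof
      fix h assume "h \<in> D (a \<otimes> g \<otimes> b)"
      then obtain c d where cd: "c \<in> A" "d \<in> A" "h = c \<otimes> (a \<otimes> g \<otimes> b) \<otimes> d" by (auto simp: D_def)
      then have "h = (c \<otimes> a) \<otimes> g \<otimes> (b \<otimes> d)" using that by (simp add: m_assoc)
      then show "h \<in> D g" unfolding D_def using cd that A.m_closed by blast
    qed
    have "D (inv a \<otimes> (a \<otimes> g \<otimes> b) \<otimes> inv b) \<subseteq> D (a \<otimes> g \<otimes> b)"
      by (rule sub) (use that in simp_all)
    moreover have "inv a \<otimes> (a \<otimes> g \<otimes> b) \<otimes> inv b = g"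
      using that cancel_both by simp
    ultimately show ?thesis using sub[OF that] by simp
  qed
  have t_mem: "t g \<in> D g" if "g \<in> carrier G" for g
  proof -
    have "\<one> \<otimes> g \<otimes> \<one> \<in> D g" unfolding D_def using A.one_closed by blast
    then show ?thesis unfolding t_def by (rule someI)
  qed
  have t_dec: "\<exists>a\<in>A. \<exists>b\<in>A. g = a \<otimes> t g \<otimes> b" if g: "g \<in> carrier G" for g
  proof -
    obtain a b where ab: "a \<in> A" "b \<in> A" "t g = a \<otimes> g \<otimes> b" using t_mem[OF g] by (auto simp: D_def)
    then have "g = inv a \<otimes> t g \<otimes> inv b" using g cancel_both[of a g b] by simp
    then show ?thesis using ab A.m_inv_closed by blast
  qed
  have t_car: "t g \<in> carrier G" if "g \<in> carrier G" for g
    using t_mem[OF that] that by (auto simp: D_def)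
  have t_not: "t g \<notin> A" if g: "g \<in> carrier G" "g \<notin> A" for g
    using t_dec[OF g(1)] g(2) A.m_closed by metis
  have t_eq: "t (a \<otimes> g \<otimes> b) = t g" if "g \<in> carrier G" "a \<in> A" "b \<in> A" for a g b
    using D_eq[OF that] by (simp add: t_def)
  have \<beta>_eqI: "\<beta> g = a" if g: "g \<in> carrier G" "g \<notin> A" and a: "a \<in> A" "b \<in> A" "g = a \<otimes> t g \<otimes> b" for g a b
  proof -
    have "\<exists>c. c \<in> A \<and> (\<exists>d\<in>A. g = c \<otimes> t g \<otimes> d)" using t_dec[OF g(1)] by blast
    from someI_ex[OF this] obtain d where d: "\<beta> g \<in> A" "d \<in> A" "g = \<beta> g \<otimes> t g \<otimes> d"
      using g(2) by (auto simp: \<beta>_def)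
    have tc: "t g \<in> carrier G" using t_car g by blast
    have "inv a \<otimes> (\<beta> g \<otimes> t g \<otimes> d) = inv a \<otimes> (a \<otimes> t g \<otimes> b)" using d(3) a(3) by simp
    then have e: "inv a \<otimes> \<beta> g \<otimes> t g \<otimes> d = t g \<otimes> b"
      using a(1,2) d(1,2) tc by (simp add: m_assoc[symmetric])
    \<comment> \<open>Comparing two decompositions of g shows that \<open>t g\<close> conjugates an
      element of A into A. Malnormality makes that element trivial, so the left factor is
      unique.\<close>
    have "t g \<otimes> (b \<otimes> inv d) \<otimes> inv (t g) = (t g \<otimes> b) \<otimes> inv d \<otimes> inv (t g)"
      using a(1,2) d(1,2) tc by (simp add: m_assoc)
    also have "\<dots> = inv a \<otimes> \<beta> g" unfolding e[symmetric]
      using a(1,2) d(1,2) tc by (simp add: m_assoc)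
    finally have "t g \<otimes> (b \<otimes> inv d) \<otimes> inv (t g) = inv a \<otimes> \<beta> g" .
    moreover have "inv a \<otimes> \<beta> g \<in> A" using a d by blast
    ultimately have bd: "b \<otimes> inv d = \<one>"
      using mal[OF tc t_not[OF g], of "b \<otimes> inv d"] a(2) d(2) by simp
    then have "\<one> = inv a \<otimes> \<beta> g"
      using \<open>t g \<otimes> (b \<otimes> inv d) \<otimes> inv (t g) = inv a \<otimes> \<beta> g\<close> tc by simp
    then have "a = \<beta> g" using a(1) d(1) by (simp add: inv_solve_left)
    then show ?thesis by simp
  qed
  have \<beta>_mem: "\<beta> g \<in> A" if g: "g \<in> carrier G" for g
  proof (cases "g \<in> A")
    case True then show ?thesis by (simp add: \<beta>_def)
  next
    case False then show ?thesis using t_dec[OF g] \<beta>_eqI[OF g False] by metis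
  qed
  have \<beta>_left: "\<beta> (c \<otimes> g) = c \<otimes> \<beta> g" if g: "g \<in> carrier G" and c: "c \<in> A" for g c
  proof (cases "g \<in> A")
    case True then show ?thesis using c by (simp add: \<beta>_def)
  next
    case False
    obtain a b where ab: "a \<in> A" "b \<in> A" "g = a \<otimes> t g \<otimes> b" using t_dec[OF g] by blast
    have 1: "c \<otimes> g \<notin> A"
    proof
      assume "c \<otimes> g \<in> A"
      then have "inv c \<otimes> (c \<otimes> g) \<in> A" using c by blast
      then show False using c g False by (simp add: m_assoc[symmetric])
    qed
    have "t (c \<otimes> g) = t g" using t_eq[OF g c A.one_closed] c g by simp
    moreover have "c \<otimes> g = c \<otimes> a \<otimes> t g \<otimes> b" using ab c t_car[OF g] by (metis A.mem_carrier m_assoc m_closed)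
    ultimately have "c \<otimes> g = c \<otimes> a \<otimes> t (c \<otimes> g) \<otimes> b" by simp
    then have "\<beta> (c \<otimes> g) = c \<otimes> a"
      by (intro \<beta>_eqI[OF _ 1 _ ab(2)]) (use ab(1) c g in simp_all)
    then show ?thesis using \<beta>_eqI[OF g False ab] by simp
  qed
  have \<beta>_right: "\<beta> (g \<otimes> c) = \<beta> g" if g: "g \<in> carrier G" "g \<notin> A" and c: "c \<in> A" for g c
  proof -
    obtain a b where ab: "a \<in> A" "b \<in> A" "g = a \<otimes> t g \<otimes> b" using t_dec[OF g(1)] by blast
    have 1: "g \<otimes> c \<notin> A"
    proof
      assume "g \<otimes> c \<in> A"
      then have "g \<otimes> c \<otimes> inv c \<in> A" using c by blast
      then show False using c g by (simp add: m_assoc)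
    qed
    have "t (g \<otimes> c) = t g" using t_eq[OF g(1) A.one_closed c] c g by simp
    moreover have "g \<otimes> c = a \<otimes> t g \<otimes> (b \<otimes> c)" using ab c t_car[OF g(1)] by (metis A.mem_carrier m_assoc m_closed)
    ultimately have "g \<otimes> c = a \<otimes> t (g \<otimes> c) \<otimes> (b \<otimes> c)" by simp
    then have "\<beta> (g \<otimes> c) = a"
      by (intro \<beta>_eqI[OF _ 1 ab(1)]) (use ab(2) c g in simp_all)
    then show ?thesis using \<beta>_eqI[OF g ab] by simp
  qed
  \<comment> \<open>\<open>F g\<close> is constant on right cosets of A because A is abelian and
    \<open>\<beta>\<close> is left equivariant, so the representatives \<open>r\<close> may be
    chosen arbitrarily. The product of these factors over all cosets is the transfer.\<close>
  define F where "F g c = \<beta> (c \<otimes> g) \<otimes> inv (\<beta> c)" for g c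
  define r where "r C = (SOME c. c \<in> C)" for C :: "'a set"
  have F_mem: "F g c \<in> A" if "g \<in> carrier G" "c \<in> carrier G" for g c
    using \<beta>_mem that by (simp add: F_def)
  have F_left: "F g (b \<otimes> c) = F g c" if gc: "g \<in> carrier G" "c \<in> carrier G" and b: "b \<in> A" for g b c
  proof -
    have "F g (b \<otimes> c) = \<beta> (b \<otimes> (c \<otimes> g)) \<otimes> inv (\<beta> (b \<otimes> c))"
      using gc b by (simp add: F_def m_assoc)
    also have "\<dots> = b \<otimes> \<beta> (c \<otimes> g) \<otimes> inv (b \<otimes> \<beta> c)" using \<beta>_left gc b by simp
    also have "inv (b \<otimes> \<beta> c) = inv b \<otimes> inv (\<beta> c)"
      using comm[OF b \<beta>_mem[OF gc(2)]] b \<beta>_mem[OF gc(2)] by (simp add: inv_mult_group)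
    also have "b \<otimes> \<beta> (c \<otimes> g) = \<beta> (c \<otimes> g) \<otimes> b" using comm[OF b \<beta>_mem] gc by simp
    finally show ?thesis using b \<beta>_mem[of c] \<beta>_mem[of "c \<otimes> g"] gc
      by (simp add: F_def m_assoc[of _ b]) (simp add: m_assoc[symmetric])
  qed
  have r_mem: "r C \<in> C" if "C \<in> rcosets A" for C
    using subgroup.rcosets_non_empty[OF A that] someI_ex[of "\<lambda>c. c \<in> C"] by (auto simp: r_def)
  have r_car: "r C \<in> carrier G" if "C \<in> rcosets A" for C
    using r_mem[OF that] rcoset_subset[OF A that] by blast
  have F_r: "F g c = F g (r C)" if g: "g \<in> carrier G" and C: "C \<in> rcosets A" and c: "c \<in> C" for g c C
  proof -
    have "c \<otimes> inv (r C) \<in> A" using diff_neutralizes[OF A C c r_mem[OF C]] .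
    moreover have "c = (c \<otimes> inv (r C)) \<otimes> r C"
      using r_car[OF C] rcoset_subset[OF A C] c by (simp add: subsetD m_assoc)
    ultimately show ?thesis using F_left[OF g r_car[OF C]] by metis
  qed
  define V where "V g = finprod ?A (\<lambda>C. F g (r C)) (rcosets A)" for g
  have V_mem: "V g \<in> A" if "g \<in> carrier G" for g
    using CA.finprod_closed[of "\<lambda>C. F g (r C)" "rcosets A"] F_mem[OF that] r_car by (auto simp: V_def)
  have V_mult: "V (g \<otimes> h) = V g \<otimes> V h" if gh: "g \<in> carrier G" "h \<in> carrier G" for g h
  proof -
    have cl: "(\<lambda>C. C #> g) ` (rcosets A) = rcosets A"
    proof
      show "rcosets A \<subseteq> (\<lambda>C. C #> g) ` (rcosets A)"
      proof
        fix C assume C: "C \<in> rcosets A"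
        then have "C #> inv g \<in> rcosets A" using gh coset_mult_closed[OF A] by simp
        moreover have "C = C #> inv g #> g"
          using rcoset_subset[OF A C] gh by (simp add: coset_mult_assoc)
        ultimately show "C \<in> (\<lambda>C. C #> g) ` (rcosets A)" by blast
      qed
    qed (use gh coset_mult_closed[OF A] in auto)
    have inj: "inj_on (\<lambda>C. C #> g) (rcosets A)"
      using cl finite_rcosets[OF fin A] by (simp add: eq_card_imp_inj_on)
    \<comment> \<open>The factor of g h at c is that of h at c g times that of g at c; right
      multiplication by g permutes the cosets.\<close>
    have "V (g \<otimes> h) = finprod ?A (\<lambda>C. F h (r (C #> g)) \<otimes>\<^bsub>?A\<^esub> F g (r C)) (rcosets A)"
      unfolding V_def
    proof (rule CA.finprod_cong')
      show "(\<lambda>C. F h (r (C #> g)) \<otimes>\<^bsub>?A\<^esub> F g (r C)) \<in> rcosets A \<rightarrow> carrier ?A"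
        using F_mem gh r_car coset_mult_closed[OF A] by auto
      fix C assume C: "C \<in> rcosets A"
      have "r C \<otimes> g \<in> C #> g" using r_mem[OF C] by (auto simp: r_coset_def)
      then have "F h (r (C #> g)) = F h (r C \<otimes> g)"
        using F_r[of h "C #> g" "r C \<otimes> g"] gh coset_mult_closed[OF A C] by simp
      then show "F (g \<otimes> h) (r C) = F h (r (C #> g)) \<otimes>\<^bsub>?A\<^esub> F g (r C)"
        using gh r_car[OF C] \<beta>_mem[of "r C \<otimes> g"] \<beta>_mem[of "r C"] \<beta>_mem[of "r C \<otimes> g \<otimes> h"]
        by (simp add: F_def m_assoc) (simp add: m_assoc[symmetric])
    qed simp
    also have "\<dots> = finprod ?A (\<lambda>C. F h (r (C #> g))) (rcosets A) \<otimes>\<^bsub>?A\<^esub> V g"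
      unfolding V_def
      by (rule CA.finprod_multf) (use F_mem gh r_car coset_mult_closed[OF A] in auto)
    also have "finprod ?A (\<lambda>C. F h (r (C #> g))) (rcosets A) = V h"
      using CA.finprod_reindex[of "\<lambda>C. F h (r C)" "\<lambda>C. C #> g" "rcosets A"] cl inj F_mem gh r_car
      by (simp add: V_def)
    finally show ?thesis using comm[OF V_mem V_mem] gh by simp
  qed
  have V_id: "V a = a" if a: "a \<in> A" for a
  proof -
    have aG: "a \<in> carrier G" using a by simp
    have AR: "A \<in> rcosets A" using A.subgroup_in_rcosets[OF group_axioms] .
    have "V a = finprod ?A (\<lambda>C. if A = C then a else \<one>\<^bsub>?A\<^esub>) (rcosets A)"
      unfolding V_def
    proof (rule CA.finprod_cong')
      show "(\<lambda>C. if A = C then a else \<one>\<^bsub>?A\<^esub>) \<in> rcosets A \<rightarrow> carrier ?A" using a by auto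
      fix C assume C: "C \<in> rcosets A"
      show "F a (r C) = (if A = C then a else \<one>\<^bsub>?A\<^esub>)"
      proof (cases "C = A")
        case True
        have rA: "r C \<in> A" using r_mem[OF C] True by simp
        then have "F a (r C) = r C \<otimes> a \<otimes> inv (r C)" using a by (simp add: F_def \<beta>_def)
        also have "\<dots> = a" using comm[OF rA a] rA a by (simp add: m_assoc)
        finally show ?thesis using True by simp
      next
        case False
        have "r C \<notin> A"
        proof
          assume rA: "r C \<in> A"
          obtain c where c: "c \<in> carrier G" "C = A #> c" using C by (auto simp: RCOSETS_def)
          then have "A #> c = A #> r C" using repr_independence[OF _ c(1) A] r_mem[OF C] by simp
          then show False using coset_join2[OF _ A rA] rA c False by simp
        qed
        then have "F a (r C) = \<one>" using \<beta>_right[OF r_car[OF C] _ a] \<beta>_mem[OF r_car[OF C]] by (simp add: F_def)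
        then show ?thesis using False by auto
      qed
    qed simp
    also have "\<dots> = a"
      using CA.finprod_singleton[OF AR finite_rcosets[OF fin A], of "\<lambda>_. a"] a by simp
    finally show ?thesis .
  qed
  have "group_hom G ?A V"
    using V_mem V_mult by (auto simp: group_hom_def group_hom_axioms_def group_axioms GA.group_axioms hom_def)
  then show ?thesis using that V_id by blast
qed

section \<open>Centralizers and element orders in groups of order 60\<close>

lemma (in group) ord_mult_coprime:
  assumes "x \<in> carrier G" "y \<in> carrier G" "x \<otimes> y = y \<otimes> x" "coprime (ord x) (ord y)"
  shows "ord x * ord y dvd ord (x \<otimes> y)"
proof -
  have xy: "x \<otimes> y \<in> carrier G" using assms by simp
  have pow: "x [^] n \<otimes> y [^] n = \<one>" if "ord (x \<otimes> y) dvd n" for n :: nat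
    using that pow_eq_id[OF xy] pow_mult_distrib[OF assms(3,1,2)] by simp
  let ?o = "ord (x \<otimes> y)"
  have "x [^] (?o * ord y) = \<one>"
    using pow[of "?o * ord y"] assms(1,2) pow_eq_id[OF assms(2), of "?o * ord y"] by simp
  then have "ord x dvd ?o * ord y" using pow_eq_id[OF assms(1)] by simp
  then have 1: "ord x dvd ?o" using assms(4) by (simp add: coprime_dvd_mult_left_iff)
  have "y [^] (?o * ord x) = \<one>"
    using pow[of "?o * ord x"] assms(1,2) pow_eq_id[OF assms(1), of "?o * ord x"] by simp
  then have "ord y dvd ?o * ord x" using pow_eq_id[OF assms(2)] by simp
  then have 2: "ord y dvd ?o" using assms(4) by (simp add: coprime_dvd_mult_left_iff coprime_commute)
  show ?thesis using divides_mult[OF 1 2 assms(4)] .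
qed

definition centralizer :: "('a, 'b) monoid_scheme \<Rightarrow> 'a \<Rightarrow> 'a set"
  where "centralizer G z = {g \<in> carrier G. g \<otimes>\<^bsub>G\<^esub> z = z \<otimes>\<^bsub>G\<^esub> g}"

lemma (in group) subgroup_centralizer:
  assumes "z \<in> carrier G" shows "subgroup (centralizer G z) G"
proof (rule subgroupI)
  fix a b assume ab: "a \<in> centralizer G z" "b \<in> centralizer G z"
  then have abG: "a \<in> carrier G" "b \<in> carrier G" by (auto simp: centralizer_def)
  have "a \<otimes> b \<otimes> z = a \<otimes> (z \<otimes> b)" using ab assms by (simp add: centralizer_def m_assoc)
  also have "\<dots> = z \<otimes> (a \<otimes> b)" using ab assms by (simp add: centralizer_def m_assoc[symmetric])
  finally show "a \<otimes> b \<in> centralizer G z" using abG by (simp add: centralizer_def)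
next
  fix a assume a: "a \<in> centralizer G z"
  then have aG: "a \<in> carrier G" by (auto simp: centralizer_def)
  have "inv a \<otimes> (a \<otimes> z) \<otimes> inv a = inv a \<otimes> (z \<otimes> a) \<otimes> inv a" using a by (simp add: centralizer_def)
  moreover have "inv a \<otimes> (a \<otimes> z) \<otimes> inv a = z \<otimes> inv a" using aG assms by (simp add: m_assoc[symmetric])
  moreover have "inv a \<otimes> (z \<otimes> a) \<otimes> inv a = inv a \<otimes> z" using aG assms by (simp add: m_assoc)
  ultimately have "z \<otimes> inv a = inv a \<otimes> z" by simp
  then show "inv a \<in> centralizer G z" using aG by (simp add: centralizer_def)
qed (use assms in \<open>auto simp: centralizer_def\<close>)

lemma (in group) card_conj_class:
  assumes z: "z \<in> carrier G"
  shows "card ((\<lambda>g. g \<otimes> z \<otimes> inv g) ` carrier G) * card (centralizer G z) = order G"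
proof -
  let ?\<phi> = "\<lambda>g. \<lambda>h \<in> carrier G. g \<otimes> h \<otimes> inv g"
  interpret act: group_action G "carrier G" ?\<phi> by (rule action_by_conjugation)
  have "orbit G ?\<phi> z = (\<lambda>g. g \<otimes> z \<otimes> inv g) ` carrier G" using z by (auto simp: orbit_def)
  moreover have "stabilizer G ?\<phi> z = centralizer G z"
  proof -
    have "g \<otimes> z \<otimes> inv g = z \<longleftrightarrow> g \<otimes> z = z \<otimes> g" if "g \<in> carrier G" for g
      using that z inv_solve_right'[of z "g \<otimes> z" g] by simp
    then show ?thesis using z by (auto simp: stabilizer_def centralizer_def)
  qed
  ultimately show ?thesis using act.orbit_stabilizer_theorem[OF z] by simp
qed

text \<open>S is a disjoint union of conjugacy classes, and the class of z has m times r / |C(z)|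
  elements.\<close>

lemma (in group) dvd_card_conj_closed:
  assumes fin: "finite (carrier G)" and S: "S \<subseteq> carrier G"
    and closed: "\<And>g z. g \<in> carrier G \<Longrightarrow> z \<in> S \<Longrightarrow> g \<otimes> z \<otimes> inv g \<in> S"
    and cent: "\<And>z. z \<in> S \<Longrightarrow> card (centralizer G z) dvd r" and r: "order G = m * r"
  shows "m dvd card S"
proof -
  let ?cl = "\<lambda>z. (\<lambda>g. g \<otimes> z \<otimes> inv g) ` carrier G"
  have self: "z \<in> ?cl z" if "z \<in> carrier G" for z
  proof -
    have "z = \<one> \<otimes> z \<otimes> inv \<one>" using that by simp
    then show ?thesis by (intro image_eqI[of _ _ "\<one>"]) simp_all
  qed
  have step: "?cl y \<subseteq> ?cl z" if zG: "z \<in> carrier G" and y: "y \<in> ?cl z" for y z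
  proof
    fix w assume "w \<in> ?cl y"
    then obtain g where g: "g \<in> carrier G" "w = g \<otimes> y \<otimes> inv g" by (rule imageE)
    obtain h where h: "h \<in> carrier G" "y = h \<otimes> z \<otimes> inv h" using y by (rule imageE)
    have gh: "g \<in> carrier G" "h \<in> carrier G" "w = g \<otimes> (h \<otimes> z \<otimes> inv h) \<otimes> inv g"
      using g h by simp_all
    then have "w = (g \<otimes> h) \<otimes> z \<otimes> inv (g \<otimes> h)" using zG by (simp add: m_assoc inv_mult_group)
    then show "w \<in> ?cl z" using gh(1,2) by (intro image_eqI[of _ _ "g \<otimes> h"]) simp_all
  qed
  have sym: "z \<in> ?cl y" if z: "z \<in> carrier G" and y: "y \<in> ?cl z" for y z
  proof -
    obtain g where g: "g \<in> carrier G" "y = g \<otimes> z \<otimes> inv g" using y by (rule imageE)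
    then have "z = inv g \<otimes> y \<otimes> inv (inv g)" using z cancel_both[of g z "inv g"] by simp
    then show ?thesis using g(1) by (intro image_eqI[of _ _ "inv g"]) simp_all
  qed
  have eq: "?cl y = ?cl z" if "z \<in> carrier G" "y \<in> ?cl z" for y z
  proof
    show "?cl y \<subseteq> ?cl z" using step[OF that] .
    have "y \<in> carrier G" using that by (auto elim!: imageE)
    then show "?cl z \<subseteq> ?cl y" using step sym[OF that] by blast
  qed
  have un: "\<Union>(?cl ` S) = S"
  proof
    show "\<Union>(?cl ` S) \<subseteq> S" using closed by auto
    show "S \<subseteq> \<Union>(?cl ` S)" using self S by (intro subsetI UnionI[OF imageI]) auto
  qed
  have "m dvd card (\<Union>(?cl ` S))"
  proof (rule dvd_partition)
    show "finite (\<Union> (?cl ` S))" using fin S finite_subset un by metis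
    show "\<forall>c\<in>?cl ` S. m dvd card c"
    proof
      fix c assume "c \<in> ?cl ` S"
      then obtain z where z: "z \<in> S" "c = ?cl z" by (elim imageE)
      obtain s where s: "r = card (centralizer G z) * s" using cent[OF z(1)] by (auto elim: dvdE)
      have zG: "z \<in> carrier G" using z S by blast
      have "card (centralizer G z) > 0"
        using subgroup.finite_imp_card_positive[OF subgroup_centralizer[OF zG] fin] .
      moreover have "card c * card (centralizer G z) = m * s * card (centralizer G z)"
        using card_conj_class[OF zG] z(2) r s by (simp add: ac_simps)
      ultimately show "m dvd card c" by simp
    qed
    show "\<forall>c1\<in>?cl ` S. \<forall>c2\<in>?cl ` S. c1 \<noteq> c2 \<longrightarrow> c1 \<inter> c2 = {}"
    proof (intro ballI impI)
      fix c1 c2 assume "c1 \<in> ?cl ` S" "c2 \<in> ?cl ` S" and ne: "c1 \<noteq> c2"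
      then obtain y z where yz: "y \<in> S" "z \<in> S" "c1 = ?cl y" "c2 = ?cl z" by (elim imageE)
      then have yzG: "y \<in> carrier G" "z \<in> carrier G" using S by auto
      show "c1 \<inter> c2 = {}"
      proof (rule ccontr)
        assume "c1 \<inter> c2 \<noteq> {}"
        then obtain w where w: "w \<in> ?cl y" "w \<in> ?cl z" unfolding yz(3,4) ex_in_conv[symmetric] by (elim exE IntE)
        show False using ne yz(3,4) eq[OF yzG(1) w(1)] eq[OF yzG(2) w(2)] by simp
      qed
    qed
  qed
  then show ?thesis using un by simp
qed

text \<open>A prime p coprime to \<open>ord z\<close> dividing the order of the centralizer of z
  gives an element of order at least \<open>p * ord z\<close>. Hence centralizers of elements of
  order 2 or 4, 3, 5 have orders dividing 4, 3, 5, and the counts are multiples of 15, 20,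
  12.\<close>

lemma (in group) order_60_counts:
  assumes ord60: "order G = 60" and le: "\<And>g. g \<in> carrier G \<Longrightarrow> ord g \<le> 5"
  shows "card {g \<in> carrier G. ord g = 2} = 15" "card {g \<in> carrier G. ord g = 3} = 20"
    "{g \<in> carrier G. ord g = 4} = {}" "card {g \<in> carrier G. ord g = 5} = 24"
proof -
  have fin: "finite (carrier G)" using ord60 order_gt_0_iff_finite by simp
  let ?S = "\<lambda>j. {g \<in> carrier G. ord g = j}"
  have no_prime: "\<not> p dvd card (centralizer G z)"
    if z: "z \<in> carrier G" and p: "Factorial_Ring.prime p" "coprime p (ord z)" "p * ord z > 5" for z p
  proof
    assume d: "p dvd card (centralizer G z)"
    have sub: "subgroup (centralizer G z) G" using subgroup_centralizer[OF z] .
    interpret C: group "G\<lparr>carrier := centralizer G z\<rparr>" using subgroup_imp_group[OF sub] .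
    have finC: "finite (centralizer G z)" using finite_subset[OF subgroup.subset[OF sub] fin] .
    obtain y where y: "y \<in> centralizer G z" "C.ord y = p"
      using C.cauchy[of p] finC p(1) d by (auto simp: order_def)
    then have yo: "ord y = p" using ord_subgroup[OF sub] by simp
    have yG: "y \<in> carrier G" "y \<otimes> z = z \<otimes> y" using y by (auto simp: centralizer_def)
    have "p * ord z dvd ord (y \<otimes> z)" using ord_mult_coprime[OF yG(1) z yG(2)] p yo by simp
    moreover have "0 < ord (y \<otimes> z)" using ord_ge_1[OF fin, of "y \<otimes> z"] yG z by simp
    ultimately have "p * ord z \<le> ord (y \<otimes> z)" by (rule dvd_imp_le)
    then show False using le[of "y \<otimes> z"] p(3) yG z by simp
  qed
  have cdvd: "card (centralizer G z) dvd 2 ^ 2 * 3 * 5" if "z \<in> carrier G" for z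
  proof -
    have "card (centralizer G z) dvd order G" by (simp flip: lagrange[OF subgroup_centralizer[OF that]])
    then show ?thesis using ord60 by simp
  qed
  have sub: "?S j \<subseteq> carrier G" for j by blast
  have cl: "g \<otimes> z \<otimes> inv g \<in> ?S j" if "g \<in> carrier G" "z \<in> ?S j" for g z j
    using that ord_conj by simp
  have cop: "coprime p c" if "Factorial_Ring.prime p" "\<not> p dvd c" for p c :: nat
    using that by (simp add: prime_imp_coprime)
  have 2: "15 dvd card (?S j)" if j: "j = 2 \<or> j = 4" for j
  proof (rule dvd_card_conj_closed[OF fin sub cl, where r = 4])
    fix z assume z: "z \<in> ?S j"
    let ?c = "card (centralizer G z)"
    have jc: "coprime 3 j" "coprime 5 j" using j by (auto simp: coprime_iff_gcd_eq_1 gcd_non_0_nat)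
    have "\<not> 3 dvd ?c" "\<not> 5 dvd ?c" using no_prime[of z 3] no_prime[of z 5] z j jc by auto
    then have "coprime ?c (3 * 5)" using cop[of 3 ?c] cop[of 5 ?c]
      by (simp only: coprime_mult_right_iff coprime_commute[of ?c]) simp
    moreover have "?c dvd 4 * (3 * 5)" using cdvd z by simp
    ultimately show "?c dvd 4" by (simp only: coprime_dvd_mult_left_iff)
  qed (use ord60 in auto)
  have 3: "20 dvd card (?S 3)"
  proof (rule dvd_card_conj_closed[OF fin sub cl, where r = 3])
    fix z assume z: "z \<in> ?S 3"
    let ?c = "card (centralizer G z)"
    have jc: "coprime 2 (3::nat)" "coprime 5 (3::nat)" by (auto simp: coprime_iff_gcd_eq_1 gcd_non_0_nat)
    have "\<not> 2 dvd ?c" "\<not> 5 dvd ?c" using no_prime[of z 2] no_prime[of z 5] z jc by auto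
    then have "coprime ?c (2 ^ 2 * 5)" using cop[of 2 ?c] cop[of 5 ?c]
      by (simp only: coprime_mult_right_iff coprime_power_right_iff coprime_commute[of ?c]) simp
    moreover have "?c dvd 3 * (2 ^ 2 * 5)" using cdvd z by simp
    ultimately show "?c dvd 3" by (simp only: coprime_dvd_mult_left_iff)
  qed (use ord60 in auto)
  have 5: "12 dvd card (?S 5)"
  proof (rule dvd_card_conj_closed[OF fin sub cl, where r = 5])
    fix z assume z: "z \<in> ?S 5"
    let ?c = "card (centralizer G z)"
    have jc: "coprime 2 (5::nat)" "coprime 3 (5::nat)" by (auto simp: coprime_iff_gcd_eq_1 gcd_non_0_nat)
    have "\<not> 2 dvd ?c" "\<not> 3 dvd ?c" using no_prime[of z 2] no_prime[of z 3] z jc by auto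
    then have "coprime ?c (2 ^ 2 * 3)" using cop[of 2 ?c] cop[of 3 ?c]
      by (simp only: coprime_mult_right_iff coprime_power_right_iff coprime_commute[of ?c]) simp
    moreover have "?c dvd 5 * (2 ^ 2 * 3)" using cdvd z by simp
    ultimately show "?c dvd 5" by (simp only: coprime_dvd_mult_left_iff)
  qed (use ord60 in auto)
  have S1: "?S 1 = {\<one>}" using ord_eq_1 by auto
  have car: "carrier G = (\<Union>j\<in>{1,2,3,4,5}. ?S j)"
  proof
    show "carrier G \<subseteq> (\<Union>j\<in>{1,2,3,4,5}. ?S j)"
    proof
      fix g assume g: "g \<in> carrier G"
      have "1 \<le> ord g" "ord g \<le> 5" using ord_ge_1[OF fin g] le[OF g] by auto
      then have "ord g = 1 \<or> ord g = 2 \<or> ord g = 3 \<or> ord g = 4 \<or> ord g = 5" by linarith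
      then show "g \<in> (\<Union>j\<in>{1,2,3,4,5}. ?S j)" using g by simp
    qed
  qed blast
  have finS: "finite (?S j)" for j using fin by simp
  have "card (\<Union>j\<in>{1,2,3,4,5}. ?S j) = (\<Sum>j\<in>{1,2,3,4,5}. card (?S j))"
  proof (rule card_UN_disjoint)
    show "\<forall>i\<in>{1,2,3,4,5}. finite (?S i)" by (intro ballI finS)
    show "\<forall>i\<in>{1,2,3,4,5}. \<forall>j\<in>{1,2,3,4,5}. i \<noteq> j \<longrightarrow> ?S i \<inter> ?S j = {}" by blast
  qed simp
  also have "\<dots> = card (?S 1) + card (?S 2) + card (?S 3) + card (?S 4) + card (?S 5)" by simp
  finally have "card (carrier G) = card (?S 1) + card (?S 2) + card (?S 3) + card (?S 4) + card (?S 5)"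
    using car by argo
  then have sum: "60 = 1 + card (?S 2) + card (?S 3) + card (?S 4) + card (?S 5)"
    using ord60 S1 by (simp add: order_def)
  obtain a b c d where abcd: "card (?S 5) = 12 * a" "card (?S 3) = 20 * b" "card (?S 2) = 15 * c" "card (?S 4) = 15 * d"
    using 2[of 2] 2[of 4] 3 5 by (auto elim!: dvdE)
  \<comment> \<open>The 59 nontrivial elements can be distributed in only one way, up to the split
    between orders 2 and 4.\<close>
  have e: "12 * a + 20 * b + 15 * (c + d) = 59" using sum abcd by simp
  have "a = 2 \<and> b = 1 \<and> c + d = 1"
  proof -
    have "a \<le> 4" "b \<le> 2" using e by linarith+
    then have "a = 0 \<or> a = 1 \<or> a = 2 \<or> a = 3 \<or> a = 4" "b = 0 \<or> b = 1 \<or> b = 2" by linarith+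
    then show ?thesis using e by (elim disjE) (simp_all, presburger+)
  qed
  \<comment> \<open>Squares of elements of order 4 have order 2, so a nonzero d would make c nonzero
    too, against c + d = 1.\<close>
  moreover have "d = 0"
  proof (rule ccontr)
    assume "d \<noteq> 0"
    then have "card (?S 4) \<noteq> 0" using abcd by simp
    then have "?S 4 \<noteq> {}" by (intro notI) simp
    then obtain z where z: "z \<in> carrier G" "ord z = 4" by blast
    have "z [^] (2::nat) \<in> ?S 2" using z ord_pow[OF z(1), of 2] by simp
    then have "card (?S 2) \<noteq> 0" using finS[of 2] by (auto simp: card_eq_0_iff)
    then show False using abcd \<open>d \<noteq> 0\<close> \<open>a = 2 \<and> b = 1 \<and> c + d = 1\<close> by simp
  qed
  ultimately show "card (?S 2) = 15" "card (?S 3) = 20" "?S 4 = {}" "card (?S 5) = 24"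
    using abcd finS[of 4] by auto
qed

section \<open>Cyclic subgroups of index at most 15\<close>

text \<open>The exception at \<open>j = 12\<close> is caused by \<open>A\<^sub>5\<close>. Fixing the carrier type to be \<open>nat\<close> lets this serve as an
  induction hypothesis that applies to quotients, whose carriers have another type.\<close>

definition solvable_index :: "nat \<Rightarrow> bool"
  where "solvable_index j \<longleftrightarrow> (\<forall>(G :: nat monoid) x. group G \<longrightarrow> finite (carrier G) \<longrightarrow> x \<in> carrier G \<longrightarrow>
    order G = j * group.ord G x \<longrightarrow> (j = 12 \<longrightarrow> \<not> 60 dvd order G) \<longrightarrow> solvable G)"

lemma (in group) solvable_indexD:
  assumes "solvable_index j" "finite (carrier G)" "x \<in> carrier G" "order G = j * ord x"
    "j = 12 \<Longrightarrow> \<not> 60 dvd order G"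
  shows "solvable G"
proof -
  obtain N :: "nat monoid" and f where N: "group N" "group_hom G N f" "bij_betw f (carrier G) (carrier N)"
    using ex_nat_group[OF assms(2)] by metis
  interpret f: group_hom G N f by fact
  have inj: "inj_on f (carrier G)" using N(3) by (simp add: bij_betw_def)
  have "order N = order G" using bij_betw_same_card[OF N(3)] by (simp add: order_def)
  moreover have "f.H.ord (f x) = ord x" using f.ord_inj[OF inj assms(3)] .
  moreover have "finite (carrier N)" using bij_betw_finite[OF N(3)] assms(2) by simp
  ultimately have "solvable N"
    using assms(1)[unfolded solvable_index_def, rule_format, of N "f x"] N(1) assms f.hom_closed by simp
  then show ?thesis using f.inj_hom_imp_solvable[OF inj] by simp
qed

lemma (in group) subgroup_pow_closed:
  assumes "subgroup H G" "h \<in> H" shows "h [^] (n::nat) \<in> H"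
  by (induction n) (use assms subgroup.one_closed subgroup.m_closed in auto)

lemma (in group) solvable_subgroup_indexD:
  assumes "solvable_index j" "finite (carrier G)" "subgroup H G" "x \<in> H" "card H = j * ord x" "j \<noteq> 12"
  shows "solvable (G\<lparr>carrier := H\<rparr>)"
proof -
  interpret H: group "G\<lparr>carrier := H\<rparr>" using subgroup_imp_group[OF assms(3)] .
  show ?thesis
    by (rule H.solvable_indexD[OF assms(1), of x])
      (use assms ord_subgroup[OF assms(3,4)] finite_subset[OF subgroup.subset[OF assms(3)]] in \<open>auto simp: order_def\<close>)
qed

text \<open>M is abelian and malnormal, so transfer retracts G onto it. The kernel has order d and
  is solvable by \<open>IH\<close>, and the image M is abelian.\<close>

lemma (in group) solvable_of_cyclic_maximal:
  assumes fin: "finite (carrier G)" and M: "maximal_subgroup M G" and core: "core G M = {\<one>}"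
    and x: "x \<in> M" "card M = ord x" and d: "order G = d * card M" "1 < d" "d \<le> 15"
    and IH: "\<And>j. j < d \<Longrightarrow> solvable_index j"
  shows "solvable G"
proof -
  have MG: "subgroup M G" using M by (simp add: maximal_subgroup_def)
  interpret M: subgroup M G by fact
  have finM: "finite M" using finite_subset[OF M.subset fin] .
  have xG: "x \<in> carrier G" using x by simp
  have Mx: "generate G {x} = M"
  proof (rule card_subset_eq[OF finM])
    show "generate G {x} \<subseteq> M" using x MG by (simp add: generate_subgroup_incl)
    show "card (generate G {x}) = card M" using x generate_pow_card[OF xG] by simp
  qed
  have comm: "a \<otimes> b = b \<otimes> a" if ab: "a \<in> M" "b \<in> M" for a b
  proof -
    obtain i j :: nat where "a = x [^] i" "b = x [^] j"
      using ab mem_generate_iff[OF fin xG] unfolding Mx by blast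
    then show ?thesis using xG by (simp add: nat_pow_mult add.commute)
  qed
  have mal: "u = \<one>" if "g \<in> carrier G" "g \<notin> M" "u \<in> M" "g \<otimes> u \<otimes> inv g \<in> M" for g u
    by (rule malnormal_of_maximal[OF fin M core x(1), unfolded Mx]) (use that x in auto)
  have "\<exists>V. group_hom G (G\<lparr>carrier := M\<rparr>) V \<and> (\<forall>a\<in>M. V a = a)"
  proof (rule retraction_of_malnormal[OF fin MG])
    show "a \<otimes> b = b \<otimes> a" if "a \<in> M" "b \<in> M" for a b using comm that .
    show "u = \<one>" if "g \<in> carrier G" "g \<notin> M" "u \<in> M" "g \<otimes> u \<otimes> inv g \<in> M" for g u using mal that .
  qed blast
  then obtain V where V: "group_hom G (G\<lparr>carrier := M\<rparr>) V" "\<And>a. a \<in> M \<Longrightarrow> V a = a" by blast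
  let ?M = "G\<lparr>carrier := M\<rparr>"
  interpret V: group_hom G ?M V by fact
  let ?N = "kernel G ?M V"
  have N: "subgroup ?N G" by (rule V.subgroup_kernel)
  have surj: "V ` carrier G = carrier ?M"
  proof
    show "carrier ?M \<subseteq> V ` carrier G"
    proof
      fix a assume "a \<in> carrier ?M"
      then show "a \<in> V ` carrier G" using V(2) by (intro image_eqI[of _ _ a]) auto
    qed
  qed (use V.hom_closed in auto)
  have "card (rcosets ?N) = card M"
    using iso_same_order[OF V.FactGroup_iso_set[OF surj]] by (simp add: order_def FactGroup_def)
  moreover have "card M > 0" using M.finite_imp_card_positive[OF fin] .
  ultimately have cN: "card ?N = d" using lagrange[OF N] d(1) by simp
  have "\<not> ?N \<subseteq> {\<one>}"
  proof
    assume "?N \<subseteq> {\<one>}"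
    then have "card ?N \<le> 1" using card_mono[of "{\<one>}" ?N] by simp
    then show False using cN d by simp
  qed
  then obtain y where y: "y \<in> ?N" "y \<noteq> \<one>" by blast
  have yG: "y \<in> carrier G" using y by (simp add: kernel_def)
  interpret N: group "G\<lparr>carrier := ?N\<rparr>" using subgroup_imp_group[OF N] .
  have "ord y dvd d"
    using N.ord_dvd_group_order[of y] y(1) ord_subgroup[OF N y(1)] cN by (simp add: order_def)
  then have "d = d div ord y * ord y" by simp
  then obtain j where j: "d = j * ord y" by blast
  have "ord y \<noteq> 1" "ord y \<ge> 1" using y(2) ord_eq_1[OF yG] ord_ge_1[OF fin yG] by auto
  then have o2: "ord y \<ge> 2" by simp
  \<comment> \<open>So j is at most 7, which keeps clear of the exceptional index 12.\<close>
  have "j * 2 \<le> d" using o2 j by simp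
  then have "j < d" "j \<noteq> 12" using d by auto
  then have sN: "solvable (G\<lparr>carrier := ?N\<rparr>)"
    using solvable_subgroup_indexD[OF IH fin N y(1), of j] cN j by simp
  have sM: "solvable ?M"
    by (rule group.comm_group_imp_solvable) (use subgroup_imp_group[OF MG] comm in auto)
  have "group_hom (G\<lparr>carrier := ?N\<rparr>) G id"
    using N.group_axioms subgroup.subset[OF N]
    by (auto simp: group_hom_def group_hom_axioms_def group_axioms hom_def)
  from solvable_condition[OF this V(1) surj _ sN sM] show ?thesis by simp
qed

text \<open>If d is prime, an element of order d generates a subgroup of index
  \<open>card M\<close>, which is below 2 d by \<open>ord_le_of_index_two\<close>. For d = 6 only
  the orders 12, 24, 36, 48 and 60 remain.\<close>

lemma (in group) solvable_of_index_two_maximal: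
  assumes fin: "finite (carrier G)" and M: "maximal_subgroup M G" and core: "core G M = {\<one>}"
    and x: "x \<in> M" "card M = 2 * ord x" and d: "order G = d * card M" "d = 5 \<or> d = 6 \<or> d = 7"
    and IH: "\<And>j. j < 2 * d \<Longrightarrow> solvable_index j"
  shows "solvable G \<or> d = 6 \<and> order G = 60"
proof -
  have MG: "subgroup M G" using M by (simp add: maximal_subgroup_def)
  have xG: "x \<in> carrier G" using x subgroup.mem_carrier[OF MG] by simp
  have le: "ord x \<le> d - 1" using ord_le_of_index_two[OF fin M core x d(1)] .
  have pos: "ord x \<ge> 1" using ord_ge_1[OF fin xG] .
  have prime_case: "solvable G" if p: "Factorial_Ring.prime d" "d \<noteq> 6"
  proof -
    obtain y where y: "y \<in> carrier G" "ord y = d" using cauchy[OF fin p(1)] d(1) by auto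
    show ?thesis
    proof (rule solvable_indexD[OF IH fin y(1)])
      show "card M < 2 * d" using x(2) le pos by linarith
      show "order G = card M * ord y" using y d by simp
      show "card M = 12 \<Longrightarrow> \<not> 60 dvd order G"
      proof -
        \<comment> \<open>The exceptional index can arise only for d = 7, where G has order
          84.\<close>
        assume 12: "card M = 12"
        then have "ord x = 6" using x(2) by linarith
        then have "d \<ge> 7" using le by linarith
        then have "d = 7" using d(2) by linarith
        then have "order G = 84" using d(1) 12 by simp
        then show "\<not> 60 dvd order G" by simp
      qed
    qed
  qed
  consider "d = 5" | "d = 6" | "d = 7" using d by blast
  then show ?thesis
  proof cases
    case 1
    then show ?thesis using prime_case by simp
  next
    case 2
    have "ord x = 1 \<or> ord x = 2 \<or> ord x = 3 \<or> ord x = 4 \<or> ord x = 5" using le pos 2 by auto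
    then show ?thesis
    proof (elim disjE)
      assume "ord x = 1"
      then have "order G = 2 ^ 2 * 3" using x d 2 by simp
      then show ?thesis using solvable_of_two_power_index_three by blast
    next
      assume "ord x = 2"
      then have "order G = 2 ^ 3 * 3" using x d 2 by simp
      then show ?thesis using solvable_of_two_power_index_three by blast
    next
      assume "ord x = 3"
      then show ?thesis using x d 2 order_36_imp_solvable by simp
    next
      assume "ord x = 4"
      then have "order G = 2 ^ 4 * 3" using x d 2 by simp
      then show ?thesis using solvable_of_two_power_index_three by blast
    qed (use 2 x d in simp)
  next
    case 3
    then show ?thesis using prime_case by simp
  qed
qed

text \<open>G embeds in the permutations of five cosets, so its order divides 120 and
  \<open>ord x\<close> divides 8. Orders 1 and 2 fall to the induction, 4 to the element counts in
  order 60, and 8 to the fact that permutations of five points have no elements of order 8.\<close>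

lemma (in group) solvable_of_index_three_maximal:
  assumes fin: "finite (carrier G)" and M: "maximal_subgroup M G" and core: "core G M = {\<one>}"
    and x: "x \<in> M" "card M = 3 * ord x" and d: "order G = 5 * card M"
    and IH: "\<And>j. j < 15 \<Longrightarrow> solvable_index j"
  shows "solvable G"
proof (rule ccontr)
  assume ns: "\<not> solvable G"
  have MG: "subgroup M G" using M by (simp add: maximal_subgroup_def)
  interpret M: subgroup M G by fact
  have xG: "x \<in> carrier G" using x by simp
  have cM: "card M > 0" using M.finite_imp_card_positive[OF fin] .
  have cR: "card (rcosets M) = 5" using lagrange[OF MG] d cM by simp
  have "order (G Mod {\<one>}) = order G" using card_rcosets_triv[OF fin] by (simp add: order_def FactGroup_def)
  then have "order G dvd fact 5" using order_Mod_core_dvd[OF fin MG] core cR by simp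
  then have "15 * ord x dvd 15 * 8" using d x by (simp add: fact_numeral)
  then have "ord x dvd 8" by simp
  moreover from this have "ord x \<le> 8" by (rule dvd_imp_le) simp
  moreover have "n = 1 \<or> n = 2 \<or> n = 4 \<or> n = 8" if "n dvd 8" "n \<le> 8" for n :: nat
  proof -
    have "n = 0 \<or> n = 1 \<or> n = 2 \<or> n = 3 \<or> n = 4 \<or> n = 5 \<or> n = 6 \<or> n = 7 \<or> n = 8"
      using that(2) by linarith
    then show ?thesis using that(1) by (elim disjE) simp_all
  qed
  ultimately have o: "ord x = 1 \<or> ord x = 2 \<or> ord x = 4 \<or> ord x = 8" by blast
  have p5: "Factorial_Ring.prime (5::nat)" by simp
  obtain y where y: "y \<in> carrier G" "ord y = 5" using cauchy[OF fin p5] d by auto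
  \<comment> \<open>The subgroup generated by y has index \<open>card M\<close>; for
    \<open>ord x = 4\<close> this would be the exceptional index 12.\<close>
  have small: "solvable G" if "card M < 12"
    by (rule solvable_indexD[OF IH fin y(1), of "card M"]) (use that y d in auto)
  have "ord x = 4 \<or> ord x = 8" using o small ns x(2) by auto
  then show False
  proof
    assume o4: "ord x = 4"
    then have o60: "order G = 60" using d x by simp
    have "ord g \<le> 5" if g: "g \<in> carrier G" for g
    proof (rule ccontr)
      assume "\<not> ord g \<le> 5"
      have "60 = 60 div ord g * ord g" using ord_dvd_group_order[OF g] o60 by simp
      then obtain j where j: "60 = j * ord g" by blast
      have "j < 12"
      proof (rule ccontr)
        assume "\<not> j < 12"
        then have "12 * 6 \<le> j * ord g" using \<open>\<not> ord g \<le> 5\<close> by (intro mult_le_mono) auto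
        then show False using j by simp
      qed
      then have "solvable G" using solvable_indexD[OF IH fin g, of j] o60 j by simp
      then show False using ns by simp
    qed
    from order_60_counts(3)[OF o60 this] show False using xG o4 by blast
  next
    assume o8: "ord x = 8"
    \<comment> \<open>60 is the least common multiple of 1, ..., 5. Two of the six cosets of g x^j
      with j at most 5 coincide, so M contains the conjugate of some x^j with j between 1 and 5, and
      hence that of x^60.\<close>
    have "g \<otimes> x [^] (60::nat) \<otimes> inv g \<in> M" if g: "g \<in> carrier G" for g
    proof -
      let ?f = "\<lambda>j::nat. M #> (g \<otimes> x [^] j)"
      have "?f ` {..5} \<subseteq> rcosets M" using g xG rcosetsI[OF M.subset] by auto
      then have "card (?f ` {..5}) \<le> 5" using card_mono[OF finite_rcosets[OF fin MG]] cR by metis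
      then have "\<not> inj_on ?f {..5}" using card_image[of ?f "{..5}"] by auto
      then obtain a b where ab: "a \<le> 5" "b \<le> 5" "a \<noteq> b" "?f a = ?f b" by (auto simp: inj_on_def)
      have *: "g \<otimes> x [^] (60::nat) \<otimes> inv g \<in> M" if ab: "a < b" "b \<le> 5" "?f a = ?f b" for a b
      proof -
        have "g \<otimes> x [^] b \<in> M #> (g \<otimes> x [^] a)"
          using ab(3) rcos_self[OF _ MG, of "g \<otimes> x [^] b"] g xG by simp
        then have "g \<otimes> x [^] b \<otimes> inv (g \<otimes> x [^] a) \<in> M"
          using M.rcos_module_imp[OF group_axioms, of "g \<otimes> x [^] a"] g xG by simp
        moreover have "x [^] b = x [^] (b - a) \<otimes> x [^] a" using ab xG by (simp add: nat_pow_mult)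
        moreover have "g \<otimes> (x [^] (b - a) \<otimes> x [^] a) \<otimes> inv (g \<otimes> x [^] a)
            = g \<otimes> x [^] (b - a) \<otimes> (x [^] a \<otimes> inv (x [^] a)) \<otimes> inv g"
          using g xG by (simp only: inv_mult_group m_assoc m_closed inv_closed nat_pow_closed)
        ultimately have mem: "g \<otimes> x [^] (b - a) \<otimes> inv g \<in> M" using g xG by simp
        have "b - a = 1 \<or> b - a = 2 \<or> b - a = 3 \<or> b - a = 4 \<or> b - a = 5" using ab by auto
        then have "b - a dvd 60" by auto
        then obtain c where c: "60 = (b - a) * c" by (rule dvdE)
        have "(g \<otimes> x [^] (b - a) \<otimes> inv g) [^] c \<in> M" using subgroup_pow_closed[OF MG mem] .
        moreover have "(g \<otimes> x [^] (b - a) \<otimes> inv g) [^] c = g \<otimes> x [^] (60::nat) \<otimes> inv g"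
          using conj_pow[OF g, of "x [^] (b - a)" c] xG c by (simp add: nat_pow_pow)
        ultimately show ?thesis by simp
      qed
      show ?thesis using *[of a b] *[of b a] ab by (cases "a < b") auto
    qed
    then have "x [^] (60::nat) \<in> core G M" using xG by (simp add: core_def)
    then have "x [^] (60::nat) = \<one>" using core by blast
    then have "ord x dvd 60" using pow_eq_id[OF xG] by simp
    then show False using o8 by simp
  qed
qed

section \<open>Maximal subgroups and the induction on the index\<close>

lemma (in group) ex_maximal_subgroup:
  assumes fin: "finite (carrier G)" and H: "subgroup H G" "H \<noteq> carrier G"
  obtains M where "maximal_subgroup M G" "H \<subseteq> M"
proof -
  let ?P = "{N. subgroup N G \<and> H \<subseteq> N \<and> N \<noteq> carrier G}"
  have "?P \<subseteq> Pow (carrier G)" using subgroup.subset by auto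
  then have finP: "finite ?P" using fin finite_subset by blast
  have "H \<in> ?P" using H by simp
  then have "?P \<noteq> {}" by blast
  from finite_has_maximal[OF finP this] obtain M where M: "M \<in> ?P" "\<forall>N\<in>?P. M \<subseteq> N \<longrightarrow> M = N" by auto
  have "maximal_subgroup M G" unfolding maximal_subgroup_def
  proof (intro conjI allI impI)
    fix N assume N: "subgroup N G" "M \<subseteq> N"
    show "N = M \<or> N = carrier G"
    proof (rule disjCI)
      assume "N \<noteq> carrier G"
      then have "N \<in> ?P" using N M(1) by auto
      then show "N = M" using M(2) N(2) by auto
    qed
  qed (use M in auto)
  then show ?thesis using that M by auto
qed

lemma (in group) subgroup_index:
  assumes "finite (carrier G)" "subgroup H G" "subgroup K G" "K \<subseteq> H"
  obtains e where "card H = e * card K"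
proof -
  interpret H: group "G\<lparr>carrier := H\<rparr>" using subgroup_imp_group[OF assms(2)] .
  have "subgroup K (G\<lparr>carrier := H\<rparr>)" using subgroup_incl[OF assms(3,2,4)] .
  from H.lagrange[OF this] show ?thesis by (intro that[of "card (rcosets\<^bsub>G\<lparr>carrier := H\<rparr>\<^esub> K)"]) (simp add: order_def)
qed

lemma (in group) quotient_by_core:
  assumes fin: "finite (carrier G)" and M: "maximal_subgroup M G"
  defines "Q \<equiv> G Mod core G M" and "\<pi> \<equiv> \<lambda>g. core G M #> g"
  shows "maximal_subgroup (\<pi> ` M) Q" "core Q (\<pi> ` M) = {\<one>\<^bsub>Q\<^esub>}"
    "card (\<pi> ` M) * card (core G M) = card M" "order Q * card (core G M) = order G"
proof -
  have MG: "subgroup M G" using M by (simp add: maximal_subgroup_def)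
  interpret M: subgroup M G by fact
  let ?L = "core G M"
  interpret L: normal ?L G using normal_core[OF MG] .
  have LM: "?L \<subseteq> M" using core_subset[OF MG] .
  interpret Q: group Q unfolding Q_def by (rule L.factorgroup_is_group)
  interpret \<pi>: group_hom G Q \<pi>
    using L.r_coset_hom_Mod by (simp add: group_hom_def group_hom_axioms_def group_axioms L.factorgroup_is_group \<pi>_def Q_def)
  have surj: "carrier Q = \<pi> ` carrier G" by (simp add: Q_def \<pi>_def carrier_FactGroup)
  \<comment> \<open>Membership in a subgroup containing the core can be tested in the
    quotient.\<close>
  have sat: "g \<in> N" if N: "subgroup N G" "?L \<subseteq> N" and g: "g \<in> carrier G" "\<pi> g \<in> \<pi> ` N" for g N
  proof -
    obtain n where n: "n \<in> N" "\<pi> g = \<pi> n" using g(2) by blast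
    have nG: "n \<in> carrier G" using n N subgroup.mem_carrier by fast
    have "g \<in> ?L #> n" using n(2) rcos_self[OF g(1) L.subgroup_axioms] by (simp add: \<pi>_def)
    then have "g \<otimes> inv n \<in> N" using L.rcos_module_imp[OF group_axioms nG] N by blast
    then have "g \<otimes> inv n \<otimes> n \<in> N" using n(1) N(1) subgroup.m_closed by fast
    then show ?thesis using g nG by (simp add: m_assoc)
  qed
  show "maximal_subgroup (\<pi> ` M) Q"
    unfolding maximal_subgroup_def
  proof (intro conjI allI impI)
    show "subgroup (\<pi> ` M) Q" by (rule \<pi>.subgroup_img_is_subgroup[OF MG])
    obtain g where g: "g \<in> carrier G" "g \<notin> M" using M M.subset by (auto simp: maximal_subgroup_def)
    show "\<pi> ` M \<noteq> carrier Q"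
    proof
      assume "\<pi> ` M = carrier Q"
      then have "\<pi> g \<in> \<pi> ` M" using g surj by simp
      then show False using sat[OF MG LM] g by blast
    qed
    fix N assume N: "subgroup N Q" "\<pi> ` M \<subseteq> N"
    let ?N = "{g \<in> carrier G. \<pi> g \<in> N}"
    have "subgroup ?N G"
      by (rule subgroupI) (use N(1) in \<open>auto simp: subgroup.one_closed subgroup.m_closed subgroup.m_inv_closed intro!: exI[of _ \<one>]\<close>)
    moreover have "M \<subseteq> ?N" using N(2) M.subset by auto
    ultimately have "?N = M \<or> ?N = carrier G" using M by (simp add: maximal_subgroup_def)
    moreover have "N = \<pi> ` ?N" using subgroup.subset[OF N(1)] surj by auto
    ultimately show "N = \<pi> ` M \<or> N = carrier Q" using surj by auto
  qed
  show "core Q (\<pi> ` M) = {\<one>\<^bsub>Q\<^esub>}"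
  proof
    show "core Q (\<pi> ` M) \<subseteq> {\<one>\<^bsub>Q\<^esub>}"
    proof
      fix z assume z: "z \<in> core Q (\<pi> ` M)"
      then have "z \<in> carrier Q" by (simp add: core_def)
      then obtain g where g: "z = \<pi> g" "g \<in> carrier G" unfolding surj by (rule imageE)
      have "h \<otimes> g \<otimes> inv h \<in> M" if h: "h \<in> carrier G" for h
      proof (rule sat[OF MG LM])
        have "\<forall>q\<in>carrier Q. q \<otimes>\<^bsub>Q\<^esub> z \<otimes>\<^bsub>Q\<^esub> inv\<^bsub>Q\<^esub> q \<in> \<pi> ` M" using z unfolding core_def by blast
        from bspec[OF this \<pi>.hom_closed[OF h]]
        have "\<pi> h \<otimes>\<^bsub>Q\<^esub> \<pi> g \<otimes>\<^bsub>Q\<^esub> inv\<^bsub>Q\<^esub> \<pi> h \<in> \<pi> ` M" unfolding g(1) .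
        moreover have "\<pi> (h \<otimes> g \<otimes> inv h) = \<pi> h \<otimes>\<^bsub>Q\<^esub> \<pi> g \<otimes>\<^bsub>Q\<^esub> inv\<^bsub>Q\<^esub> \<pi> h"
          using g(2) h by simp
        ultimately show "\<pi> (h \<otimes> g \<otimes> inv h) \<in> \<pi> ` M" by (simp only:)
      qed (use g h in simp)
      then have "g \<in> ?L" using g(2) unfolding core_def by blast
      then have "\<pi> g = ?L" unfolding \<pi>_def by (rule coset_join2[OF g(2) L.subgroup_axioms])
      then show "z \<in> {\<one>\<^bsub>Q\<^esub>}" unfolding g(1) Q_def by simp
    qed
    have "\<one>\<^bsub>Q\<^esub> \<in> \<pi> ` M" using imageI[OF M.one_closed, of \<pi>] \<pi>.hom_one by simp
    moreover have "q \<otimes>\<^bsub>Q\<^esub> \<one>\<^bsub>Q\<^esub> \<otimes>\<^bsub>Q\<^esub> inv\<^bsub>Q\<^esub> q = \<one>\<^bsub>Q\<^esub>" if "q \<in> carrier Q" for q using that by simp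
    ultimately have "\<one>\<^bsub>Q\<^esub> \<in> core Q (\<pi> ` M)" unfolding core_def using Q.one_closed by (simp only: mem_Collect_eq) blast
    then show "{\<one>\<^bsub>Q\<^esub>} \<subseteq> core Q (\<pi> ` M)" by blast
  qed
  interpret MM: group "G\<lparr>carrier := M\<rparr>" using subgroup_imp_group[OF MG] .
  have "rcosets\<^bsub>G\<lparr>carrier := M\<rparr>\<^esub> ?L = \<pi> ` M" by (auto simp: RCOSETS_def \<pi>_def)
  then show "card (\<pi> ` M) * card ?L = card M"
    using MM.lagrange[OF subgroup_incl[OF L.subgroup_axioms MG LM]] by (simp add: order_def)
  show "order Q * card ?L = order G"
    using lagrange[OF L.subgroup_axioms] by (simp add: order_def Q_def FactGroup_def)
qed

text \<open>For a maximal M containing x, i = d e with d the index of M and e that of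
  \<open>generate G {x}\<close> in M. If d is at most 4, solvability of M suffices; otherwise e is
  at most 3, and modulo the core M is cyclic or has its cyclic subgroup of index 2 or 3.\<close>

lemma (in group) solvable_of_cyclic_index:
  assumes fin: "finite (carrier G)" and x: "x \<in> carrier G" and i: "order G = i * ord x" "i \<le> 15"
    and IH: "\<And>j. j < i \<Longrightarrow> solvable_index j"
  shows "solvable G \<or> i = 12 \<and> (\<exists>z\<in>carrier G. generate G {z} \<lhd> G \<and> order G = 60 * ord z)"
proof (rule disjCI)
  assume not: "\<not> (i = 12 \<and> (\<exists>z\<in>carrier G. generate G {z} \<lhd> G \<and> order G = 60 * ord z))"
  have pos: "order G > 0" using fin order_gt_0_iff_finite by simp
  have ox: "ord x \<ge> 1" using ord_ge_1[OF fin x] .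
  show "solvable G"
  proof (cases "i = 1")
    case True
    then show ?thesis using cyclic_imp_solvable[OF fin x] i by simp
  next
    case False
    let ?A = "generate G {x}"
    have cA: "card ?A = ord x" using generate_pow_card[OF x] by simp
    have "?A \<noteq> carrier G" using cA i False ox pos by (auto simp: order_def)
    then obtain M where M: "maximal_subgroup M G" "?A \<subseteq> M"
      using ex_maximal_subgroup[OF fin subgroup_generate_single[OF x]] by blast
    have MG: "subgroup M G" "M \<noteq> carrier G" using M by (simp_all add: maximal_subgroup_def)
    have xM: "x \<in> M" using M(2) by (auto intro: generate.incl)
    obtain e where e: "card M = e * ord x"
      using subgroup_index[OF fin MG(1) subgroup_generate_single[OF x] M(2)] cA by metis
    define d where "d = card (rcosets M)"
    have d: "order G = d * card M" using lagrange[OF MG(1)] by (simp add: d_def)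
    have de: "i = d * e" using d e i(1) ox by simp
    have cM: "card M > 0" using subgroup.finite_imp_card_positive[OF MG(1) fin] .
    have e0: "e > 0" using e cM by (cases e) auto
    have "d \<noteq> 1" using d MG card_subset_eq[OF fin subgroup.subset[OF MG(1)]] by (auto simp: order_def)
    moreover have "d \<noteq> 0" using d pos by (cases d) auto
    ultimately have d2: "d \<ge> 2" by simp
    \<comment> \<open>Since i is at most 15, e is at most 7, so \<open>IH\<close> applies to M
      without its exception.\<close>
    have "2 * e \<le> d * e" using d2 by simp
    then have "e < i" "e \<noteq> 12" using de i(2) e0 by linarith+
    then have sM: "solvable (G\<lparr>carrier := M\<rparr>)"
      using solvable_subgroup_indexD[OF IH fin MG(1) xM e] by blast
    show ?thesis
    proof (cases "d \<le> 4")
      case True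
      then show ?thesis using solvable_of_index_le_four[OF fin MG(1) d _ sM] by blast
    next
      case False
      then have d5: "d \<ge> 5" by simp
      have "5 * e \<le> d * e" using d5 by simp
      then have e3: "e \<le> 3" using de i(2) by linarith
      let ?L = "core G M"
      define Q where "Q = G Mod ?L"
      define \<pi> where "\<pi> g = ?L #> g" for g
      interpret L: normal ?L G using normal_core[OF MG(1)] .
      interpret Q: group Q unfolding Q_def by (rule L.factorgroup_is_group)
      interpret \<pi>: group_hom G Q \<pi>
        using L.r_coset_hom_Mod by (simp add: group_hom_def group_hom_axioms_def group_axioms L.factorgroup_is_group \<pi>_def[abs_def] Q_def)
      note quot = quotient_by_core[OF fin M(1), folded Q_def \<pi>_def]
      have LM: "?L \<subseteq> M" using core_subset[OF MG(1)] .
      have finL: "finite ?L" using finite_subset[OF L.subset fin] .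
      have cL: "card ?L > 0" using L.finite_imp_card_positive[OF fin] .
      have finQ: "finite (carrier Q)" using fin by (simp add: Q_def carrier_FactGroup)
      have oQ: "order Q = d * card (\<pi> ` M)"
      proof -
        have "order Q * card ?L = (d * card (\<pi> ` M)) * card ?L" using quot(3,4) d by (simp add: mult.assoc)
        then show ?thesis using cL by simp
      qed
      have xQ: "\<pi> x \<in> \<pi> ` M" "\<pi> x \<in> carrier Q" using xM x by auto
      \<comment> \<open>x^o' generates the intersection of \<open>generate G {x}\<close> with the
        core. The index e splits as f s, with f the index left in the quotient and s the index
        inside the core.\<close>
      define o' where "o' = Q.ord (\<pi> x)"
      have o'pos: "o' \<ge> 1" using Q.ord_ge_1[OF finQ xQ(2)] by (simp add: o'_def)
      have "\<pi> x [^]\<^bsub>Q\<^esub> ord x = \<one>\<^bsub>Q\<^esub>" using x by (simp flip: \<pi>.hom_nat_pow)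
      then have o'dvd: "o' dvd ord x" using Q.pow_eq_id[OF xQ(2)] by (simp add: o'_def)
      let ?y = "x [^] o'"
      have yG: "?y \<in> carrier G" using x by simp
      have "\<pi> ?y = \<one>\<^bsub>Q\<^esub>" using x Q.pow_ord_eq_1[OF xQ(2)] by (simp add: \<pi>.hom_nat_pow o'_def)
      then have yL: "?y \<in> ?L" using coset_join1[OF _ yG L.subgroup_axioms] by (simp add: Q_def \<pi>_def)
      have oy: "ord x = o' * ord ?y" using ord_pow[OF x o'dvd] o'pos o'dvd by simp
      have yLs: "generate G {?y} \<subseteq> ?L" using yL by (simp add: generate_subgroup_incl L.subgroup_axioms)
      have cy: "card (generate G {?y}) = ord ?y" using generate_pow_card[OF yG] by simp
      obtain s where s: "card ?L = s * ord ?y"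
        using subgroup_index[OF fin L.subgroup_axioms subgroup_generate_single[OF yG] yLs] cy by metis
      have oypos: "ord ?y \<ge> 1" using ord_ge_1[OF fin yG] .
      have es: "card (\<pi> ` M) * s = e * o'"
      proof -
        have "(card (\<pi> ` M) * s) * ord ?y = (e * o') * ord ?y"
          using quot(3) s e oy by (simp add: ac_simps)
        then show ?thesis using oypos by simp
      qed
      interpret MQ: subgroup "\<pi> ` M" Q using quot(1) by (simp add: maximal_subgroup_def)
      obtain f where f: "card (\<pi> ` M) = f * o'"
      proof -
        have "generate Q {\<pi> x} \<subseteq> \<pi> ` M" using xQ MQ.subgroup_axioms by (simp add: Q.generate_subgroup_incl)
        from Q.subgroup_index[OF finQ MQ.subgroup_axioms Q.subgroup_generate_single[OF xQ(2)] this]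
        show ?thesis using that Q.generate_pow_card[OF xQ(2)] by (metis o'_def)
      qed
      have fs: "f * s = e" using es f o'pos by simp
      \<comment> \<open>e is 1 or prime. In the second case s = 1 makes the core itself cyclic,
        which the exceptional conclusion requires.\<close>
      have fe: "f = 1 \<or> f = e \<and> s = 1"
      proof -
        have "e = 1 \<or> e = 2 \<or> e = 3" using e0 e3 by linarith
        moreover have "f \<noteq> 0" "s \<noteq> 0" using fs e0 by auto
        moreover have "f \<le> e" "s \<le> e" using fs \<open>f \<noteq> 0\<close> \<open>s \<noteq> 0\<close> by auto
        ultimately show ?thesis using fs by (auto simp: le_Suc_eq numeral_eq_Suc)
      qed
      have "solvable Q"
      proof (cases "f = 1")
        case True
        have "d \<le> i" using de e0 by simp
        then show ?thesis
          using Q.solvable_of_cyclic_maximal[OF finQ quot(1,2) xQ(1) _ oQ] True f i(2) d2 IH o'_def by simp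
      next
        case False
        then have "f = e" and s1: "s = 1" using fe by auto
        have "e = 2 \<or> e = 3" using False \<open>f = e\<close> e0 e3 by linarith
        then show ?thesis
        proof
          assume e2: "e = 2"
          have "d \<le> 7" using de i(2) e2 by simp
          then have d567: "d = 5 \<or> d = 6 \<or> d = 7" using d5 by linarith
          have "solvable Q \<or> d = 6 \<and> order Q = 60"
            by (rule Q.solvable_of_index_two_maximal[OF finQ quot(1,2) xQ(1) _ oQ d567])
              (use f \<open>f = e\<close> e2 de IH o'_def in auto)
          moreover have False if "d = 6 \<and> order Q = 60"
          proof -
            have "generate G {?y} = ?L"
              by (rule card_subset_eq[OF finL yLs]) (use s s1 cy in simp)
            then have "generate G {?y} \<lhd> G" using L.normal_axioms by simp
            moreover have "order G = 60 * ord ?y" using quot(4) that s s1 by simp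
            ultimately show False using not yG de e2 that by auto
          qed
          ultimately show ?thesis by blast
        next
          assume e3: "e = 3"
          have "d = 5" using de i(2) e3 d5 by simp
          then show ?thesis
            using Q.solvable_of_index_three_maximal[OF finQ quot(1,2) xQ(1)] oQ f \<open>f = e\<close> e3 de IH o'_def by simp
        qed
      qed
      moreover have "solvable (G\<lparr>carrier := ?L\<rparr>)"
        by (rule solvable_subgroup_mono[OF MG(1) L.subgroup_axioms LM sM])
      ultimately show ?thesis using solvable_of_normal[OF L.normal_axioms] by (simp add: Q_def)
    qed
  qed
qed

text \<open>The exceptional outcome makes 60 divide the order, which \<open>solvable_index\<close>
  rules out at index 12.\<close>

lemma solvable_index_le_15: "i \<le> 15 \<Longrightarrow> solvable_index i"
proof (induction i rule: less_induct)
  case (less i)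
  show ?case unfolding solvable_index_def
  proof (intro allI impI)
    fix G :: "nat monoid" and x
    assume G: "group G" "finite (carrier G)" "x \<in> carrier G" "order G = i * group.ord G x"
      "i = 12 \<longrightarrow> \<not> 60 dvd order G"
    interpret group G by fact
    have "solvable G \<or> i = 12 \<and> (\<exists>z\<in>carrier G. generate G {z} \<lhd> G \<and> order G = 60 * ord z)"
      by (rule solvable_of_cyclic_index[OF G(2,3,4)]) (use less in auto)
    moreover have "\<not> (i = 12 \<and> (\<exists>z\<in>carrier G. generate G {z} \<lhd> G \<and> order G = 60 * ord z))"
      using G(5) dvd_triv_left by metis
    ultimately show "solvable G" by blast
  qed
qed

section \<open>Power sums of element orders\<close>

text \<open>The residue m has order n / gcd(n, m) in Z_n; m = 0 is the identity, as
  \<open>gcd n 0 = n\<close>. A purely arithmetic form lets it be applied to divisors of the group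
  order.\<close>

definition cyclic_psi :: "nat \<Rightarrow> nat \<Rightarrow> nat"
  where "cyclic_psi k n = (\<Sum>m<n. (n div gcd n m) ^ k)"

lemma (in group) sum_generate:
  assumes fin: "finite (carrier G)" and z: "z \<in> carrier G"
  shows "(\<Sum>u\<in>generate G {z}. f u) = (\<Sum>j< ord z. f (z [^] j))"
proof -
  have inj: "inj_on (\<lambda>j. z [^] j) {..< ord z}"
  proof -
    have "{..< ord z} = {0..ord z - 1}" using ord_ge_1[OF fin z] by auto
    then show ?thesis using ord_inj[OF z] by simp
  qed
  have sub: "(\<lambda>j. z [^] j) ` {..< ord z} \<subseteq> generate G {z}"
    using mem_generate_iff[OF fin z] by auto
  have "finite (generate G {z})"
    using finite_subset[OF generate_incl fin, of "{z}"] z by simp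
  then have "(\<lambda>j. z [^] j) ` {..< ord z} = generate G {z}"
    using card_subset_eq[OF _ sub] card_image[OF inj] generate_pow_card[OF z] by simp
  then show ?thesis using sum.reindex[OF inj, of f] by simp
qed

lemma (in group) ord_pow':
  assumes "finite (carrier G)" "z \<in> carrier G"
  shows "ord (z [^] (j::nat)) = ord z div gcd (ord z) j"
  using ord_pow_gen[OF assms(2), of j] ord_ge_1[OF assms] by auto

lemma (in group) sum_ord_generate:
  assumes "finite (carrier G)" "z \<in> carrier G"
  shows "(\<Sum>u\<in>generate G {z}. ord u ^ k) = cyclic_psi k (ord z)"
  using sum_generate[OF assms, of "\<lambda>u. ord u ^ k"] ord_pow'[OF assms] by (simp add: cyclic_psi_def)

lemma psi_integer_mod_group:
  assumes "n > 0" shows "psi k (integer_mod_group n) = cyclic_psi k n"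
proof -
  let ?Z = "integer_mod_group n"
  interpret Z: group ?Z by simp
  have car: "carrier ?Z = {0..<int n}" using assms by (simp add: carrier_integer_mod_group)
  then have fin: "finite (carrier ?Z)" by simp
  \<comment> \<open>Reducing 1 covers n = 1, where the only element is 0.\<close>
  let ?z = "1 mod int n"
  have z: "?z \<in> carrier ?Z" using assms by (simp add: car)
  have "?z [^]\<^bsub>?Z\<^esub> m = \<one>\<^bsub>?Z\<^esub> \<longleftrightarrow> n dvd m" for m :: nat
  proof -
    have "?z [^]\<^bsub>?Z\<^esub> m = int m mod int n" by (simp add: mod_mult_right_eq)
    then show ?thesis by (simp add: mod_eq_0_iff_dvd flip: of_nat_mod)
  qed
  then have oz: "Z.ord ?z = n" using Z.ord_unique[OF z] by blast
  have "generate ?Z {?z} = carrier ?Z"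
  proof (rule card_subset_eq[OF fin])
    show "generate ?Z {?z} \<subseteq> carrier ?Z" using Z.generate_incl[of "{?z}"] z by simp
    show "card (generate ?Z {?z}) = card (carrier ?Z)"
      using Z.generate_pow_card[OF z] oz by (simp add: car)
  qed
  then show ?thesis using Z.sum_ord_generate[OF fin z, of k] oz by (simp add: psi_def)
qed

lemma bij_betw_mod_mod:
  fixes a b :: nat
  assumes "coprime a b" "a > 0" "b > 0"
  shows "bij_betw (\<lambda>m. (m mod a, m mod b)) {..<a * b} ({..<a} \<times> {..<b})"
  unfolding bij_betw_def
proof
  show inj: "inj_on (\<lambda>m. (m mod a, m mod b)) {..<a * b}"
  proof (rule inj_onI)
    fix x y assume xy: "x \<in> {..<a * b}" "y \<in> {..<a * b}" "(x mod a, x mod b) = (y mod a, y mod b)"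
    then have "[x = y] (mod a)" "[x = y] (mod b)" by (simp_all add: cong_def)
    then have "[x = y] (mod a * b)" using coprime_cong_mult_nat assms(1) by blast
    then show "x = y" using xy by (simp add: cong_def)
  qed
  show "(\<lambda>m. (m mod a, m mod b)) ` {..<a * b} = {..<a} \<times> {..<b}"
    by (rule card_subset_eq) (use assms card_image[OF inj] in auto)
qed

lemma gcd_mult_coprime:
  fixes a b m :: nat
  assumes "coprime a b" shows "gcd (a * b) m = gcd a m * gcd b m"
proof (rule dvd_antisym)
  have "coprime (gcd a m) (gcd b m)" using assms by (meson coprime_divisors gcd_dvd1)
  then show "gcd a m * gcd b m dvd gcd (a * b) m"
    by (intro gcd_greatest mult_dvd_mono divides_mult) auto
  obtain c d where cd: "gcd (a * b) m = c * d" "c dvd a" "d dvd b"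
    using division_decomp[of "gcd (a * b) m" a b] by auto
  then have "c dvd gcd a m" "d dvd gcd b m"
    by (metis dvd_mult_left dvd_mult_right gcd_dvd2 gcd_greatest)+
  then show "gcd (a * b) m dvd gcd a m * gcd b m" using cd by (simp add: mult_dvd_mono)
qed

lemma cyclic_psi_mult_coprime:
  assumes "coprime a b" "a > 0" "b > 0"
  shows "cyclic_psi k (a * b) = cyclic_psi k a * cyclic_psi k b"
proof -
  have "cyclic_psi k (a * b) = (\<Sum>m<a * b. (case (m mod a, m mod b) of (i, j) \<Rightarrow> (a div gcd a i) ^ k * (b div gcd b j) ^ k))"
    unfolding cyclic_psi_def
  proof (rule sum.cong[OF refl])
    fix m
    have "gcd (a * b) m = gcd a (m mod a) * gcd b (m mod b)"
      using gcd_mult_coprime[OF assms(1)] by (simp add: gcd.commute gcd_red_nat[symmetric] flip: gcd_red_nat[of m])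
    then show "(a * b div gcd (a * b) m) ^ k = (case (m mod a, m mod b) of (i, j) \<Rightarrow> (a div gcd a i) ^ k * (b div gcd b j) ^ k)"
      by (simp add: div_mult_div_if_dvd power_mult_distrib[symmetric])
  qed
  also have "\<dots> = (\<Sum>(i, j)\<in>{..<a} \<times> {..<b}. (a div gcd a i) ^ k * (b div gcd b j) ^ k)"
    using sum.reindex_bij_betw[OF bij_betw_mod_mod[OF assms],
        of "\<lambda>(i, j). (a div gcd a i) ^ k * (b div gcd b j) ^ k"] by simp
  also have "\<dots> = cyclic_psi k a * cyclic_psi k b"
    by (simp add: cyclic_psi_def sum_product sum.cartesian_product)
  finally show ?thesis .
qed

lemma cyclic_psi_1 [simp]: "cyclic_psi k (Suc 0) = 1"
  by (simp add: cyclic_psi_def)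

text \<open>The multiples of q form a copy of the cyclic group of order \<open>q ^ a\<close>; every
  other residue is a generator.\<close>

lemma cyclic_psi_prime_power_Suc:
  assumes q: "Factorial_Ring.prime (q::nat)"
  shows "cyclic_psi k (q ^ Suc a) = cyclic_psi k (q ^ a) + (q - 1) * q ^ a * (q ^ Suc a) ^ k"
proof -
  let ?n = "q ^ Suc a"
  let ?D = "(\<lambda>m. q * m) ` {..<q ^ a}"
  have q0: "q > 0" using q prime_gt_0_nat by blast
  have D: "?D = {m \<in> {..<?n}. q dvd m}"
    using q0 by (auto elim!: dvdE)
  have inj: "inj_on (\<lambda>m. q * m) {..<q ^ a}" using q0 by (auto simp: inj_on_def)
  have "cyclic_psi k ?n = (\<Sum>m\<in>?D. (?n div gcd ?n m) ^ k) + (\<Sum>m\<in>{..<?n} - ?D. (?n div gcd ?n m) ^ k)"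
    unfolding cyclic_psi_def
    by (subst sum.subset_diff[of ?D]) (use D in auto)
  also have "(\<Sum>m\<in>?D. (?n div gcd ?n m) ^ k) = cyclic_psi k (q ^ a)"
    unfolding cyclic_psi_def using sum.reindex[OF inj, of "\<lambda>m. (?n div gcd ?n m) ^ k"] q0
    by (simp add: gcd_mult_distrib_nat[symmetric])
  also have "(\<Sum>m\<in>{..<?n} - ?D. (?n div gcd ?n m) ^ k) = (\<Sum>m\<in>{..<?n} - ?D. ?n ^ k)"
  proof (rule sum.cong[OF refl])
    fix m assume "m \<in> {..<?n} - ?D"
    then have "\<not> q dvd m" unfolding D by blast
    then have "coprime ?n m" using q by (simp add: prime_imp_coprime)
    then show "(?n div gcd ?n m) ^ k = ?n ^ k" by simp
  qed
  also have "\<dots> = card ({..<?n} - ?D) * ?n ^ k" by simp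
  also have "card ({..<?n} - ?D) = ?n - q ^ a"
    using card_Diff_subset[of ?D "{..<?n}"] D card_image[OF inj] by auto
  also have "?n - q ^ a = (q - 1) * q ^ a" using q0 by (simp add: diff_mult_distrib)
  finally show ?thesis .
qed

lemma cyclic_psi_prime_power:
  assumes q: "Factorial_Ring.prime (q::nat)"
  shows "cyclic_psi k (q ^ a) = 1 + (q - 1) * q ^ k * (\<Sum>j<a. (q ^ Suc k) ^ j)"
proof (induction a)
  case (Suc a)
  have "(q ^ Suc a) ^ k = q ^ k * (q ^ k) ^ a" by (simp add: power_mult_distrib power_mult[symmetric] mult.commute)
  then show ?case
    using Suc by (simp only: cyclic_psi_prime_power_Suc[OF q] sum.lessThan_Suc) (simp add: algebra_simps power_mult_distrib)
qed simp

text \<open>Multiplying by q^(k+1) - 1 sums the geometric series, and the two sides then differ by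
  exactly \<open>q ^ k - 1\<close>.\<close>

lemma cyclic_psi_prime_power_ge:
  assumes q: "Factorial_Ring.prime (q::nat)"
  shows "(real q - 1) * q ^ k * (q ^ a) ^ Suc k \<le> real (cyclic_psi k (q ^ a)) * (real q ^ Suc k - 1)"
proof -
  have q2: "real q \<ge> 2" using prime_ge_2_nat[OF q] by simp
  have X: "real q ^ Suc k \<noteq> 1" using q2 one_less_power[of "real q" "Suc k"] by (metis less_irrefl less_le_trans one_less_numeral_iff semiring_norm(76) zero_less_Suc)
  have rq: "real (q - 1) = real q - 1" using q2 by (simp add: of_nat_diff)
  have "real (cyclic_psi k (q ^ a)) * (real q ^ Suc k - 1) =
      (real q ^ Suc k - 1) + (real q - 1) * q ^ k * ((\<Sum>j<a. (real q ^ Suc k) ^ j) * (real q ^ Suc k - 1))"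
    using rq by (simp add: cyclic_psi_prime_power[OF q] algebra_simps)
  also have "(\<Sum>j<a. (real q ^ Suc k) ^ j) * (real q ^ Suc k - 1) = (real q ^ Suc k) ^ a - 1"
    using geometric_sum[OF X, of a] X by simp
  also have "(real q ^ Suc k) ^ a = (real q ^ a) ^ Suc k" by (simp only: power_mult[symmetric] mult.commute)
  also have "(real q ^ Suc k - 1) + (real q - 1) * q ^ k * ((real q ^ a) ^ Suc k - 1) =
      (real q - 1) * q ^ k * (real q ^ a) ^ Suc k + (real q ^ k - 1)"
    by (simp add: algebra_simps)
  also have "\<dots> \<ge> (real q - 1) * q ^ k * (real q ^ a) ^ Suc k"
    using one_le_power[of "real q" k] q2 by simp
  finally show ?thesis by simp
qed

text \<open>The bound on \<open>w q\<close> is (q-1) q^k / (q^(k+1) - 1), the limit for large a of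
  psi_k(Z_m) / m^(k+1) at m = q^a. The weights stay free because 1 - 1/q is convenient but too weak
  at q = 2 when k = 4.\<close>

lemma cyclic_psi_ge_prod:
  fixes w :: "nat \<Rightarrow> real"
  assumes "n > 0"
    and w: "\<And>q. q \<in> prime_factors n \<Longrightarrow> 0 \<le> w q \<and> w q * (real q ^ Suc k - 1) \<le> (real q - 1) * q ^ k"
  shows "real n ^ Suc k * (\<Prod>q\<in>prime_factors n. w q) \<le> cyclic_psi k n"
  using assms
proof (induction n rule: less_induct)
  case (less n)
  show ?case
  proof (cases "n = 1")
    case False
    then obtain q where q: "Factorial_Ring.prime q" "q dvd n" using prime_factor_nat by blast
    define a where "a = multiplicity q n"
    obtain m where m: "n = q ^ a * m" "\<not> q dvd m"
    proof (rule multiplicity_decompose'[of n q])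
      show "n \<noteq> 0" "\<not> is_unit q" using less.prems(1) not_prime_unit q(1) by auto
    qed (use that in \<open>auto simp: a_def\<close>)
    have a0: "a > 0" using q less.prems(1) by (simp add: a_def prime_multiplicity_gt_zero_iff)
    have m0: "m > 0" using m(1) less.prems(1) by (cases m) auto
    have q2: "q \<ge> 2" using prime_ge_2_nat[OF q(1)] .
    have "q ^ a > 1" using one_less_power[of q a] q2 a0 by simp
    then have mn: "m < n" using m m0 by simp
    have cop: "coprime (q ^ a) m" using m(2) q(1) by (simp add: prime_imp_coprime)
    have pf: "prime_factors n = insert q (prime_factors m)"
    proof -
      have "p dvd n \<longleftrightarrow> p = q \<or> p dvd m" if p: "Factorial_Ring.prime p" for p
      proof -
        have "p dvd q ^ a \<longleftrightarrow> p = q"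
          using primes_dvd_imp_eq[OF p q(1)] prime_dvd_power[OF p, of q a] a0 by (auto intro: dvd_power)
        then show ?thesis using m(1) p by (simp add: prime_dvd_mult_iff)
      qed
      then show ?thesis using less.prems(1) m0 q(1) by (auto simp: prime_factors_dvd)
    qed
    have qm: "q \<notin> prime_factors m" using m(2) by auto
    have IH: "real m ^ Suc k * (\<Prod>q\<in>prime_factors m. w q) \<le> cyclic_psi k m"
      using less.IH[OF mn m0] less.prems(2) pf by simp
    have wq: "0 \<le> w q" "w q * (real q ^ Suc k - 1) \<le> (real q - 1) * q ^ k" using less.prems(2) pf by auto
    have X: "real q ^ Suc k - 1 > 0" using one_less_power[of "real q" "Suc k"] q2 by simp
    have "(real q ^ a) ^ Suc k * w q * (real q ^ Suc k - 1) \<le> (real q ^ a) ^ Suc k * ((real q - 1) * q ^ k)"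
      using mult_left_mono[OF wq(2), of "(real q ^ a) ^ Suc k"] by (simp add: mult.assoc)
    also have "\<dots> \<le> real (cyclic_psi k (q ^ a)) * (real q ^ Suc k - 1)"
      using cyclic_psi_prime_power_ge[OF q(1), of k a] by (simp add: mult.commute)
    finally have 1: "(real q ^ a) ^ Suc k * w q \<le> cyclic_psi k (q ^ a)" using X by simp
    have "real n ^ Suc k * (\<Prod>q\<in>prime_factors n. w q) =
        ((real q ^ a) ^ Suc k * w q) * (real m ^ Suc k * (\<Prod>q\<in>prime_factors m. w q))"
      using qm m(1) pf by (simp add: power_mult_distrib)
    also have "\<dots> \<le> real (cyclic_psi k (q ^ a)) * real (cyclic_psi k m)"
      using 1 IH wq(1) less.prems(2) pf
      by (intro mult_mono) (auto intro!: prod_nonneg mult_nonneg_nonneg)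
    also have "\<dots> = cyclic_psi k n"
      using cyclic_psi_mult_coprime[OF cop] m(1) m0 q2 by simp
    finally show ?thesis .
  qed simp
qed

section \<open>Element orders summed over cosets of a cyclic normal subgroup\<close>

lemma sum_periodic:
  fixes f :: "nat \<Rightarrow> nat"
  assumes "\<And>j. f (j + r) = f j"
  shows "(\<Sum>j<q * r. f j) = q * (\<Sum>j<r. f j)"
proof -
  have per: "f (j + m * r) = f j" for j m
    by (induction m) (use assms in \<open>simp_all add: add.assoc[symmetric] add.commute[of r]\<close>)
  have "(\<Sum>j<q * r. f j) = (\<Sum>m<q. sum f {m * r..<m * r + r})"
    by (rule sum.nat_group[symmetric])
  also have "\<dots> = (\<Sum>m<q. \<Sum>j<r. f j)"
  proof (rule sum.cong[OF refl])
    fix m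
    show "sum f {m * r..<m * r + r} = (\<Sum>j<r. f j)"
      using sum.shift_bounds_nat_ivl[of f 0 "m * r" r] per by (simp add: add.commute atLeast0LessThan)
  qed
  finally show ?thesis by simp
qed

text \<open>The coset has a representative h whose m-th power is killed by q, so the order of h u is
  at most m q times that of u^q. Summed over u, this gives q^k from the bound and one more q because
  u to u^q is q-to-one.\<close>

lemma (in group) sum_ord_coset_le:
  assumes fin: "finite (carrier G)" and z: "z \<in> carrier G" and K: "generate G {z} \<lhd> G"
    and qr: "ord z = q * r" and C: "C \<in> carrier (G Mod generate G {z})"
    and m: "m = group.ord (G Mod generate G {z}) C" and cop: "coprime m r"
  shows "(\<Sum>g\<in>C. ord g ^ k) \<le> m ^ k * q ^ Suc k * cyclic_psi k r"
proof -
  let ?K = "generate G {z}"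
  interpret K: normal ?K G by fact
  interpret Q: group "G Mod ?K" by (rule K.factorgroup_is_group)
  note memK = mem_generate_iff[OF fin z]
  obtain g where g: "g \<in> carrier G" "C = ?K #> g" using C by (auto simp: carrier_FactGroup)
  have finQ: "finite (carrier (G Mod ?K))" using fin by (simp add: carrier_FactGroup)
  have mpos: "m > 0" using Q.ord_ge_1[OF finQ C] m by simp
  have oz: "ord z > 0" using ord_ge_1[OF fin z] by simp
  have powC: "?K #> g [^] n = C [^]\<^bsub>G Mod ?K\<^esub> n" for n :: nat
    using K.FactGroup_pow[OF g(1), of n] g(2) by simp
  have "?K #> g [^] m = ?K" using powC[of m] Q.pow_ord_eq_1[OF C] m by simp
  then have "g [^] m \<in> ?K" using coset_join1[OF _ _ K.subgroup_axioms] g(1) by simp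
  then obtain j0 :: nat where j0: "g [^] m = z [^] j0" using memK by blast
  \<comment> \<open>t = 1 modulo m keeps g^t in the coset of g; r dividing t makes its m-th power an
    r-th power in the cyclic subgroup, hence killed by q.\<close>
  obtain t where t: "[t = 1] (mod m)" "[t = 0] (mod r)"
    using binary_chinese_remainder_nat[OF cop] by blast
  define h where "h = g [^] t"
  have hG: "h \<in> carrier G" using g by (simp add: h_def)
  have "C [^]\<^bsub>G Mod ?K\<^esub> t = C [^]\<^bsub>G Mod ?K\<^esub> (1::nat)"
  proof -
    have "int m dvd int 1 - int t" using t(1) by (metis cong_iff_dvd_diff cong_int_iff cong_sym)
    then have "C [^]\<^bsub>G Mod ?K\<^esub> int t = C [^]\<^bsub>G Mod ?K\<^esub> int 1"
      using Q.int_pow_eq[OF C, of "int t" "int 1"] m by blast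
    then show ?thesis by (simp only: int_pow_int)
  qed
  then have hC: "?K #> h = C" using powC[of t] Q.nat_pow_eone[OF C] by (simp add: h_def)
  have "h [^] m = z [^] (j0 * t)"
    using g(1) z j0 by (simp add: h_def nat_pow_pow mult.commute[of t]) (simp flip: nat_pow_pow)
  moreover have "r dvd t" using t(2) by (simp add: cong_0_iff)
  ultimately have hmq: "(h [^] m) [^] q = \<one>"
    using z qr pow_eq_id[OF z, of "j0 * t * q"] by (simp add: nat_pow_pow mult.commute[of q])
  obtain a :: nat where a: "inv h \<otimes> z \<otimes> h = z [^] a"
    using K.inv_op_closed1[OF hG, of z] memK by (auto intro: generate.incl)
  have conj: "inv h \<otimes> u \<otimes> h = u [^] a" if u: "u \<in> ?K" for u
  proof -
    obtain j :: nat where j: "u = z [^] j" using u memK by blast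
    have "inv h \<otimes> z [^] j \<otimes> h = (z [^] a) [^] j" using conj_pow[of "inv h" z j] hG z a by simp
    then show ?thesis using j z by (simp add: nat_pow_pow mult.commute)
  qed
  \<comment> \<open>Moving h past a power of u only changes the exponent, since h acts on the cyclic
    subgroup as a power map.\<close>
  have expand: "\<exists>s::nat. (h \<otimes> u) [^] n = h [^] n \<otimes> u [^] s" if u: "u \<in> ?K" for u and n :: nat
  proof (induction n)
    case 0
    show ?case by (intro exI[of _ 0]) simp
  next
    case (Suc n)
    then obtain s :: nat where s: "(h \<otimes> u) [^] n = h [^] n \<otimes> u [^] s" by blast
    have uG: "u \<in> carrier G" using u by simp
    have "u [^] s \<in> ?K" using subgroup_pow_closed[OF K.subgroup_axioms u] .
    from conj[OF this] have "h \<otimes> (inv h \<otimes> u [^] s \<otimes> h) = h \<otimes> u [^] (s * a)" using uG by (simp add: nat_pow_pow)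
    moreover have "h \<otimes> (inv h \<otimes> u [^] s \<otimes> h) = (h \<otimes> inv h) \<otimes> (u [^] s \<otimes> h)"
      using uG hG by (simp only: m_assoc m_closed inv_closed nat_pow_closed)
    ultimately have us: "u [^] s \<otimes> h = h \<otimes> u [^] (s * a)" using uG hG by simp
    have "(h \<otimes> u) [^] Suc n = h [^] n \<otimes> (u [^] s \<otimes> h) \<otimes> u"
      using s uG hG by (simp add: m_assoc)
    also have "\<dots> = h [^] Suc n \<otimes> u [^] Suc (s * a)"
      unfolding us using uG hG by (simp add: m_assoc)
    finally show ?case by blast
  qed
  have bound: "ord (h \<otimes> u) \<le> m * (q * ord (u [^] q))" if u: "u \<in> ?K" for u
  proof -
    let ?w = "ord (u [^] q)"
    have uG: "u \<in> carrier G" using u by simp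
    obtain s :: nat where s: "(h \<otimes> u) [^] m = h [^] m \<otimes> u [^] s" using expand[OF u] by blast
    have "h [^] m \<in> ?K" "u [^] s \<in> ?K"
      using memK \<open>h [^] m = z [^] (j0 * t)\<close> subgroup_pow_closed[OF K.subgroup_axioms u] by auto
    then obtain i j :: nat where ij: "h [^] m = z [^] i" "u [^] s = z [^] j" using memK by metis
    have comm: "h [^] m \<otimes> u [^] s = u [^] s \<otimes> h [^] m"
      unfolding ij using z by (simp add: nat_pow_mult add.commute)
    have "(h \<otimes> u) [^] (m * (q * ?w)) = (h [^] m \<otimes> u [^] s) [^] (q * ?w)"
      using s uG hG nat_pow_pow[of "h \<otimes> u" m "q * ?w"] by simp
    also have "\<dots> = (h [^] m) [^] (q * ?w) \<otimes> (u [^] s) [^] (q * ?w)"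
      by (rule pow_mult_distrib[OF comm]) (use uG hG in simp_all)
    also have "(h [^] m) [^] (q * ?w) = \<one>"
      using hmq nat_pow_pow[of "h [^] m" q ?w] hG by simp
    also have "(u [^] s) [^] (q * ?w) = ((u [^] q) [^] ?w) [^] s"
      using uG by (simp only: nat_pow_pow nat_pow_closed) (simp add: ac_simps)
    also have "\<dots> = \<one>" using uG by simp
    finally have "ord (h \<otimes> u) dvd m * (q * ?w)" using pow_eq_id[of "h \<otimes> u"] uG hG by simp
    moreover have "m * (q * ?w) > 0" using mpos oz qr ord_ge_1[OF fin, of "u [^] q"] uG by auto
    ultimately show ?thesis by (rule dvd_imp_le)
  qed
  have Ch: "C = (\<lambda>u. h \<otimes> u) ` ?K"
    using K.coset_eq hG hC by (auto simp: l_coset_def)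
  have inj: "inj_on (\<lambda>u. h \<otimes> u) ?K" using hG by (auto simp: inj_on_def)
  have "(\<Sum>g\<in>C. ord g ^ k) = (\<Sum>u\<in>?K. ord (h \<otimes> u) ^ k)"
    unfolding Ch using sum.reindex[OF inj, of "\<lambda>g. ord g ^ k"] by simp
  also have "\<dots> \<le> (\<Sum>u\<in>?K. (m * (q * ord (u [^] q))) ^ k)"
    by (intro sum_mono power_mono bound) simp_all
  also have "\<dots> = (m * q) ^ k * (\<Sum>u\<in>?K. ord (u [^] q) ^ k)"
    by (simp add: sum_distrib_left power_mult_distrib mult.assoc)
  also have "(\<Sum>u\<in>?K. ord (u [^] q) ^ k) = (\<Sum>j< ord z. ord ((z [^] j) [^] q) ^ k)"
    by (rule sum_generate[OF fin z])
  also have "\<dots> = (\<Sum>j<q * r. (r div gcd r j) ^ k)"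
  proof (rule sum.cong)
    show "{..< ord z} = {..<q * r}" using qr by simp
    fix j
    have "ord ((z [^] j) [^] q) = q * r div gcd (q * r) (q * j)"
      using ord_pow'[OF fin z, of "j * q"] z qr by (simp add: nat_pow_pow mult.commute)
    also have "\<dots> = r div gcd r j" using oz qr by (simp add: gcd_mult_distrib_nat[symmetric])
    finally show "ord ((z [^] j) [^] q) ^ k = (r div gcd r j) ^ k" by simp
  qed
  also have "\<dots> = q * cyclic_psi k r"
    unfolding cyclic_psi_def
  proof (rule sum_periodic)
    fix j
    have "gcd r (j + r) = gcd r j" using gcd_add2[of r j] by (simp add: add.commute)
    then show "(r div gcd r (j + r)) ^ k = (r div gcd r j) ^ k" by simp
  qed
  finally show ?thesis by (simp add: power_mult_distrib ac_simps)
qed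

lemma (in group) psi_eq_sum_cosets:
  assumes fin: "finite (carrier G)" and K: "K \<lhd> G"
  shows "psi k G = (\<Sum>C\<in>carrier (G Mod K). \<Sum>g\<in>C. ord g ^ k)"
proof -
  interpret K: normal K G by fact
  have "psi k G = (\<Sum>g\<in>\<Union>(rcosets K). ord g ^ k)"
    using rcosets_part_G[OF K.subgroup_axioms] by (simp add: psi_def)
  also have "\<dots> = (\<Sum>C\<in>rcosets K. \<Sum>g\<in>C. ord g ^ k)"
  proof (subst sum.Union_disjoint)
    show "\<forall>A\<in>rcosets K. finite A" using cosets_finite[OF _ K.subset fin] by blast
    show "\<forall>A\<in>rcosets K. \<forall>B\<in>rcosets K. A \<noteq> B \<longrightarrow> A \<inter> B = {}"
      using rcos_disjoint[OF K.subgroup_axioms] by (simp add: pairwise_def disjnt_def)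
  qed simp
  finally show ?thesis by (simp add: FactGroup_def)
qed

text \<open>The case q = 1 of the coset estimate: all cosets have order prime to
  \<open>ord z\<close>.\<close>

lemma (in group) psi_le_of_coprime_normal:
  assumes fin: "finite (carrier G)" and z: "z \<in> carrier G" and K: "generate G {z} \<lhd> G"
    and cop: "coprime (ord z) (order (G Mod generate G {z}))"
  shows "psi k G \<le> cyclic_psi k (ord z) * psi k (G Mod generate G {z})"
proof -
  let ?Q = "G Mod generate G {z}"
  interpret Q: group ?Q using normal.factorgroup_is_group[OF K] .
  have "psi k G \<le> (\<Sum>C\<in>carrier ?Q. Q.ord C ^ k * cyclic_psi k (ord z))"
    unfolding psi_eq_sum_cosets[OF fin K]
  proof (rule sum_mono)
    fix C assume C: "C \<in> carrier ?Q"
    have "coprime (Q.ord C) (ord z)"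
      using cop Q.ord_dvd_group_order[OF C] by (metis coprime_commute coprime_divisors dvd_refl)
    then show "(\<Sum>g\<in>C. ord g ^ k) \<le> Q.ord C ^ k * cyclic_psi k (ord z)"
      using sum_ord_coset_le[OF fin z K, of 1 "ord z" C "Q.ord C" k] C by simp
  qed
  then show ?thesis by (simp add: psi_def sum_distrib_left mult.commute)
qed

text \<open>Eliminates one prime \<open>q\<close> from the estimate below: \<open>c\<close> is the factor that the \<open>q\<close>-part of \<open>K\<close> contributes
  on cosets of order prime to \<open>q\<close>, and \<open>P\<close> the one on cosets of order \<open>q\<close>.\<close>

lemma prime_step:
  fixes D c R P U V w e f :: real
  assumes "P * D - R = e" "R - c * D = f" "w * e * V \<le> f * U"
  shows "D * (c * U + w * P * V) \<le> R * (U + w * V)"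
proof -
  have "D * (c * U + w * P * V) = (c * D) * U + w * (P * D) * V" by (simp add: algebra_simps)
  also have "c * D = R - f" using assms(2) by simp
  also have "P * D = R + e" using assms(1) by simp
  finally have "D * (c * U + w * P * V) = R * (U + w * V) + (w * e * V - f * U)"
    by (simp add: algebra_simps)
  then show ?thesis using assms(3) by simp
qed

section \<open>The estimate in the exceptional case\<close>

lemma geometric_sum_closed:
  fixes x :: real
  shows "x ^ a = 1 + (x - 1) * (\<Sum>j<a. x ^ j)" "(\<Sum>j<Suc a. x ^ j) = 1 + x * (\<Sum>j<a. x ^ j)"
proof -
  show 1: "x ^ a = 1 + (x - 1) * (\<Sum>j<a. x ^ j)" for a
  proof (induction a)
    case (Suc a)
    show ?case unfolding sum.lessThan_Suc power_Suc Suc.IH by (simp add: algebra_simps)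
  qed simp
  show "(\<Sum>j<Suc a. x ^ j) = 1 + x * (\<Sum>j<a. x ^ j)"
    unfolding sum.lessThan_Suc 1[of a] by (simp add: algebra_simps)
qed

lemma ex_prime_power_decomposition:
  fixes q n :: nat
  assumes "Factorial_Ring.prime q" "n > 0"
  shows "\<exists>a m. n = q ^ a * m \<and> \<not> q dvd m \<and> m > 0"
proof -
  have "\<not> is_unit q" using not_prime_unit assms(1) by blast
  with assms(2) obtain m where "n = q ^ multiplicity q n * m" "\<not> q dvd m"
    using multiplicity_decompose'[of n q] by blast
  moreover from this have "m > 0" by (cases m) auto
  ultimately show ?thesis by blast
qed

lemma real_cyclic_psi_prime_power:
  assumes "Factorial_Ring.prime (q::nat)"
  shows "real (cyclic_psi k (q ^ a)) = 1 + (real q - 1) * real q ^ k * (\<Sum>j<a. (real q ^ Suc k) ^ j)"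
  using assms prime_ge_2_nat[OF assms] by (simp add: cyclic_psi_prime_power of_nat_diff)

text \<open>Equality holds at a = b = c = 0. The factors of \<open>psi_Z60\<close> for 5, 3 and 2
  are absorbed in this order, each turning a local sum into that of the next higher prime power, or
  two powers higher at 2, since 60 = 4 * 3 * 5.\<close>

lemma exceptional_estimate:
  fixes k a b c :: nat
  defines "x \<equiv> (2::real) ^ k" and "y \<equiv> (3::real) ^ k" and "z \<equiv> (5::real) ^ k"
  defines "ca \<equiv> real (cyclic_psi k (2 ^ a))" and "cb \<equiv> real (cyclic_psi k (3 ^ b))" and "cc \<equiv> real (cyclic_psi k (5 ^ c))"
  shows "((1 + x + 2 * 4 ^ k) * (1 + 2 * y) * (1 + 4 * z)) *
      (ca * cb * cc + 15 * x * (2 ^ a) ^ Suc k * (cb * cc) + 20 * y * (3 ^ b) ^ Suc k * (ca * cc) + 24 * z * (5 ^ c) ^ Suc k * (ca * cb))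
    \<le> (1 + 15 * x + 20 * y + 24 * z) *
      (real (cyclic_psi k (2 ^ Suc (Suc a))) * real (cyclic_psi k (3 ^ Suc b)) * real (cyclic_psi k (5 ^ Suc c)))"
proof -
  have x1: "x \<ge> 1" and y1: "y \<ge> 1" and z1: "z \<ge> 1" by (simp_all add: x_def y_def z_def)
  have four: "(4::real) ^ k = x * x" by (simp add: x_def flip: power_mult_distrib)
  have p2: "Factorial_Ring.prime (2::nat)" and p3: "Factorial_Ring.prime (3::nat)" and p5: "Factorial_Ring.prime (5::nat)"
    by simp_all
  define A where "A = ((2::real) ^ a) ^ Suc k"
  define B where "B = ((3::real) ^ b) ^ Suc k"
  define C where "C = ((5::real) ^ c) ^ Suc k"
  \<comment> \<open>With the geometric sums as variables, every quantity is a polynomial and the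
    identities needed by \<open>prime_step\<close> follow by expansion.\<close>
  define Sa where "Sa = (\<Sum>j<a. (2 * x) ^ j)"
  define Sb where "Sb = (\<Sum>j<b. (3 * y) ^ j)"
  define Sc where "Sc = (\<Sum>j<c. (5 * z) ^ j)"
  have S0: "Sa \<ge> 0" "Sb \<ge> 0" "Sc \<ge> 0"
    using x1 y1 z1 by (auto simp: Sa_def Sb_def Sc_def intro!: sum_nonneg)
  have A: "A = 1 + (2 * x - 1) * Sa"
    using geometric_sum_closed(1)[of "2 * x" a]
    by (simp add: A_def Sa_def x_def flip: power_Suc) (simp flip: power_mult add: mult.commute)
  have B: "B = 1 + (3 * y - 1) * Sb"
    using geometric_sum_closed(1)[of "3 * y" b]
    by (simp add: B_def Sb_def y_def flip: power_Suc) (simp flip: power_mult add: mult.commute)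
  have C: "C = 1 + (5 * z - 1) * Sc"
    using geometric_sum_closed(1)[of "5 * z" c]
    by (simp add: C_def Sc_def z_def flip: power_Suc) (simp flip: power_mult add: mult.commute)
  have ca: "ca = 1 + x * Sa"
    using real_cyclic_psi_prime_power[OF p2, of k a] by (simp add: ca_def Sa_def x_def)
  have cb: "cb = 1 + 2 * y * Sb"
    using real_cyclic_psi_prime_power[OF p3, of k b] by (simp add: cb_def Sb_def y_def)
  have cc: "cc = 1 + 4 * z * Sc"
    using real_cyclic_psi_prime_power[OF p5, of k c] by (simp add: cc_def Sc_def z_def)
  define Ra where "Ra = real (cyclic_psi k (2 ^ Suc (Suc a)))"
  define Rb where "Rb = real (cyclic_psi k (3 ^ Suc b))"
  define Rc where "Rc = real (cyclic_psi k (5 ^ Suc c))"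
  have Ra: "Ra = 1 + x * (1 + 2 * x * (1 + 2 * x * Sa))"
    using real_cyclic_psi_prime_power[OF p2, of k "Suc (Suc a)"] geometric_sum_closed(2)[of "2 * x" "Suc a"]
      geometric_sum_closed(2)[of "2 * x" a]
    by (simp add: Ra_def Sa_def x_def del: sum.lessThan_Suc)
  have Rb: "Rb = 1 + 2 * y * (1 + 3 * y * Sb)"
    using real_cyclic_psi_prime_power[OF p3, of k "Suc b"] geometric_sum_closed(2)[of "3 * y" b]
    by (simp add: Rb_def Sb_def y_def del: sum.lessThan_Suc)
  have Rc: "Rc = 1 + 4 * z * (1 + 5 * z * Sc)"
    using real_cyclic_psi_prime_power[OF p5, of k "Suc c"] geometric_sum_closed(2)[of "5 * z" c]
    by (simp add: Rc_def Sc_def z_def del: sum.lessThan_Suc)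
  let ?Da = "1 + x + 2 * (x * x)" and ?Db = "1 + 2 * y" and ?Dc = "1 + 4 * z"
  have pos: "ca \<ge> 1" "cb \<ge> 1" "cc \<ge> 1" using ca cb cc S0 x1 y1 z1 by simp_all
  have "(2 * x - 1) * Sa \<ge> x * Sa" using x1 S0 by (intro mult_right_mono) auto
  then have Aca: "A \<ge> ca" using A ca by simp
  have "(3 * y - 1) * Sb \<ge> 2 * y * Sb" using y1 S0 by (intro mult_right_mono) auto
  then have Bcb: "B \<ge> cb" using B cb by simp
  \<comment> \<open>The contribution of cosets of order prime to 5, without its factor
    \<open>cc\<close>. \<open>U'\<close> and \<open>U''\<close> regroup what is left for the primes
    3 and 2.\<close>
  define U where "U = ca * cb + 15 * x * A * cb + 20 * y * B * ca"
  have 5: "?Dc * (cc * U + 24 * z * C * (ca * cb)) \<le> Rc * (U + 24 * z * (ca * cb))"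
  proof (rule prime_step)
    show "C * ?Dc - Rc = (z - 1) * Sc" by (simp add: C Rc algebra_simps)
    show "Rc - cc * ?Dc = 4 * z * (z - 1) * Sc" by (simp add: cc Rc algebra_simps)
    have "15 * x * (ca * cb) \<le> 15 * x * A * cb" using x1 Aca pos by (simp add: mult_right_mono mult_left_mono)
    moreover have "15 * (ca * cb) \<le> 15 * x * (ca * cb)" using x1 pos by simp
    moreover have "0 \<le> 20 * y * B * ca" using y1 Bcb pos by (intro mult_nonneg_nonneg) auto
    moreover have "0 \<le> ca * cb" using pos by simp
    ultimately have "6 * (ca * cb) \<le> U" unfolding U_def by linarith
    then have "(4 * z * (z - 1) * Sc) * (6 * (ca * cb)) \<le> (4 * z * (z - 1) * Sc) * U"
      using z1 S0 by (intro mult_left_mono) auto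
    then show "24 * z * ((z - 1) * Sc) * (ca * cb) \<le> 4 * z * (z - 1) * Sc * U" by (simp add: ac_simps)
  qed
  define U' where "U' = ca + 15 * x * A + 24 * z * ca"
  have 3: "?Db * (cb * U' + 20 * y * B * ca) \<le> Rb * (U' + 20 * y * ca)"
  proof (rule prime_step)
    show "B * ?Db - Rb = (y - 1) * Sb" by (simp add: B Rb algebra_simps)
    show "Rb - cb * ?Db = 2 * y * (y - 1) * Sb" by (simp add: cb Rb algebra_simps)
    have "24 * ca \<le> 24 * z * ca" using z1 pos by simp
    moreover have "0 \<le> 15 * x * A" using x1 Aca pos by simp
    ultimately have "10 * ca \<le> U'" unfolding U'_def using pos by linarith
    then have "(2 * y * (y - 1) * Sb) * (10 * ca) \<le> (2 * y * (y - 1) * Sb) * U'"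
      using y1 S0 by (intro mult_left_mono) auto
    then show "20 * y * ((y - 1) * Sb) * ca \<le> 2 * y * (y - 1) * Sb * U'" by (simp add: ac_simps)
  qed
  define U'' where "U'' = 1 + 20 * y + 24 * z"
  have 2: "?Da * (ca * U'' + 15 * x * A * 1) \<le> Ra * (U'' + 15 * x * 1)"
  proof (rule prime_step)
    show "A * ?Da - Ra = (x - 1) * Sa" by (simp add: A Ra algebra_simps)
    show "Ra - ca * ?Da = x * (2 * x + 1) * (x - 1) * Sa" by (simp add: ca Ra algebra_simps)
    have "1 * 15 \<le> (2 * x + 1) * U''" unfolding U''_def using x1 y1 z1 by (intro mult_mono) auto
    then have "(x * (x - 1) * Sa) * 15 \<le> (x * (x - 1) * Sa) * ((2 * x + 1) * U'')"
      using x1 S0 by (intro mult_left_mono) auto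
    then show "15 * x * ((x - 1) * Sa) * 1 \<le> x * (2 * x + 1) * (x - 1) * Sa * U''" by (simp add: ac_simps)
  qed
  have Dpos: "?Da \<ge> 0" "?Db \<ge> 0" using x1 y1 by simp_all
  have Rpos: "Rb \<ge> 0" "Rc \<ge> 0" by (simp_all add: Rb_def Rc_def)
  have "(?Da * ?Db * ?Dc) * (ca * cb * cc + 15 * x * A * (cb * cc) + 20 * y * B * (ca * cc) + 24 * z * C * (ca * cb))
      = ?Da * (?Db * (?Dc * (cc * U + 24 * z * C * (ca * cb))))"
    by (simp add: U_def algebra_simps)
  also have "\<dots> \<le> ?Da * (?Db * (Rc * (U + 24 * z * (ca * cb))))"
    using 5 Dpos by (intro mult_left_mono) auto
  also have "\<dots> = Rc * (?Da * (?Db * (cb * U' + 20 * y * B * ca)))"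
    by (simp add: U_def U'_def algebra_simps)
  also have "\<dots> \<le> Rc * (?Da * (Rb * (U' + 20 * y * ca)))"
    using 3 Dpos Rpos by (intro mult_left_mono) auto
  also have "\<dots> = Rc * (Rb * (?Da * (ca * U'' + 15 * x * A * 1)))"
    by (simp add: U'_def U''_def algebra_simps)
  also have "\<dots> \<le> Rc * (Rb * (Ra * (U'' + 15 * x * 1)))"
    using 2 Rpos by (intro mult_left_mono) auto
  also have "\<dots> = (1 + 15 * x + 20 * y + 24 * z) * (Ra * Rb * Rc)"
    by (simp add: U''_def algebra_simps)
  finally show ?thesis by (simp add: four A_def B_def C_def Ra_def Rb_def Rc_def)
qed

text \<open>A coset of prime order is estimated with q the full part of \<open>ord z\<close> at that
  prime. The part r of \<open>ord z\<close> prime to 30 contributes the same factor to both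
  sides.\<close>

lemma (in group) psi_le_of_order_60_quotient:
  assumes fin: "finite (carrier G)" and z: "z \<in> carrier G" and K: "generate G {z} \<lhd> G"
    and o: "order G = 60 * ord z"
    and le: "\<And>C. C \<in> carrier (G Mod generate G {z}) \<Longrightarrow> group.ord (G Mod generate G {z}) C \<le> 5"
  shows "((1 + 2 ^ k + 2 * 4 ^ k) * (1 + 2 * 3 ^ k) * (1 + 4 * 5 ^ k)) * real (psi k G)
    \<le> (1 + 15 * 2 ^ k + 20 * 3 ^ k + 24 * 5 ^ k) * real (cyclic_psi k (order G))"
proof -
  let ?Q = "G Mod generate G {z}"
  interpret K: normal "generate G {z}" G by fact
  interpret Q: group ?Q by (rule K.factorgroup_is_group)
  have finQ: "finite (carrier ?Q)" using fin by (simp add: carrier_FactGroup)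
  have oz: "ord z > 0" using ord_ge_1[OF fin z] by simp
  have "order ?Q * ord z = 60 * ord z"
    using lagrange[OF K.subgroup_axioms] o generate_pow_card[OF z] by (simp add: order_def FactGroup_def)
  then have oQ: "order ?Q = 60" using oz by simp
  note cnt = Q.order_60_counts[OF oQ le]
  obtain a n1 where n1: "ord z = 2 ^ a * n1" "\<not> 2 dvd n1" "n1 > 0"
    using ex_prime_power_decomposition[of 2, OF _ oz] by auto
  obtain b n2 where n2: "n1 = 3 ^ b * n2" "\<not> 3 dvd n2" "n2 > 0"
    using ex_prime_power_decomposition[of 3, OF _ n1(3)] by auto
  obtain c r where n3: "n2 = 5 ^ c * r" "\<not> 5 dvd r" and rpos: "r > 0"
    using ex_prime_power_decomposition[of 5, OF _ n2(3)] by auto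
  have nd: "\<not> 2 dvd n2" "\<not> 2 dvd r" "\<not> 3 dvd r"
    using n1(2) n2 n3 by auto
  have cp: "coprime (2::nat) 3" "coprime (2::nat) 5" "coprime (3::nat) 5"
    "coprime (2::nat) r" "coprime (3::nat) r" "coprime (5::nat) r"
    using nd n3(2) by (auto intro!: prime_imp_coprime)
  let ?c = "cyclic_psi k"
  have mult3: "?c (3 ^ i * (5 ^ j * r)) = ?c (3 ^ i) * (?c (5 ^ j) * ?c r)" for i j
    using cp rpos by (simp add: cyclic_psi_mult_coprime)
  have mult2: "?c (2 ^ h * (3 ^ i * (5 ^ j * r))) = ?c (2 ^ h) * (?c (3 ^ i) * (?c (5 ^ j) * ?c r))" for h i j
    using cp rpos mult3 by (simp add: cyclic_psi_mult_coprime)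
  have W: "(\<Sum>g\<in>C. ord g ^ k) \<le> Q.ord C ^ k * q ^ Suc k * ?c s"
    if "C \<in> carrier ?Q" "ord z = q * s" "coprime (Q.ord C) s" for C q s
    using sum_ord_coset_le[OF fin z K that(2,1) refl that(3)] .
  define w where "w j = (if j = 1 then ?c (2 ^ a) * ?c (3 ^ b) * ?c (5 ^ c) * ?c r
    else if j = 2 then 2 ^ k * (2 ^ a) ^ Suc k * (?c (3 ^ b) * ?c (5 ^ c) * ?c r)
    else if j = 3 then 3 ^ k * (3 ^ b) ^ Suc k * (?c (2 ^ a) * ?c (5 ^ c) * ?c r)
    else 5 ^ k * (5 ^ c) ^ Suc k * (?c (2 ^ a) * ?c (3 ^ b) * ?c r))" for j :: nat
  have img: "Q.ord ` carrier ?Q \<subseteq> {1, 2, 3, 5}"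
  proof
    fix j assume "j \<in> Q.ord ` carrier ?Q"
    then obtain C where C: "C \<in> carrier ?Q" "j = Q.ord C" by blast
    have "1 \<le> j" "j \<le> 5" using Q.ord_ge_1[OF finQ C(1)] le[OF C(1)] C(2) by auto
    moreover have "j \<noteq> 4" using cnt(3) C by auto
    ultimately show "j \<in> {1, 2, 3, 5}" by auto
  qed
  have bound: "(\<Sum>g\<in>C. ord g ^ k) \<le> w (Q.ord C)" if C: "C \<in> carrier ?Q" for C
  proof -
    have "Q.ord C \<in> {1, 2, 3, 5}" using img C by blast
    then consider "Q.ord C = 1" | "Q.ord C = 2" | "Q.ord C = 3" | "Q.ord C = 5" by blast
    then show ?thesis
    proof cases
      case 1
      then show ?thesis using W[OF C, of 1 "ord z"] n1 n2 n3 mult2 by (simp add: w_def ac_simps)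
    next
      case 2
      then show ?thesis using W[OF C, of "2 ^ a" n1] n1 n2 n3 mult3 cp by (simp add: w_def ac_simps)
    next
      case 3
      \<comment> \<open>The empty power of 3 brings the cofactor into the shape of
        \<open>mult2\<close>; the case of order 5 does the same.\<close>
      have "ord z = 3 ^ b * (2 ^ a * (3 ^ 0 * (5 ^ c * r)))" using n1 n2 n3 by (simp add: ac_simps)
      moreover have "coprime (Q.ord C) (2 ^ a * (3 ^ 0 * (5 ^ c * r)))"
        using 3 cp by (simp add: coprime_commute)
      ultimately show ?thesis using W[OF C, of "3 ^ b" "2 ^ a * (3 ^ 0 * (5 ^ c * r))"] mult2[of a 0 c] 3
        by (simp add: w_def ac_simps)
    next
      case 4
      have "ord z = 5 ^ c * (2 ^ a * (3 ^ b * (5 ^ 0 * r)))" using n1 n2 n3 by (simp add: ac_simps)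
      moreover have "coprime (Q.ord C) (2 ^ a * (3 ^ b * (5 ^ 0 * r)))"
        using 4 cp by (simp add: coprime_commute)
      ultimately show ?thesis using W[OF C, of "5 ^ c" "2 ^ a * (3 ^ b * (5 ^ 0 * r))"] mult2[of a b 0] 4
        by (simp add: w_def ac_simps)
    qed
  qed
  have S1: "{C \<in> carrier ?Q. Q.ord C = 1} = {\<one>\<^bsub>?Q\<^esub>}" using Q.ord_eq_1 Q.one_closed Q.ord_id by (auto simp del: one_FactGroup)
  have "psi k G \<le> (\<Sum>C\<in>carrier ?Q. w (Q.ord C))"
    unfolding psi_eq_sum_cosets[OF fin K] by (intro sum_mono bound)
  also have "\<dots> = (\<Sum>j\<in>{1, 2, 3, 5}. \<Sum>C\<in>{C \<in> carrier ?Q. Q.ord C = j}. w (Q.ord C))"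
    by (rule sum.group[symmetric]) (use finQ img in auto)
  also have "\<dots> = (\<Sum>j\<in>{1, 2, 3, 5}. card {C \<in> carrier ?Q. Q.ord C = j} * w j)"
    by (intro sum.cong) auto
  also have "\<dots> = w 1 + 15 * w 2 + 20 * w 3 + 24 * w 5"
    using cnt S1 by simp
  finally have "real (psi k G) \<le> real (w 1 + 15 * w 2 + 20 * w 3 + 24 * w 5)" by simp
  also have "\<dots> = (real (?c (2 ^ a)) * real (?c (3 ^ b)) * real (?c (5 ^ c)) + 15 * 2 ^ k * (2 ^ a) ^ Suc k * (real (?c (3 ^ b)) * real (?c (5 ^ c)))
      + 20 * 3 ^ k * (3 ^ b) ^ Suc k * (real (?c (2 ^ a)) * real (?c (5 ^ c))) + 24 * 5 ^ k * (5 ^ c) ^ Suc k * (real (?c (2 ^ a)) * real (?c (3 ^ b)))) * real (?c r)"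
    by (simp add: w_def algebra_simps)
  finally have psi: "real (psi k G) \<le> \<dots>" .
  have oG: "order G = 2 ^ Suc (Suc a) * (3 ^ Suc b * (5 ^ Suc c * r))" using o n1 n2 n3 by simp
  have cG: "real (?c (order G)) = real (?c (2 ^ Suc (Suc a))) * real (?c (3 ^ Suc b)) * real (?c (5 ^ Suc c)) * real (?c r)"
    unfolding oG mult2 by simp
  have "((1 + 2 ^ k + 2 * 4 ^ k) * (1 + 2 * 3 ^ k) * (1 + 4 * 5 ^ k)) * real (psi k G)
      \<le> ((1 + 2 ^ k + 2 * 4 ^ k) * (1 + 2 * 3 ^ k) * (1 + 4 * 5 ^ k)) * ((real (?c (2 ^ a)) * real (?c (3 ^ b)) * real (?c (5 ^ c)) + 15 * 2 ^ k * (2 ^ a) ^ Suc k * (real (?c (3 ^ b)) * real (?c (5 ^ c)))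
      + 20 * 3 ^ k * (3 ^ b) ^ Suc k * (real (?c (2 ^ a)) * real (?c (5 ^ c))) + 24 * 5 ^ k * (5 ^ c) ^ Suc k * (real (?c (2 ^ a)) * real (?c (3 ^ b)))) * real (?c r))"
    by (rule mult_left_mono[OF psi]) simp
  also have "\<dots> \<le> (1 + 15 * 2 ^ k + 20 * 3 ^ k + 24 * 5 ^ k) *
      (real (?c (2 ^ Suc (Suc a))) * real (?c (3 ^ Suc b)) * real (?c (5 ^ Suc c))) * real (?c r)"
    using mult_right_mono[OF exceptional_estimate[of k a b c], of "real (?c r)"] by (simp only: mult.assoc)
  finally show ?thesis unfolding cG by (simp only: mult.assoc)
qed

section \<open>Numerical estimates\<close>

text \<open>Besides the identity, A_5 has 15, 20 and 24 elements of orders 2, 3 and 5.\<close>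

definition psi_A5 :: "nat \<Rightarrow> real"
  where "psi_A5 k = 1 + 15 * 2 ^ k + 20 * 3 ^ k + 24 * 5 ^ k"

text \<open>By multiplicativity, the power sums of Z_4, Z_3 and Z_5.\<close>

definition psi_Z60 :: "nat \<Rightarrow> real"
  where "psi_Z60 k = (1 + 2 ^ k + 2 * 4 ^ k) * (1 + 2 * 3 ^ k) * (1 + 4 * 5 ^ k)"

lemma psi_A5_pos: "psi_A5 k > 0" and psi_Z60_pos: "psi_Z60 k > 0"
  by (auto simp: psi_A5_def psi_Z60_def add_pos_pos)

text \<open>The terms in 60^k agree, with coefficient 48 on each side. All remaining terms on the
  left are absorbed by the term 40 * 36^k on the right, which comes from the elements of order
  3.\<close>

lemma psi_Z60_le:
  assumes "k \<ge> 4" shows "3 * psi_Z60 k \<le> 2 * 12 ^ k * psi_A5 k"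
proof -
  define x where "x = (2::real) ^ k"
  define y where "y = (3::real) ^ k"
  define z where "z = (5::real) ^ k"
  have x: "x \<ge> 16" using power_increasing[of 4 k "2::real"] assms by (simp add: x_def)
  have y: "y \<ge> 81" using power_increasing[of 4 k "3::real"] assms by (simp add: y_def)
  have z: "z \<ge> 1" by (simp add: z_def)
  have zxy: "1296 * z \<le> 625 * (x * y)"
  proof -
    have "(5 / 6 :: real) ^ k \<le> (5 / 6) ^ 4" using assms by (intro power_decreasing) auto
    then have "(5 / 6 :: real) ^ k \<le> 625 / 1296" by (simp add: power4_eq_xxxx)
    moreover have "(5 / 6 :: real) ^ k * (x * y) = z"
      by (simp add: x_def y_def z_def flip: power_mult_distrib)
    moreover have "x * y > 0" using x y by simp
    ultimately show ?thesis using mult_right_mono[of "(5 / 6) ^ k" "625 / 1296" "x * y"] by simp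
  qed
  have zyy: "z \<le> y * y / 9"
  proof -
    have "(5 / 9 :: real) ^ k \<le> (5 / 9) ^ 4" using assms by (intro power_decreasing) auto
    then have "(5 / 9 :: real) ^ k \<le> 1 / 9" by (simp add: power4_eq_xxxx)
    moreover have "(5 / 9 :: real) ^ k * (y * y) = z"
      by (simp add: y_def z_def flip: power_mult_distrib)
    moreover have "y * y > 0" using y by simp
    ultimately show ?thesis using mult_right_mono[of "(5 / 9) ^ k" "1 / 9" "y * y"] by simp
  qed
  have four: "(4::real) ^ k = x * x" and twelve: "(12::real) ^ k = x * x * y"
    by (simp_all add: x_def y_def flip: power_mult_distrib)
  have main: "24 * (1 + x) * y * z + 3 * (1 + x + 2 * (x * x)) * (1 + 4 * z + 2 * y) \<le> 40 * (x * y) * (x * y)"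
  proof -
    have a: "24 * (1 + x) * y * z \<le> 13 * (x * y) * (x * y)"
    proof -
      have "24 * (1 + x) * y * z \<le> 24 * (17 / 16 * x) * y * z"
        using x y z by (intro mult_right_mono) auto
      also have "\<dots> = 24 * 17 / 16 / 1296 * (x * y) * (1296 * z)" by simp
      also have "\<dots> \<le> 24 * 17 / 16 / 1296 * (x * y) * (625 * (x * y))"
        using x y zxy by (intro mult_left_mono) auto
      also have "\<dots> \<le> 13 * (x * y) * (x * y)" using x y by (simp add: field_simps)
      finally show ?thesis .
    qed
    have "1 + x + 2 * (x * x) \<le> 3 * (x * x)"
      using mult_right_mono[of 16 x x] x by linarith
    moreover have "1 + 4 * z + 2 * y \<le> y * y"
    proof -
      have "81 * y \<le> y * y" using y by (intro mult_right_mono) auto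
      then show ?thesis using zyy y by linarith
    qed
    ultimately have "(1 + x + 2 * (x * x)) * (1 + 4 * z + 2 * y) \<le> (3 * (x * x)) * (y * y)"
      using x y z by (intro mult_mono) auto
    moreover have "9 * (x * y) * (x * y) = 3 * ((3 * (x * x)) * (y * y))" by simp
    ultimately have "3 * (1 + x + 2 * (x * x)) * (1 + 4 * z + 2 * y) \<le> 9 * (x * y) * (x * y)"
      by (simp only: mult.assoc)
    moreover have "40 * (x * y) * (x * y) = 13 * (x * y) * (x * y) + 9 * (x * y) * (x * y) + 18 * ((x * y) * (x * y))"
      by simp
    moreover have "0 \<le> (x * y) * (x * y)" by simp
    ultimately show ?thesis using a by linarith
  qed
  have "3 * psi_Z60 k = 48 * (x * x * y * z) + (24 * (1 + x) * y * z + 3 * (1 + x + 2 * (x * x)) * (1 + 4 * z + 2 * y))"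
    by (simp add: psi_Z60_def four x_def[symmetric] y_def[symmetric] z_def[symmetric] algebra_simps)
  also have "\<dots> \<le> 48 * (x * x * y * z) + 40 * (x * y) * (x * y)" using main by simp
  also have "\<dots> \<le> 2 * (x * x * y) * (1 + 15 * x + 20 * y + 24 * z)"
    using x y by (simp add: algebra_simps)
  also have "\<dots> = 2 * 12 ^ k * psi_A5 k"
    by (simp add: psi_A5_def twelve x_def[symmetric] y_def[symmetric] z_def[symmetric])
  finally show ?thesis .
qed

section \<open>Products over primes and the resulting bounds\<close>

lemma prod_subset_ge:
  fixes f :: "'a \<Rightarrow> real"
  assumes "finite B" "A \<subseteq> B" "\<And>q. q \<in> B \<Longrightarrow> 0 \<le> f q \<and> f q \<le> 1"
  shows "prod f B \<le> prod f A"
proof -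
  have "prod f B = prod f (B - A) * prod f A" by (rule prod.subset_diff[OF assms(2,1)])
  also have "\<dots> \<le> 1 * prod f A"
    using assms by (intro mult_right_mono prod_le_1 prod_nonneg) auto
  finally show ?thesis by simp
qed

lemma prime_cases_le_17:
  fixes q :: nat
  assumes "Factorial_Ring.prime q" "q \<le> 17"
  shows "q \<in> {2, 3, 5, 7, 11, 13, 17}"
proof -
  have "q = 0 \<or> q = 1 \<or> q = 2 \<or> q = 3 \<or> q = 4 \<or> q = 5 \<or> q = 6 \<or> q = 7 \<or> q = 8 \<or> q = 9 \<or> q = 10
    \<or> q = 11 \<or> q = 12 \<or> q = 13 \<or> q = 14 \<or> q = 15 \<or> q = 16 \<or> q = 17"
    using assms(2) by presburger
  then show ?thesis using assms(1) by (elim disjE) simp_all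
qed

text \<open>At 17 this is an equality. Beyond 17 every integer is treated as if it were prime, so
  the factors P / (P + 1) telescope.\<close>

lemma prod_primes_ge:
  assumes "P \<ge> 17"
  shows "(\<Prod>q\<in>{q. Factorial_Ring.prime q \<and> q \<le> P}. 1 - 1 / real q) \<ge> 3072 / (1001 * real P)"
  using assms
proof (induction P rule: dec_induct)
  case base
  have "{q. Factorial_Ring.prime q \<and> q \<le> (17::nat)} = {2, 3, 5, 7, 11, 13, 17}"
    using prime_cases_le_17 by auto
  then show ?case by simp
next
  case (step P)
  let ?S = "\<lambda>P. {q. Factorial_Ring.prime q \<and> q \<le> (P::nat)}" and ?f = "\<lambda>q::nat. 1 - 1 / real q"
  have fin: "finite (?S P)" by (rule finite_subset[of _ "{..P}"]) auto
  have sub: "?S (Suc P) \<subseteq> insert (Suc P) (?S P)" by (auto simp: le_Suc_eq)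
  have "real P > 0" using step(1) by simp
  moreover have "?f (Suc P) = real P / real (Suc P)" by (simp add: field_simps)
  ultimately have "3072 / (1001 * real (Suc P)) = ?f (Suc P) * (3072 / (1001 * real P))"
    by (simp only: times_divide_times_eq) simp
  also have "\<dots> \<le> ?f (Suc P) * prod ?f (?S P)"
    using step by (intro mult_left_mono) auto
  also have "\<dots> = prod ?f (insert (Suc P) (?S P))" using fin by simp
  also have "\<dots> \<le> prod ?f (?S (Suc P))"
    by (rule prod_subset_ge[OF _ sub]) (use fin in \<open>auto dest: prime_ge_1_nat\<close>)
  finally show ?case .
qed

lemma one_minus_inverse_weight:
  assumes "q \<ge> 1"
  shows "(1 - 1 / real q) * (real q ^ Suc k - 1) \<le> (real q - 1) * q ^ k"
proof -
  have "(1 - 1 / real q) * (real q ^ Suc k - 1) = (real q - 1) * q ^ k - (1 - 1 / real q)"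
    using assms by (simp add: field_simps)
  then show ?thesis using assms by simp
qed

lemma cyclic_psi_ge_large:
  assumes "n > 0" "P \<ge> 17" "\<And>q. q \<in> prime_factors n \<Longrightarrow> q \<le> P"
  shows "3072 * real n ^ Suc k \<le> 1001 * real P * cyclic_psi k n"
proof -
  let ?f = "\<lambda>q::nat. 1 - 1 / real q"
  have "real n ^ Suc k * (3072 / (1001 * real P)) \<le> real n ^ Suc k * (\<Prod>q\<in>prime_factors n. ?f q)"
  proof (intro mult_left_mono)
    have "(\<Prod>q\<in>{q. Factorial_Ring.prime q \<and> q \<le> P}. ?f q) \<le> (\<Prod>q\<in>prime_factors n. ?f q)"
    proof (rule prod_subset_ge)
      show "finite {q. Factorial_Ring.prime q \<and> q \<le> P}" by (rule finite_subset[of _ "{..P}"]) auto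
      show "prime_factors n \<subseteq> {q. Factorial_Ring.prime q \<and> q \<le> P}" using assms(3) by auto
    qed (auto dest: prime_ge_1_nat)
    then show "3072 / (1001 * real P) \<le> (\<Prod>q\<in>prime_factors n. ?f q)"
      using prod_primes_ge[OF assms(2)] by linarith
  qed simp
  also have "\<dots> \<le> cyclic_psi k n"
  proof (rule cyclic_psi_ge_prod[OF assms(1)])
    fix q assume "q \<in> prime_factors n"
    then have "q \<ge> 1" using prime_ge_1_nat by blast
    then show "0 \<le> ?f q \<and> ?f q * (real q ^ Suc k - 1) \<le> (real q - 1) * q ^ k"
      using one_minus_inverse_weight by simp
  qed
  finally show ?thesis using assms(2) by (simp add: field_simps)
qed

text \<open>With weights 1 - 1/q the product is 192/1001, and the claim reduces to (4/3)^k being at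
  least 2002/576, true from k = 5. At k = 4 the weight 1/2 at the prime 2 is too weak even with
  exact constants; the exact local factor 16/31 turns the product into 6144/31031, which
  suffices.\<close>

lemma cyclic_psi_ge_small:
  assumes k: "k \<ge> 4" and n: "n > 0" and P: "\<And>q. q \<in> prime_factors n \<Longrightarrow> q \<le> 13"
  shows "psi_Z60 k * real n ^ Suc k \<le> 16 ^ k * psi_A5 k * cyclic_psi k n"
proof -
  let ?S = "{2, 3, 5, 7, 11, 13} :: nat set"
  have sub: "prime_factors n \<subseteq> ?S"
  proof
    fix q assume q: "q \<in> prime_factors n"
    then have "Factorial_Ring.prime q" by blast
    then show "q \<in> ?S" using prime_cases_le_17[of q] P[OF q] by auto
  qed
  have bound: "real n ^ Suc k * prod w ?S \<le> cyclic_psi k n"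
    if w: "\<And>q. q \<in> ?S \<Longrightarrow> 0 \<le> w q \<and> w q \<le> 1 \<and> w q * (real q ^ Suc k - 1) \<le> (real q - 1) * q ^ k" for w
  proof -
    have "real n ^ Suc k * prod w ?S \<le> real n ^ Suc k * prod w (prime_factors n)"
      by (intro mult_left_mono prod_subset_ge) (use sub w in auto)
    also have "\<dots> \<le> cyclic_psi k n"
      by (rule cyclic_psi_ge_prod[OF n]) (use sub w in blast)
    finally show ?thesis .
  qed
  show ?thesis
  proof (cases "k = 4")
    case True
    define w where "w q = (if q = 2 then 16 / 31 else 1 - 1 / real q)" for q :: nat
    have "real n ^ Suc k * prod w ?S \<le> cyclic_psi k n"
      by (rule bound) (use True in \<open>auto simp: w_def\<close>)
    then have "6144 * real n ^ Suc k \<le> 31031 * real (cyclic_psi k n)" by (simp add: w_def)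
    then have 1: "(16 ^ k * psi_A5 k) * (6144 * real n ^ Suc k) \<le> (16 ^ k * psi_A5 k) * (31031 * real (cyclic_psi k n))"
      using psi_A5_pos[of k] by (intro mult_left_mono) auto
    have "31031 * psi_Z60 k \<le> 16 ^ k * psi_A5 k * 6144"
      using True by (simp add: psi_A5_def psi_Z60_def)
    then have "31031 * psi_Z60 k * real n ^ Suc k \<le> 16 ^ k * psi_A5 k * 6144 * real n ^ Suc k"
      by (rule mult_right_mono) simp
    then have "31031 * (psi_Z60 k * real n ^ Suc k) \<le> (16 ^ k * psi_A5 k) * (6144 * real n ^ Suc k)"
      by (simp only: mult.assoc)
    also have "\<dots> \<le> 31031 * (16 ^ k * psi_A5 k * cyclic_psi k n)"
      using 1 by (simp only: ac_simps)
    finally show ?thesis by simp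
  next
    case False
    then have k5: "k \<ge> 5" using k by simp
    define w where "w q = 1 - 1 / real q" for q :: nat
    have "real n ^ Suc k * prod w ?S \<le> cyclic_psi k n"
      by (rule bound) (use one_minus_inverse_weight in \<open>auto simp: w_def\<close>)
    then have c: "192 * real n ^ Suc k \<le> 1001 * real (cyclic_psi k n)" by (simp add: w_def)
    have "(4 / 3 :: real) ^ 5 \<le> (4 / 3) ^ k" using k5 by (intro power_increasing) auto
    then have "2002 / 576 \<le> (4 / 3 :: real) ^ k" by (simp add: power_numeral_reduce)
    then have "2002 / 576 * (12 :: real) ^ k \<le> (4 / 3) ^ k * 12 ^ k" by (rule mult_right_mono) simp
    then have "2002 * (12 :: real) ^ k \<le> 576 * 16 ^ k" by (simp flip: power_mult_distrib)
    then have "(2002 * 12 ^ k) * psi_A5 k \<le> (576 * 16 ^ k) * psi_A5 k"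
      using psi_A5_pos[of k] by (intro mult_right_mono) auto
    then have "1001 * psi_Z60 k \<le> 192 * (16 ^ k * psi_A5 k)"
      using psi_Z60_le[OF k] unfolding mult.assoc by linarith
    then have "1001 * psi_Z60 k * real n ^ Suc k \<le> 192 * (16 ^ k * psi_A5 k) * real n ^ Suc k"
      by (rule mult_right_mono) simp
    also have "\<dots> \<le> (16 ^ k * psi_A5 k) * (1001 * real (cyclic_psi k n))"
      using mult_left_mono[OF c, of "16 ^ k * psi_A5 k"] psi_A5_pos[of k] by (simp add: ac_simps)
    finally show ?thesis by simp
  qed
qed

text \<open>The linear loss in P from the product over primes is outweighed by (P/12)^k. The
  tightest case is k = 4 and P = 17, where 2002 * 12^4 is below 9216 * 17^3.\<close>

lemma cyclic_psi_ge_prime_power: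
  assumes k: "k \<ge> 4" and n: "n > 0" and P: "P \<ge> 17" "\<And>q. q \<in> prime_factors n \<Longrightarrow> q \<le> P"
  shows "psi_Z60 k * real n ^ Suc k \<le> real P ^ k * psi_A5 k * cyclic_psi k n"
proof -
  have "2002 * real P * 12 ^ k \<le> 9216 * real P ^ k"
  proof -
    have "(real P / 12) ^ 4 \<le> (real P / 12) ^ k" using k P(1) by (intro power_increasing) auto
    moreover have "17 ^ 3 \<le> real P ^ 3" using P(1) by (intro power_mono) auto
    then have "2002 * 12 ^ 4 \<le> 9216 * real P ^ 3" by simp
    then have "2002 * 12 ^ 4 * real P \<le> 9216 * real P ^ 3 * real P" by (rule mult_right_mono) simp
    then have "2002 * real P \<le> 9216 * (real P / 12) ^ 4"
      by (simp add: power_divide power_numeral_reduce field_simps)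
    ultimately have "2002 * real P \<le> 9216 * (real P / 12) ^ k" by linarith
    then have "2002 * real P * 12 ^ k \<le> 9216 * (real P / 12) ^ k * 12 ^ k" by (rule mult_right_mono) simp
    then show ?thesis by (simp add: power_divide)
  qed
  then have "2002 * real P * 12 ^ k * psi_A5 k \<le> 9216 * real P ^ k * psi_A5 k"
    using psi_A5_pos[of k] by (intro mult_right_mono) auto
  moreover have "1001 * real P * (3 * psi_Z60 k) \<le> 1001 * real P * (2 * 12 ^ k * psi_A5 k)"
    by (intro mult_left_mono psi_Z60_le[OF k]) simp
  ultimately have "1001 * real P * psi_Z60 k \<le> 3072 * (real P ^ k * psi_A5 k)" by (simp add: ac_simps)
  then have "1001 * real P * psi_Z60 k * real n ^ Suc k \<le> 3072 * (real P ^ k * psi_A5 k) * real n ^ Suc k"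
    by (rule mult_right_mono) simp
  also have "\<dots> \<le> (real P ^ k * psi_A5 k) * (1001 * real P * cyclic_psi k n)"
    using mult_left_mono[OF cyclic_psi_ge_large[OF n P], of "real P ^ k * psi_A5 k" k] psi_A5_pos[of k]
    by (simp add: ac_simps)
  finally have "1001 * real P * (psi_Z60 k * real n ^ Suc k) \<le> 1001 * real P * (real P ^ k * psi_A5 k * cyclic_psi k n)"
    by (simp add: ac_simps)
  then show ?thesis using P(1) by simp
qed

section \<open>The criterion\<close>

text \<open>Only the exceptional outcome survives nonsolvability. The quotient of order 60 is then
  nonsolvable as well, because the kernel is cyclic.\<close>

lemma (in group) psi_le_of_small_index:
  assumes fin: "finite (carrier G)" and ns: "\<not> solvable G" and x: "x \<in> carrier G"
    and i: "order G = i * ord x" "i \<le> 15"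
  shows "psi_Z60 k * psi k G \<le> psi_A5 k * cyclic_psi k (order G)"
proof -
  have "solvable G \<or> i = 12 \<and> (\<exists>z\<in>carrier G. generate G {z} \<lhd> G \<and> order G = 60 * ord z)"
    by (rule solvable_of_cyclic_index[OF fin x i]) (use i(2) solvable_index_le_15 in auto)
  then obtain z where z: "z \<in> carrier G" "generate G {z} \<lhd> G" "order G = 60 * ord z"
    using ns by blast
  let ?Q = "G Mod generate G {z}"
  interpret K: normal "generate G {z}" G by (rule z(2))
  interpret Q: group ?Q by (rule K.factorgroup_is_group)
  interpret KG: group "G\<lparr>carrier := generate G {z}\<rparr>" using subgroup_imp_group[OF K.subgroup_axioms] .
  have finQ: "finite (carrier ?Q)" using fin by (simp add: carrier_FactGroup)
  have zK: "z \<in> generate G {z}" by (simp add: generate.incl)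
  have "solvable (G\<lparr>carrier := generate G {z}\<rparr>)"
    by (rule KG.cyclic_imp_solvable[of z])
      (use zK ord_subgroup[OF K.subgroup_axioms zK] generate_pow_card[OF z(1)] finite_subset[OF K.subset fin]
        in \<open>auto simp: order_def\<close>)
  then have nsQ: "\<not> solvable ?Q" using solvable_of_normal[OF z(2)] ns by blast
  have "order ?Q * ord z = 60 * ord z"
    using lagrange[OF K.subgroup_axioms] z(3) generate_pow_card[OF z(1)] by (simp add: order_def FactGroup_def)
  then have oQ: "order ?Q = 60" using ord_ge_1[OF fin z(1)] by simp
  have "Q.ord C \<le> 5" if C: "C \<in> carrier ?Q" for C
  proof (rule ccontr)
    assume gt: "\<not> Q.ord C \<le> 5"
    define j where "j = 60 div Q.ord C"
    have j: "60 = j * Q.ord C" using Q.ord_dvd_group_order[OF C] oQ by (simp add: j_def)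
    \<comment> \<open>An element of order at least 6 has index at most 10 in a group of order 60,
      below the exceptional index.\<close>
    have "j < 12"
    proof (rule ccontr)
      assume "\<not> j < 12"
      then have "12 * 6 \<le> j * Q.ord C" using gt by (intro mult_le_mono) auto
      then show False using j by simp
    qed
    then have "solvable ?Q" using Q.solvable_indexD[OF solvable_index_le_15 finQ C, of j] oQ j by simp
    then show False using nsQ by simp
  qed
  from psi_le_of_order_60_quotient[OF fin z this, of k] show ?thesis
    by (simp only: psi_A5_def psi_Z60_def)
qed

text \<open>As i < p, the full p-part of the order divides \<open>ord x\<close>. The corresponding
  subgroup of \<open>generate G {x}\<close> is conjugated into \<open>generate G {x}\<close> by
  every g, and back to itself by uniqueness of subgroups of a given order.\<close>

lemma (in group) normal_cyclic_sylow:
  assumes fin: "finite (carrier G)" and x: "x \<in> carrier G" and i: "order G = i * ord x" "i < p"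
    and p: "Factorial_Ring.prime p" "p dvd order G"
  obtains y where "y \<in> carrier G" "generate G {y} \<lhd> G" "ord y > 1"
    "coprime (ord y) (order (G Mod generate G {y}))"
proof -
  have pos: "order G > 0" using fin order_gt_0_iff_finite by simp
  obtain a m where am: "order G = p ^ a * m" "\<not> p dvd m" "m > 0"
    using ex_prime_power_decomposition[OF p(1) pos] by blast
  have a0: "a > 0" using am p(2) by (cases a) auto
  have ipos: "i > 0" using i(1) pos by (cases i) auto
  have copi: "coprime (p ^ a) j" if "0 < j" "j < p" for j
    using that p(1) by (simp add: prime_imp_coprime nat_dvd_not_less)
  have "p ^ a dvd i * ord x" using i(1) am(1) by (metis dvd_triv_left)
  then have dv: "p ^ a dvd ord x" using copi[OF ipos i(2)] by (simp add: coprime_dvd_mult_right_iff)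
  have ox: "ord x > 0" using ord_ge_1[OF fin x] by simp
  define y where "y = x [^] (ord x div p ^ a)"
  have yG: "y \<in> carrier G" using x by (simp add: y_def)
  have pa: "p ^ a > 1" using one_less_power[of p a] a0 prime_gt_1_nat[OF p(1)] by simp
  have oy: "ord y = p ^ a"
  proof -
    obtain s where s: "ord x = p ^ a * s" using dv by (rule dvdE)
    then have "ord x div p ^ a = s" "s > 0" using pa ox by auto
    then show ?thesis using ord_pow[OF x, of s] s by (simp add: y_def)
  qed
  let ?A = "generate G {x}"
  interpret A: subgroup ?A G using subgroup_generate_single[OF x] .
  have yA: "y \<in> ?A" using mem_generate_iff[OF fin x] by (auto simp: y_def)
  have cA: "card ?A = ord x" using generate_pow_card[OF x] by simp
  have cR: "card (rcosets ?A) = i" using lagrange[OF A.subgroup_axioms] i(1) cA ox by simp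
  have conjA: "g \<otimes> y \<otimes> inv g \<in> ?A" if g: "g \<in> carrier G" for g
  proof -
    \<comment> \<open>Two of the i + 1 cosets coincide, so \<open>?A\<close> contains the conjugate
      of a power of y whose exponent is positive and below p. That exponent is invertible modulo
      \<open>ord y\<close>, so y itself is conjugated into \<open>?A\<close>.\<close>
    let ?f = "\<lambda>j::nat. ?A #> (g \<otimes> y [^] j)"
    have "?f ` {..i} \<subseteq> rcosets ?A" using g yG rcosetsI[OF A.subset] by auto
    from card_mono[OF finite_rcosets[OF fin A.subgroup_axioms] this]
    have "card (?f ` {..i}) \<le> i" using cR by simp
    then have "\<not> inj_on ?f {..i}" using card_image[of ?f "{..i}"] by auto
    then obtain b c where bc: "b \<le> i" "c \<le> i" "b \<noteq> c" "?f b = ?f c" by (auto simp: inj_on_def)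
    have *: "g \<otimes> y \<otimes> inv g \<in> ?A" if bc: "b < c" "c \<le> i" "?f b = ?f c" for b c
    proof -
      have "g \<otimes> y [^] c \<in> ?A #> (g \<otimes> y [^] b)"
        using bc(3) rcos_self[OF _ A.subgroup_axioms, of "g \<otimes> y [^] c"] g yG by simp
      then have "g \<otimes> y [^] c \<otimes> inv (g \<otimes> y [^] b) \<in> ?A"
        using A.rcos_module_imp[OF group_axioms, of "g \<otimes> y [^] b"] g yG by simp
      moreover have "y [^] c = y [^] (c - b) \<otimes> y [^] b" using bc yG by (simp add: nat_pow_mult)
      moreover have "g \<otimes> (y [^] (c - b) \<otimes> y [^] b) \<otimes> inv (g \<otimes> y [^] b)
          = g \<otimes> y [^] (c - b) \<otimes> (y [^] b \<otimes> inv (y [^] b)) \<otimes> inv g"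
        using g yG by (simp only: inv_mult_group m_assoc m_closed inv_closed nat_pow_closed)
      ultimately have mem: "g \<otimes> y [^] (c - b) \<otimes> inv g \<in> ?A" using g yG by simp
      have "coprime (c - b) (p ^ a)" using copi[of "c - b"] bc i(2) by (simp add: coprime_commute)
      then obtain e where e: "[(c - b) * e = 1] (mod p ^ a)"
        using cong_solve_coprime_nat[of "c - b" "p ^ a"] by auto
      have "y [^] ((c - b) * e) = y"
      proof -
        have "int (ord y) dvd int 1 - int ((c - b) * e)"
          using e oy by (metis cong_iff_dvd_diff cong_int_iff cong_sym)
        then have "y [^] int ((c - b) * e) = y [^] int 1" using int_pow_eq[OF yG] by blast
        then show ?thesis using yG by (simp only: int_pow_int nat_pow_eone)
      qed
      then have "(g \<otimes> y [^] (c - b) \<otimes> inv g) [^] e = g \<otimes> y \<otimes> inv g"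
        using conj_pow[OF g, of "y [^] (c - b)" e] yG by (simp add: nat_pow_pow)
      then show ?thesis using subgroup_pow_closed[OF A.subgroup_axioms mem, of e] by simp
    qed
    show ?thesis using *[of b c] *[of c b] bc by (cases "b < c") auto
  qed
  have normal: "generate G {y} \<lhd> G"
  proof (rule normal_invI[OF subgroup_generate_single[OF yG]])
    fix g h assume g: "g \<in> carrier G" and h: "h \<in> generate G {y}"
    obtain j :: nat where j: "h = y [^] j" using h mem_generate_iff[OF fin yG] by blast
    have "g \<otimes> y \<otimes> inv g \<in> generate G {y}"
      by (rule mem_generate_of_ord_dvd[OF fin x yA conjA[OF g]]) (use ord_conj[OF g yG] in simp)
    from subgroup_pow_closed[OF subgroup_generate_single[OF yG] this, of j]
    show "g \<otimes> h \<otimes> inv g \<in> generate G {y}" using conj_pow[OF g yG, of j] j by simp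
  qed
  have "order (G Mod generate G {y}) * p ^ a = m * p ^ a"
    using lagrange[OF subgroup_generate_single[OF yG]] am(1) generate_pow_card[OF yG] oy
    by (simp add: order_def FactGroup_def mult.commute)
  then have "order (G Mod generate G {y}) = m" using pa prime_gt_0_nat[OF p(1)] by simp
  moreover have "coprime (p ^ a) m" using am(2) p(1) by (simp add: prime_imp_coprime)
  ultimately show ?thesis using that[OF yG normal] oy pa by simp
qed

lemma (in group_hom) psi_bij:
  assumes "bij_betw h (carrier G) (carrier H)"
  shows "psi k H = psi k G"
proof -
  have inj: "inj_on h (carrier G)" using assms by (simp add: bij_betw_def)
  have "psi k H = (\<Sum>g\<in>carrier G. group.ord H (h g) ^ k)"
    unfolding psi_def by (rule sum.reindex_bij_betw[OF assms, symmetric])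
  also have "\<dots> = psi k G" unfolding psi_def by (intro sum.cong refl) (simp add: ord_inj[OF inj])
  finally show ?thesis .
qed

text \<open>The carrier type of G is arbitrary while \<open>IH\<close> speaks of
  \<open>nat monoid\<close>, so this serves both as the induction step over the naturals and as the
  final passage to any group.\<close>

lemma (in group) psi_le_step:
  assumes fin: "finite (carrier G)" and ns: "\<not> solvable G" and k: "k \<ge> 4"
    and IH: "\<And>(H :: nat monoid). \<lbrakk>group H; finite (carrier H); \<not> solvable H; order H < order G\<rbrakk>
      \<Longrightarrow> psi_Z60 k * psi k H \<le> psi_A5 k * cyclic_psi k (order H)"
  shows "psi_Z60 k * psi k G \<le> psi_A5 k * cyclic_psi k (order G)"
proof (rule ccontr)
  assume neg: "\<not> ?thesis"
  let ?n = "order G"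
  have n: "?n > 0" using fin order_gt_0_iff_finite by simp
  have "carrier G \<noteq> {}" using one_closed by blast
  then obtain x where x: "x \<in> carrier G" "\<And>g. g \<in> carrier G \<Longrightarrow> ord g \<le> ord x"
  proof -
    have "Max (ord ` carrier G) \<in> ord ` carrier G" using fin \<open>carrier G \<noteq> {}\<close> by (intro Max_in) auto
    then obtain x where "x \<in> carrier G" "ord x = Max (ord ` carrier G)" by auto
    then show ?thesis using that fin by simp
  qed
  define i where "i = ?n div ord x"
  have i: "?n = i * ord x" using ord_dvd_group_order[OF x(1)] by (simp add: i_def)
  have i16: "i \<ge> 16"
    using psi_le_of_small_index[OF fin ns x(1) i, of k] neg by (cases "i \<le> 15") auto
  have "psi k G \<le> (\<Sum>g\<in>carrier G. ord x ^ k)"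
    unfolding psi_def by (intro sum_mono power_mono x(2)) simp_all
  then have "psi k G \<le> ?n * ord x ^ k" by (simp add: order_def)
  then have "i ^ k * psi k G \<le> i ^ k * (?n * ord x ^ k)" by simp
  also have "\<dots> = ?n ^ Suc k"
  proof -
    have "?n ^ k = i ^ k * ord x ^ k" using arg_cong[OF i, of "\<lambda>m. m ^ k"] by (simp only: power_mult_distrib)
    then show ?thesis by simp
  qed
  finally have "real (i ^ k * psi k G) \<le> real (?n ^ Suc k)" by (simp only: of_nat_le_iff)
  then have "real i ^ k * psi k G \<le> real ?n ^ Suc k" by simp
  then have "psi_Z60 k * (real i ^ k * psi k G) \<le> psi_Z60 k * real ?n ^ Suc k"
    using psi_Z60_pos[of k] by (intro mult_left_mono) auto
  moreover have "real i ^ k * (psi_A5 k * cyclic_psi k ?n) < real i ^ k * (psi_Z60 k * psi k G)"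
    using neg i16 by (intro mult_strict_left_mono) auto
  \<comment> \<open>The failing bound combined with psi_k(G) being at most n (n/i)^k. With
    \<open>mono\<close>, it contradicts the numerical bounds for any base j not exceeding i: 16 when
    all primes are at most 13, and the largest prime p if p were at most i.\<close>
  ultimately have key: "real i ^ k * psi_A5 k * cyclic_psi k ?n < psi_Z60 k * real ?n ^ Suc k"
    by (simp add: ac_simps)
  have mono: "real j ^ k * psi_A5 k * cyclic_psi k ?n \<le> real i ^ k * psi_A5 k * cyclic_psi k ?n" if "j \<le> i" for j
    using that psi_A5_pos[of k] by (intro mult_right_mono power_mono) auto
  have "\<not> (\<forall>q\<in>prime_factors ?n. q \<le> 13)"
  proof
    assume "\<forall>q\<in>prime_factors ?n. q \<le> 13"
    then show False using cyclic_psi_ge_small[OF k n] mono[OF i16] key by simp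
  qed
  then obtain q where q: "q \<in> prime_factors ?n" "q > 13" by auto
  define p where "p = Max (prime_factors ?n)"
  have p: "p \<in> prime_factors ?n" and pmax: "\<And>q. q \<in> prime_factors ?n \<Longrightarrow> q \<le> p"
    using q by (auto simp: p_def intro!: Max_in)
  have pp: "Factorial_Ring.prime p" "p dvd ?n" using p by auto
  have "p > 13" using pmax[OF q(1)] q(2) by simp
  then have p17: "p \<ge> 17"
  proof -
    have False if "p < 17"
    proof -
      have "p \<in> {2, 3, 5, 7, 11, 13, 17}" using prime_cases_le_17[OF pp(1)] that by simp
      then show False using that \<open>p > 13\<close> by auto
    qed
    then show ?thesis by (meson not_le)
  qed
  have "i < p"
  proof (rule ccontr)
    assume "\<not> i < p"
    then show False using cyclic_psi_ge_prime_power[OF k n p17 pmax] mono[of p] key by simp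
  qed
  then obtain y where y: "y \<in> carrier G" "generate G {y} \<lhd> G" "ord y > 1"
    "coprime (ord y) (order (G Mod generate G {y}))"
    using normal_cyclic_sylow[OF fin x(1) i _ pp] by blast
  let ?Q = "G Mod generate G {y}"
  interpret K: normal "generate G {y}" G by (rule y(2))
  interpret Q: group ?Q by (rule K.factorgroup_is_group)
  interpret KG: group "G\<lparr>carrier := generate G {y}\<rparr>" using subgroup_imp_group[OF K.subgroup_axioms] .
  have finQ: "finite (carrier ?Q)" using fin by (simp add: carrier_FactGroup)
  have yK: "y \<in> generate G {y}" by (simp add: generate.incl)
  have "solvable (G\<lparr>carrier := generate G {y}\<rparr>)"
    by (rule KG.cyclic_imp_solvable[of y])
      (use yK ord_subgroup[OF K.subgroup_axioms yK] generate_pow_card[OF y(1)] finite_subset[OF K.subset fin]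
        in \<open>auto simp: order_def\<close>)
  then have nsQ: "\<not> solvable ?Q" using solvable_of_normal[OF y(2)] ns by blast
  have oQ: "?n = ord y * order ?Q"
    using lagrange[OF K.subgroup_axioms] generate_pow_card[OF y(1)] by (simp add: order_def FactGroup_def mult.commute)
  have oQpos: "order ?Q > 0" using oQ n by (cases "order ?Q") auto
  obtain N :: "nat monoid" and f where N: "group N" "group_hom ?Q N f" "bij_betw f (carrier ?Q) (carrier N)"
    using Q.ex_nat_group[OF finQ] by metis
  interpret f: group_hom ?Q N f by fact
  have injf: "inj_on f (carrier ?Q)" using N(3) by (simp add: bij_betw_def)
  have oN: "order N = order ?Q" using bij_betw_same_card[OF N(3)] by (simp add: order_def)
  have "psi_Z60 k * psi k N \<le> psi_A5 k * cyclic_psi k (order N)"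
  proof (rule IH[OF N(1)])
    show "finite (carrier N)" using bij_betw_finite[OF N(3)] finQ by simp
    show "\<not> solvable N" using f.inj_hom_imp_solvable[OF injf] nsQ by blast
    show "order N < ?n" using oN oQ oQpos y(3) by simp
  qed
  then have Q: "psi_Z60 k * psi k ?Q \<le> psi_A5 k * cyclic_psi k (order ?Q)"
    using f.psi_bij[OF N(3)] oN by simp
  have "real (psi k G) \<le> real (cyclic_psi k (ord y) * psi k ?Q)"
    using psi_le_of_coprime_normal[OF fin y(1,2,4), of k] by (simp only: of_nat_le_iff)
  then have "psi_Z60 k * psi k G \<le> psi_Z60 k * (cyclic_psi k (ord y) * psi k ?Q)"
    using psi_Z60_pos[of k] by (intro mult_left_mono) auto
  also have "\<dots> = cyclic_psi k (ord y) * (psi_Z60 k * psi k ?Q)" by simp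
  also have "\<dots> \<le> cyclic_psi k (ord y) * (psi_A5 k * cyclic_psi k (order ?Q))"
    using Q by (intro mult_left_mono) auto
  also have "\<dots> = psi_A5 k * cyclic_psi k ?n"
    using cyclic_psi_mult_coprime[OF y(4) _ oQpos, of k] y(3) oQ by simp
  finally show False using neg by simp
qed

lemma psi_le_nat:
  fixes G :: "nat monoid"
  assumes "group G" "finite (carrier G)" "\<not> solvable G" "k \<ge> 4"
  shows "psi_Z60 k * psi k G \<le> psi_A5 k * cyclic_psi k (order G)"
  using assms
proof (induction "order G" arbitrary: G rule: less_induct)
  case less
  interpret group G by fact
  show ?case by (rule psi_le_step[OF less.prems(2,3,4)]) (use less in blast)
qed

lemma (in group) solvable_of_psi_gt:
  assumes fin: "finite (carrier G)" and k: "k \<ge> 4"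
    and gt: "real (psi k G) > psi_A5 k / psi_Z60 k * real (psi k (integer_mod_group (order G)))"
  shows "solvable G"
proof (rule ccontr)
  assume ns: "\<not> solvable G"
  have n: "order G > 0" using fin order_gt_0_iff_finite by simp
  have "psi_Z60 k * psi k G \<le> psi_A5 k * cyclic_psi k (order G)"
    by (rule psi_le_step[OF fin ns k]) (use psi_le_nat k in blast)
  then show False using gt psi_Z60_pos[of k] psi_integer_mod_group[OF n, of k]
    by (simp add: field_simps)
qed

theorem theorem1p5:
  fixes G :: "('a, 'b) monoid_scheme" and n p :: nat
  assumes "group G"
    and "finite (carrier G)"
    and "Coset.order G = n"
    and "p \<in> prime_factors n"
    and "\<forall>q \<in> prime_factors n. q \<le> p"
  shows "(p > 7 \<longrightarrow>
      (\<exists>k::nat. k \<ge> 4 \<and>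
        real (psi k G) >
          (1 + 15 * 2 ^ k + 20 * 3 ^ k + 24 * 5 ^ k)
            / ((1 + 2 ^ k + 2 * 4 ^ k) * (1 + 2 * 3 ^ k) * (1 + 4 * 5 ^ k))
            * real (psi k (integer_mod_group n))) \<longrightarrow>
      solvable G) \<and>
    (p = 7 \<longrightarrow>
      (\<exists>k::nat. k \<ge> 13 \<and>
        real (psi k G) >
          (1 + 15 * 2 ^ k + 20 * 3 ^ k + 24 * 5 ^ k)
            / ((1 + 2 ^ k + 2 * 4 ^ k) * (1 + 2 * 3 ^ k) * (1 + 4 * 5 ^ k))
            * real (psi k (integer_mod_group n))) \<longrightarrow>
      solvable G)"
proof -
  interpret group G by fact
  note crit = solvable_of_psi_gt[OF assms(2), unfolded assms(3) psi_A5_def psi_Z60_def]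
  show ?thesis
  proof (intro conjI impI)
    show "solvable G" if "\<exists>k::nat. k \<ge> 4 \<and>
        real (psi k G) >
          (1 + 15 * 2 ^ k + 20 * 3 ^ k + 24 * 5 ^ k)
            / ((1 + 2 ^ k + 2 * 4 ^ k) * (1 + 2 * 3 ^ k) * (1 + 4 * 5 ^ k))
            * real (psi k (integer_mod_group n))"
      using that crit by blast
    show "solvable G" if "\<exists>k::nat. k \<ge> 13 \<and>
        real (psi k G) >
          (1 + 15 * 2 ^ k + 20 * 3 ^ k + 24 * 5 ^ k)
            / ((1 + 2 ^ k + 2 * 4 ^ k) * (1 + 2 * 3 ^ k) * (1 + 4 * 5 ^ k))
            * real (psi k (integer_mod_group n))"
    proof -
      from that obtain k where "k \<ge> 13" and k: "real (psi k G) >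
          (1 + 15 * 2 ^ k + 20 * 3 ^ k + 24 * 5 ^ k)
            / ((1 + 2 ^ k + 2 * 4 ^ k) * (1 + 2 * 3 ^ k) * (1 + 4 * 5 ^ k))
            * real (psi k (integer_mod_group n))" by blast
      then have "k \<ge> 4" by simp
      from crit[OF this k] show ?thesis .
    qed
  qed
qed

end
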